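(* Let $H$ and $U$ be two (real or complex) Hilbert spaces. Let $A_0:D(A_0)\subset H\longrightarrow H$ be the generator of a $C_0$-semigroup on $H$ and let $B\in\mathcal{L}(U,D(A_0^* )')$ be an admissible control operator for $A_0$. Let $K\in\mathcal{L}(H)$ and let $A_K=A_0+K$ with $D(A_K)=D(A_0)$ (then $A_K$ generates a $C_0$-semigroup on $H$ and $B$ is also admissible for $A_K$). Assume that: (i) there exists $T_0>0$ such that $(A_0,B)$ is exactly controllable in time $T_0$; (ii) $K$ is compact; (iii) $(A_K,B)$ is approximately controllable in time $T_0$. Then $(A_K,B)$ is exactly controllable in time $T_0$.
   Context: Let $H,U$ be Hilbert spaces, $A:D(A)\subset H\to H$ the generator of a $C_0$-semigroup $(S_A(t))_{t\ge 0}$ on $H$, and $B\in\mathcal{L}(U,D(A^* )')$, where $D(A^* )$ carries the graph norm and $D(A^* )'$ is its dual with respect to the pivot space $H$ (so $D(A^* )\subset H\subset D(A^* )'$, and $S_A(t)$ extends to a $C_0$-semigroup on $D(A^* )'$). For $T\ge 0$ the input map $\Phi_T\in\mathcal{L}(L^2(0,+\infty;U),D(A^* )')$ of $(A,B)$ is $\Phi_T u=\int_0^T S_A(T-s)Bu(s)\,ds$. The operator $B$ is admissible for $A$ if $\mathrm{Im}\,\Phi_T\subset H$ for some (equivalently all) $T>0$; then $\Phi_T\in\mathcal{L}(L^2(0,+\infty;U),H)$. For $B$ admissible, the system $\frac{d}{dt}y=Ay+Bu$ on $(0,T)$, $y(0)=y^0\in H$, with $u\in L^2(0,T;U)$, has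 the unique solution $y\in C^0([0,T];H)$ given by $y(t)=S_A(t)y^0+\Phi_t u$. $(A,B)$ is exactly controllable in time $T>0$ if for every $y^0,y^1\in H$ there is $u\in L^2(0,T;U)$ with $y(T)=y^1$; it is approximately controllable in time $T$ if for every $\varepsilon>0$ and $y^0,y^1\in H$ there is $u\in L^2(0,T;U)$ with $\|y(T)-y^1\|_H\le\varepsilon$. *)

theory Defs
  imports "HOL-Analysis.Analysis"
begin

section \<open>Scalars and Hilbert spaces\<close>

text \<open>
  The scalar field is \<open>\<real>\<close> or \<open>\<complex>\<close>. A commutative real normed field with multiplicative norm is
  isometrically isomorphic to one of these, and the law for \<open>kcnj z * z\<close> forces \<open>kcnj\<close> to be the
  usual conjugation.
\<close>

class real_or_complex = real_normed_field + euclidean_space +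
  fixes kcnj :: "'a \<Rightarrow> 'a"
  assumes kcnj_add: "kcnj (x + y) = kcnj x + kcnj y"
    and kcnj_mult: "kcnj (x * y) = kcnj x * kcnj y"
    and kcnj_mult_self: "kcnj x * x = (norm x)\<^sup>2 *\<^sub>R 1"

instantiation real :: real_or_complex
begin
definition kcnj_real :: "real \<Rightarrow> real" where "kcnj_real x = x"
instance by standard (simp_all add: kcnj_real_def power2_eq_square)
end

instantiation complex :: real_or_complex
begin
definition kcnj_complex :: "complex \<Rightarrow> complex" where "kcnj_complex = cnj"
instance
  by standard (simp_all add: kcnj_complex_def scaleR_conv_of_real complex_norm_square mult.commute
      del: of_real_power)
end

text \<open>
  A Hilbert space over \<open>'k\<close>: the type class \<open>banach\<close> supplies the complete norm, \<open>scal\<close> the scalar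
  multiplication and \<open>ip\<close> the inner product, linear in its first argument.
\<close>

locale hilbert_space = vector_space scal
  for scal :: "'k::real_or_complex \<Rightarrow> 'h::banach \<Rightarrow> 'h" +
  fixes ip :: "'h \<Rightarrow> 'h \<Rightarrow> 'k"
  assumes scale_of_real: "scal (of_real r) x = r *\<^sub>R x"
    and ip_add_left: "ip (x + y) z = ip x z + ip y z"
    and ip_scale_left: "ip (scal c x) z = c * ip x z"
    and ip_commute: "ip y x = kcnj (ip x y)"
    and ip_self: "ip x x = of_real ((norm x)\<^sup>2)"

lemma hilbert_space_real:
  "hilbert_space scaleR (inner :: 'h::{real_inner,banach} \<Rightarrow> 'h \<Rightarrow> real)"
  by unfold_locales
    (simp_all add: algebra_simps kcnj_real_def inner_commute power2_norm_eq_inner)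

lemma hilbert_space_complex: "hilbert_space (*) (\<lambda>x y. x * cnj y)"
  by unfold_locales
    (simp_all add: algebra_simps kcnj_complex_def scaleR_conv_of_real complex_norm_square
      del: of_real_power)

definition bounded_operator ::
    "('k::field \<Rightarrow> 'h::real_normed_vector \<Rightarrow> 'h) \<Rightarrow> ('h \<Rightarrow> 'h) \<Rightarrow> bool" where
  "bounded_operator scal V \<longleftrightarrow>
     Vector_Spaces.linear scal scal V \<and> (\<exists>C. \<forall>x. norm (V x) \<le> C * norm x)"

definition compact_operator :: "('h::real_normed_vector \<Rightarrow> 'h) \<Rightarrow> bool" where
  "compact_operator V \<longleftrightarrow> (\<forall>S. bounded S \<longrightarrow> compact (closure (V ` S)))"

section \<open>Semigroups and generators\<close>

definition C0_semigroup ::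
    "('k::field \<Rightarrow> 'h::real_normed_vector \<Rightarrow> 'h) \<Rightarrow> (real \<Rightarrow> 'h \<Rightarrow> 'h) \<Rightarrow> bool" where
  "C0_semigroup scal S \<longleftrightarrow>
     (\<forall>t\<ge>0. bounded_operator scal (S t)) \<and>
     S 0 = id \<and>
     (\<forall>s\<ge>0. \<forall>t\<ge>0. S (s + t) = S s \<circ> S t) \<and>
     (\<forall>x. ((\<lambda>t. S t x) \<longlongrightarrow> x) (at_right 0))"

text \<open>
  An unbounded operator is given by its domain \<open>D\<close> and a function \<open>A\<close>, of which only the values on
  \<open>D\<close> matter.
\<close>

definition generates ::
    "('k::field \<Rightarrow> 'h::real_normed_vector \<Rightarrow> 'h) \<Rightarrow> 'h set \<Rightarrow> ('h \<Rightarrow> 'h) \<Rightarrow>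
      (real \<Rightarrow> 'h \<Rightarrow> 'h) \<Rightarrow> bool" where
  "generates scal D A S \<longleftrightarrow>
     C0_semigroup scal S \<and>
     D = {x. \<exists>y. ((\<lambda>t. (1 / t) *\<^sub>R (S t x - x)) \<longlongrightarrow> y) (at_right 0)} \<and>
     (\<forall>x\<in>D. ((\<lambda>t. (1 / t) *\<^sub>R (S t x - x)) \<longlongrightarrow> A x) (at_right 0))"

definition is_generator ::
    "('k::field \<Rightarrow> 'h::real_normed_vector \<Rightarrow> 'h) \<Rightarrow> 'h set \<Rightarrow> ('h \<Rightarrow> 'h) \<Rightarrow> bool" where
  "is_generator scal D A \<longleftrightarrow> (\<exists>S. generates scal D A S)"

text \<open>
  A generator determines its semigroup for \<open>t \<ge> 0\<close>; the values at \<open>t < 0\<close> are arbitrary and never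
  used, hence \<open>SOME\<close> rather than \<open>THE\<close>.
\<close>

definition semigroup_of ::
    "('k::field \<Rightarrow> 'h::real_normed_vector \<Rightarrow> 'h) \<Rightarrow> 'h set \<Rightarrow> ('h \<Rightarrow> 'h) \<Rightarrow>
      real \<Rightarrow> 'h \<Rightarrow> 'h" where
  "semigroup_of scal D A = (SOME S. generates scal D A S)"

section \<open>The adjoint and the space \<open>D(A\<^sup>*)'\<close>\<close>

definition adj_domain :: "('h \<Rightarrow> 'h \<Rightarrow> 'k) \<Rightarrow> 'h set \<Rightarrow> ('h \<Rightarrow> 'h) \<Rightarrow> 'h set" where
  "adj_domain ip D A = {\<phi>. \<exists>\<psi>. \<forall>x\<in>D. ip (A x) \<phi> = ip x \<psi>}"

definition adj :: "('h \<Rightarrow> 'h \<Rightarrow> 'k) \<Rightarrow> 'h set \<Rightarrow> ('h \<Rightarrow> 'h) \<Rightarrow> 'h \<Rightarrow> 'h" where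
  "adj ip D A \<phi> = (THE \<psi>. \<forall>x\<in>D. ip (A x) \<phi> = ip x \<psi>)"

definition graph_norm ::
    "('h::real_normed_vector \<Rightarrow> 'h \<Rightarrow> 'k) \<Rightarrow> 'h set \<Rightarrow> ('h \<Rightarrow> 'h) \<Rightarrow> 'h \<Rightarrow> real" where
  "graph_norm ip D A \<phi> = norm \<phi> + norm (adj ip D A \<phi>)"

text \<open>
  Elements of \<open>D(A\<^sup>*)'\<close> are the bounded \<^emph>\<open>conjugate-linear\<close> functionals on \<open>D(A\<^sup>*)\<close> (over \<open>\<real>\<close>: the
  linear ones), so that the pivot embedding \<open>x \<mapsto> \<langle>x, \<cdot>\<rangle>\<close> of \<open>H\<close> is linear. They are extended by \<open>0\<close>
  off \<open>D(A\<^sup>*)\<close>, so that equal functionals are equal functions; the vector space operations are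
  pointwise.
\<close>

definition dual_space ::
    "('k::real_or_complex \<Rightarrow> 'h::real_normed_vector \<Rightarrow> 'h) \<Rightarrow> ('h \<Rightarrow> 'h \<Rightarrow> 'k) \<Rightarrow>
      'h set \<Rightarrow> ('h \<Rightarrow> 'h) \<Rightarrow> ('h \<Rightarrow> 'k) set" where
  "dual_space scal ip D A =
     {F. (\<forall>\<phi>\<in>adj_domain ip D A. \<forall>\<psi>\<in>adj_domain ip D A. F (\<phi> + \<psi>) = F \<phi> + F \<psi>) \<and>
         (\<forall>c. \<forall>\<phi>\<in>adj_domain ip D A. F (scal c \<phi>) = kcnj c * F \<phi>) \<and>
         (\<exists>C. \<forall>\<phi>\<in>adj_domain ip D A. norm (F \<phi>) \<le> C * graph_norm ip D A \<phi>) \<and>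
         (\<forall>\<phi>. \<phi> \<notin> adj_domain ip D A \<longrightarrow> F \<phi> = 0)}"

definition dual_norm ::
    "('h::real_normed_vector \<Rightarrow> 'h \<Rightarrow> 'k::real_normed_vector) \<Rightarrow> 'h set \<Rightarrow> ('h \<Rightarrow> 'h) \<Rightarrow>
      ('h \<Rightarrow> 'k) \<Rightarrow> real" where
  "dual_norm ip D A F =
     (SUP \<phi>\<in>{\<phi> \<in> adj_domain ip D A. graph_norm ip D A \<phi> \<le> 1}. norm (F \<phi>))"

definition pivot_embed ::
    "('h \<Rightarrow> 'h \<Rightarrow> 'k::zero) \<Rightarrow> 'h set \<Rightarrow> ('h \<Rightarrow> 'h) \<Rightarrow> 'h \<Rightarrow> 'h \<Rightarrow> 'k" where
  "pivot_embed ip D A x = (\<lambda>\<phi>. if \<phi> \<in> adj_domain ip D A then ip x \<phi> else 0)"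

text \<open>
  The continuous extension of \<open>V = S\<^sub>A(t)\<close> from \<open>H\<close> to \<open>D(A\<^sup>*)'\<close>: its Hilbert adjoint
  \<open>V\<^sup>* = adj ip UNIV V\<close> maps \<open>D(A\<^sup>*)\<close> boundedly into itself, and \<open>\<langle>V x, \<phi>\<rangle> = \<langle>x, V\<^sup>* \<phi>\<rangle>\<close> for \<open>x \<in> H\<close>
  extends to \<open>D(A\<^sup>*)'\<close>. The extension is unique because \<open>H\<close> is dense in \<open>D(A\<^sup>*)'\<close>.
\<close>

definition extended_op ::
    "('h \<Rightarrow> 'h \<Rightarrow> 'k::zero) \<Rightarrow> 'h set \<Rightarrow> ('h \<Rightarrow> 'h) \<Rightarrow> ('h \<Rightarrow> 'h) \<Rightarrow> ('h \<Rightarrow> 'k) \<Rightarrow> 'h \<Rightarrow> 'k" where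
  "extended_op ip D A V F = (\<lambda>\<phi>. if \<phi> \<in> adj_domain ip D A then F (adj ip UNIV V \<phi>) else 0)"

definition control_operator ::
    "('k::real_or_complex \<Rightarrow> 'h::real_normed_vector \<Rightarrow> 'h) \<Rightarrow> ('h \<Rightarrow> 'h \<Rightarrow> 'k) \<Rightarrow>
      ('k \<Rightarrow> 'u::real_normed_vector \<Rightarrow> 'u) \<Rightarrow> 'h set \<Rightarrow> ('h \<Rightarrow> 'h) \<Rightarrow> ('u \<Rightarrow> 'h \<Rightarrow> 'k) \<Rightarrow> bool" where
  "control_operator scal ip scalU D A B \<longleftrightarrow>
     (\<forall>u. B u \<in> dual_space scal ip D A) \<and>
     (\<forall>u v \<phi>. B (u + v) \<phi> = B u \<phi> + B v \<phi>) \<and>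
     (\<forall>c u \<phi>. B (scalU c u) \<phi> = c * B u \<phi>) \<and>
     (\<exists>C. \<forall>u. dual_norm ip D A (B u) \<le> C * norm u)"

section \<open>Controls, solutions and controllability\<close>

text \<open>
  \<open>U\<close> need not be separable, so measurability is strong measurability: \<open>measurable_on\<close> asks for an
  almost everywhere limit of continuous functions. Elements of \<open>L\<^sup>2\<close> are represented by functions.
\<close>

definition L2_on :: "real set \<Rightarrow> (real \<Rightarrow> 'u::real_normed_vector) set" where
  "L2_on I = {u. u measurable_on I \<and> set_integrable lebesgue I (\<lambda>t. (norm (u t))\<^sup>2)}"

text \<open>
  The integral of a \<open>D(A\<^sup>*)'\<close>-valued function is the functional whose value at each \<open>\<phi> \<in> D(A\<^sup>*)\<close> is
  the integral of the values at \<open>\<phi>\<close>.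
\<close>

definition input_map ::
    "('k::real_or_complex \<Rightarrow> 'h::real_normed_vector \<Rightarrow> 'h) \<Rightarrow> ('h \<Rightarrow> 'h \<Rightarrow> 'k) \<Rightarrow>
      'h set \<Rightarrow> ('h \<Rightarrow> 'h) \<Rightarrow> ('u \<Rightarrow> 'h \<Rightarrow> 'k) \<Rightarrow> real \<Rightarrow> (real \<Rightarrow> 'u) \<Rightarrow> 'h \<Rightarrow> 'k" where
  "input_map scal ip D A B T u =
     (\<lambda>\<phi>. LINT s:{0<..<T}|lebesgue.
             extended_op ip D A (semigroup_of scal D A (T - s)) (B (u s)) \<phi>)"

definition admissible ::
    "('k::real_or_complex \<Rightarrow> 'h::real_normed_vector \<Rightarrow> 'h) \<Rightarrow> ('h \<Rightarrow> 'h \<Rightarrow> 'k) \<Rightarrow>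
      ('k \<Rightarrow> 'u::real_normed_vector \<Rightarrow> 'u) \<Rightarrow> 'h set \<Rightarrow> ('h \<Rightarrow> 'h) \<Rightarrow> ('u \<Rightarrow> 'h \<Rightarrow> 'k) \<Rightarrow> bool" where
  "admissible scal ip scalU D A B \<longleftrightarrow>
     control_operator scal ip scalU D A B \<and>
     (\<exists>T>0. input_map scal ip D A B T ` L2_on {0<..} \<subseteq> range (pivot_embed ip D A))"

text \<open>
  For admissible \<open>B\<close> the \<open>THE\<close> below is the element of \<open>H\<close> identified with \<open>\<Phi>\<^sub>t u\<close>; it is unique since
  \<open>D(A\<^sup>*)\<close> is dense in \<open>H\<close>.
\<close>

definition solution ::
    "('k::real_or_complex \<Rightarrow> 'h::real_normed_vector \<Rightarrow> 'h) \<Rightarrow> ('h \<Rightarrow> 'h \<Rightarrow> 'k) \<Rightarrow>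
      'h set \<Rightarrow> ('h \<Rightarrow> 'h) \<Rightarrow> ('u \<Rightarrow> 'h \<Rightarrow> 'k) \<Rightarrow> 'h \<Rightarrow> (real \<Rightarrow> 'u) \<Rightarrow> real \<Rightarrow> 'h" where
  "solution scal ip D A B y0 u t =
     semigroup_of scal D A t y0 + (THE h. pivot_embed ip D A h = input_map scal ip D A B t u)"

definition exactly_controllable ::
    "('k::real_or_complex \<Rightarrow> 'h::real_normed_vector \<Rightarrow> 'h) \<Rightarrow> ('h \<Rightarrow> 'h \<Rightarrow> 'k) \<Rightarrow>
      'h set \<Rightarrow> ('h \<Rightarrow> 'h) \<Rightarrow> ('u::real_normed_vector \<Rightarrow> 'h \<Rightarrow> 'k) \<Rightarrow> real \<Rightarrow> bool" where
  "exactly_controllable scal ip D A B T \<longleftrightarrow>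
     (\<forall>y0 y1. \<exists>u\<in>L2_on {0<..<T}. solution scal ip D A B y0 u T = y1)"

definition approximately_controllable ::
    "('k::real_or_complex \<Rightarrow> 'h::real_normed_vector \<Rightarrow> 'h) \<Rightarrow> ('h \<Rightarrow> 'h \<Rightarrow> 'k) \<Rightarrow>
      'h set \<Rightarrow> ('h \<Rightarrow> 'h) \<Rightarrow> ('u::real_normed_vector \<Rightarrow> 'h \<Rightarrow> 'k) \<Rightarrow> real \<Rightarrow> bool" where
  "approximately_controllable scal ip D A B T \<longleftrightarrow>
     (\<forall>\<epsilon>>0. \<forall>y0 y1. \<exists>u\<in>L2_on {0<..<T}. norm (solution scal ip D A B y0 u T - y1) \<le> \<epsilon>)"

end

theory Submission
  imports Defs
begin

text \<open>
  Exact controllability is surjectivity of the input map \<open>\<Phi>\<close> in time \<open>T\<close>, which by uniform boundedness and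
  convex projection is equivalent to an observability inequality: \<open>\<parallel>\<phi>\<parallel>\<close> is at most a multiple of the
  supremum of \<open>Re \<langle>\<Phi> u, \<phi>\<rangle>\<close> over the controls \<open>u\<close> of norm at most \<open>1\<close>. Let \<open>S\<close> and \<open>P\<close> be the
  semigroups generated by \<open>A\<close> and \<open>A + K\<close>, with input maps \<open>\<Phi>\<^sub>S(t)\<close> and \<open>\<Phi>\<^sub>P(t)\<close>. Duhamel's formula gives
  \<open>\<Phi>\<^sub>P(T) u - \<Phi>\<^sub>S(T) u = \<integral>\<^sub>0\<^sup>T P(\<sigma>) K \<Phi>\<^sub>S(T - \<sigma>) u d\<sigma>\<close>, and for compact \<open>K\<close> the vectors \<open>P(\<sigma>) K x\<close>
  with bounded \<open>x\<close> form a relatively compact set. Approximate controllability of the perturbed system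
  covers this set by finitely many small balls around reachable states, so the observability
  inequality of the unperturbed system carries over to the perturbed one, with the error absorbed
  into \<open>\<parallel>\<phi>\<parallel>\<close>.
\<close>

section \<open>Scalars and Hilbert space geometry\<close>

text \<open>Since \<open>B\<close> takes values in the dual of \<open>Dstar\<close>, neither
  Duhamel's formula nor Fubini's theorem applies directly to the input maps. \<open>B\<close> is
  therefore replaced by bounded operators \<open>Bn n\<close>, its compositions with the adjoint of
  the orbit mean over [0, 1/(n+1)]. This adjoint commutes with the adjoint semigroup of
  \<open>S\<close> and with \<open>Astar\<close>, so the comparison holds for every n with constants
  independent of n and survives the limit. Admissibility only says that each single \<Phi> u lies in
  H; a uniform bound comes from a gliding hump over controls, and the comparison carries that bound
  over to the perturbed system. The absorption works because the covering radius is fixed before the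
  controls: with radius of order 1/(C0 T + 1) the error is at most half of the norm of \<phi>,
  whereas the size of the finitely many controls that nearly reach the ball centres only enters the
  constant in front of the supremum.\<close>

lemma kcnj_0 [simp]: "kcnj (0::'k::real_or_complex) = 0"
  using kcnj_add[of 0 "0::'k"] by simp

lemma kcnj_of_real [simp]: "kcnj (of_real r :: 'k::real_or_complex) = of_real r"
proof (cases "r = 0")
  case False
  have "kcnj (of_real r :: 'k) * of_real r = of_real r * of_real r"
    using kcnj_mult_self[of "of_real r :: 'k"]
    by (simp add: scaleR_conv_of_real power2_eq_square)
  then show ?thesis using False by simp
qed simp

text \<open>The number \<open>kcnj c * c\<close> is real, hence fixed by \<open>kcnj\<close>;
  cancelling \<open>kcnj c\<close> from the resulting equation of products gives the claim.\<close>

lemma kcnj_kcnj [simp]: "kcnj (kcnj c) = (c :: 'k::real_or_complex)"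
proof (cases "c = 0")
  case False
  then have n: "kcnj c \<noteq> 0"
    using kcnj_mult_self[of c] by auto
  have "kcnj (kcnj c) * kcnj c = kcnj (of_real ((norm c)\<^sup>2) :: 'k)"
    using kcnj_mult[of "kcnj c" c] kcnj_mult_self[of c] by (simp add: scaleR_conv_of_real)
  also have "\<dots> = c * kcnj c"
    using kcnj_mult_self[of c] by (simp only: kcnj_of_real) (simp add: scaleR_conv_of_real mult.commute)
  finally show ?thesis using n by simp
qed simp

lemma norm_kcnj [simp]: "norm (kcnj c) = norm (c :: 'k::real_or_complex)"
proof (cases "c = 0")
  case False
  have "norm (kcnj c) * norm c = (norm c)\<^sup>2"
    using arg_cong[OF kcnj_mult_self[of c], of norm] by (simp add: norm_mult)
  then show ?thesis using False by (simp add: power2_eq_square)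
qed simp

text \<open>The real part of a scalar is its inner product with \<open>1\<close> in the Euclidean space \<open>'k\<close>.\<close>

lemma add_kcnj: "c + kcnj c = of_real (2 * (c \<bullet> 1))" for c :: "'k::real_or_complex"
proof -
  \<comment> \<open>The norm law at \<open>c + 1\<close> isolates the linear term
    \<open>c + kcnj c\<close>.\<close>
  have "kcnj (c + 1) * (c + 1) = kcnj c * c + (c + kcnj c) + 1"
    using kcnj_of_real[of 1, where 'k='k] by (simp add: kcnj_add algebra_simps)
  then have "c + kcnj c = of_real ((norm (c + 1))\<^sup>2 - (norm c)\<^sup>2 - 1)"
    using kcnj_mult_self[of c] kcnj_mult_self[of "c + 1"]
    by (simp add: scaleR_conv_of_real algebra_simps del: of_real_power)
  also have "(norm (c + 1))\<^sup>2 - (norm c)\<^sup>2 - 1 = 2 * (c \<bullet> 1)"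
    using power2_norm_eq_inner[of "1::'k"]
    by (simp add: power2_norm_eq_inner algebra_simps inner_commute)
  finally show ?thesis .
qed

lemma inner_1_kcnj [simp]: "kcnj c \<bullet> 1 = c \<bullet> (1 :: 'k::real_or_complex)"
  using add_kcnj[of c] add_kcnj[of "kcnj c"]
  by (metis add.commute kcnj_kcnj mult_cancel_left of_real_eq_iff zero_neq_numeral)

lemma inner_1_1 [simp]: "(1::'k::real_or_complex) \<bullet> 1 = 1"
  using power2_norm_eq_inner[of "1::'k"] by simp

lemma inner_1_le_norm: "c \<bullet> (1::'k::real_or_complex) \<le> norm c"
  using norm_cauchy_schwarz[of c 1] by simp

text \<open>The multiplier \<open>kcnj (c - d)\<close> turns the difference into the squared norm of
  \<open>c - d\<close>. This is how identities of real parts become identities of scalars.\<close>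

lemma scalar_eqI:
  fixes c d :: "'k::real_or_complex"
  assumes "\<And>a. (a * c) \<bullet> 1 = (a * d) \<bullet> 1"
  shows "c = d"
proof -
  have "(kcnj (c - d) * (c - d)) \<bullet> 1 = 0"
    using assms[of "kcnj (c - d)"] by (simp add: right_diff_distrib inner_diff_left)
  then show ?thesis by (simp add: kcnj_mult_self)
qed

lemma norm_le_if_inner_1_le:
  fixes c :: "'k::real_or_complex"
  assumes "\<And>a. norm a = 1 \<Longrightarrow> (a * c) \<bullet> 1 \<le> m" and "0 \<le> m"
  shows "norm c \<le> m"
proof (cases "c = 0")
  case False
  \<comment> \<open>The unit scalar that rotates \<open>c\<close> onto the positive real
    axis.\<close>
  define a where "a = kcnj c /\<^sub>R norm c"
  have "a * c = of_real (norm c)"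
    using False kcnj_mult_self[of c]
    by (simp add: a_def scaleR_conv_of_real power2_eq_square mult.assoc)
  moreover have "norm a = 1" using False by (simp add: a_def)
  ultimately show ?thesis using assms(1)[of a] by simp
qed (use assms in auto)

section \<open>Real inner product, projection and Riesz representation\<close>

context hilbert_space
begin

lemma ip_scaleR_left: "ip (r *\<^sub>R x) y = r *\<^sub>R ip x y"
  using ip_scale_left[of "of_real r" x y] by (simp add: scale_of_real scaleR_conv_of_real)

lemma ip_add_right: "ip x (y + z) = ip x y + ip x z"
  by (metis ip_add_left ip_commute kcnj_add)

lemma ip_scale_right: "ip x (scal c y) = kcnj c * ip x y"
  by (metis ip_commute ip_scale_left kcnj_mult)

lemma ip_scaleR_right: "ip x (r *\<^sub>R y) = r *\<^sub>R ip x y"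
  using ip_scale_right[of x "of_real r" y] by (simp add: scale_of_real scaleR_conv_of_real)

lemma ip_minus_left: "ip (- x) y = - ip x y"
  using ip_scaleR_left[of "-1" x y] by simp

lemma ip_minus_right: "ip x (- y) = - ip x y"
  using ip_scaleR_right[of x "-1" y] by simp

lemma ip_diff_left: "ip (x - y) z = ip x z - ip y z"
  using ip_add_left[of x "- y" z] by (simp add: ip_minus_left)

lemma ip_diff_right: "ip x (y - z) = ip x y - ip x z"
  using ip_add_right[of x y "- z"] by (simp add: ip_minus_right)

lemma ip_zero_left [simp]: "ip 0 y = 0"
  using ip_scaleR_left[of 0 0 y] by simp

lemma ip_zero_right [simp]: "ip x 0 = 0"
  using ip_scaleR_right[of x 0 0] by simp

lemma norm_scal [simp]: "norm (scal c x) = norm c * norm x"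
proof -
  have "of_real ((norm (scal c x))\<^sup>2) = (of_real ((norm c)\<^sup>2 * (norm x)\<^sup>2) :: 'k)"
    unfolding ip_self[symmetric] ip_scale_left ip_scale_right
    using kcnj_mult_self[of c] ip_self[of x]
    by (simp add: scaleR_conv_of_real mult.assoc[symmetric] mult.commute)
  then have "(norm (scal c x))\<^sup>2 = (norm c * norm x)\<^sup>2"
    by (simp add: power_mult_distrib del: of_real_power of_real_mult)
  then show ?thesis by (simp add: power2_eq_iff_nonneg)
qed

text \<open>The real part makes H a real Hilbert space, so that arguments with order, convexity and
  suprema are the same over both scalar fields.\<close>

abbreviation rip :: "'h \<Rightarrow> 'h \<Rightarrow> real" where "rip x y \<equiv> ip x y \<bullet> 1"

lemma rip_commute: "rip x y = rip y x"
  by (metis inner_1_kcnj ip_commute)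

lemma rip_self: "rip x x = (norm x)\<^sup>2"
  by (simp add: ip_self del: of_real_power)

lemmas rip_simps = ip_add_left ip_add_right ip_diff_left ip_diff_right ip_scaleR_left
  ip_scaleR_right ip_minus_left ip_minus_right inner_add_left inner_diff_left

lemma norm_add_sq: "(norm (x + y))\<^sup>2 = (norm x)\<^sup>2 + 2 * rip x y + (norm y)\<^sup>2"
  unfolding rip_self[symmetric] by (simp add: rip_simps rip_commute[of y x])

lemma norm_diff_sq: "(norm (x - y))\<^sup>2 = (norm x)\<^sup>2 - 2 * rip x y + (norm y)\<^sup>2"
  unfolding rip_self[symmetric] by (simp add: rip_simps rip_commute[of y x])

lemma rip_le: "rip x y \<le> norm x * norm y"
proof (cases "x = 0 \<or> y = 0")
  case False
  then have n: "norm x > 0" "norm y > 0" by auto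
  \<comment> \<open>Both vectors have length \<open>norm x * norm y\<close>; the squared distance is
    twice this length times the defect in the Cauchy-Schwarz inequality.\<close>
  have "0 \<le> (norm (norm y *\<^sub>R x - norm x *\<^sub>R y))\<^sup>2" by simp
  also have "\<dots> = 2 * (norm x * norm y) * (norm x * norm y - rip x y)"
    by (subst norm_diff_sq) (simp add: ip_scaleR_left ip_scaleR_right power2_eq_square algebra_simps)
  finally show ?thesis using mult_pos_pos[OF n] by (auto simp add: zero_le_mult_iff)
qed auto

lemma norm_ip_le: "norm (ip x y) \<le> norm x * norm y"
proof (rule norm_le_if_inner_1_le)
  fix a :: 'k assume "norm a = 1"
  then show "(a * ip x y) \<bullet> 1 \<le> norm x * norm y"
    using rip_le[of "scal a x" y] by (simp add: ip_scale_left)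
qed simp

lemma bounded_bilinear_ip: "bounded_bilinear ip"
  by unfold_locales
    (auto simp: ip_add_left ip_add_right ip_scaleR_left ip_scaleR_right
      intro!: exI[of _ 1] norm_ip_le)

lemmas bounded_linear_ip_left = bounded_bilinear.bounded_linear_left[OF bounded_bilinear_ip]
lemmas tendsto_ip = bounded_bilinear.tendsto[OF bounded_bilinear_ip]
lemmas continuous_on_ip = bounded_bilinear.continuous_on[OF bounded_bilinear_ip]

lemma bounded_linear_rip_left: "bounded_linear (\<lambda>x. rip x y)"
  using bounded_linear_compose[OF bounded_linear_inner_left bounded_linear_ip_left] .

lemma rip_eqI: "(\<And>y. rip x y = rip z y) \<Longrightarrow> x = z"
  using rip_self[of "x - z"] by (simp add: rip_simps)

lemma ip_eqI: "(\<And>y. ip x y = ip z y) \<Longrightarrow> x = z"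
  by (rule rip_eqI) simp

lemma norm_le_if_rip_le:
  assumes "\<And>y. rip x y \<le> m * norm y" and "0 \<le> m" shows "norm x \<le> m"
proof (cases "x = 0")
  case True then show ?thesis using assms(2) by simp
next
  case False
  have "norm x * norm x \<le> m * norm x" using assms(1)[of x] by (simp add: rip_self power2_eq_square)
  then show ?thesis using False by simp
qed

text \<open>The parallelogram law makes a minimising sequence of a uniformly midpoint convex functional
  a Cauchy sequence.\<close>

lemma minimizing_sequence_converges:
  fixes J :: "'h \<Rightarrow> real"
  assumes ne: "C \<noteq> {}"
    and mid: "\<And>x y. x \<in> C \<Longrightarrow> y \<in> C \<Longrightarrow> (1/2) *\<^sub>R (x + y) \<in> C"
    and J: "\<And>x y. x \<in> C \<Longrightarrow> y \<in> C \<Longrightarrow>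
      J ((1/2) *\<^sub>R (x + y)) = (J x + J y) / 2 - (norm (x - y))\<^sup>2 / 4"
    and below: "\<And>x. x \<in> C \<Longrightarrow> b \<le> J x"
  obtains m X p where "\<And>x. x \<in> C \<Longrightarrow> m \<le> J x" "\<And>n. X n \<in> C" "(\<lambda>n. J (X n)) \<longlonglongrightarrow> m"
    "X \<longlonglongrightarrow> p" "p \<in> closure C"
proof -
  define m where "m = (INF x\<in>C. J x)"
  have bdd: "bdd_below (J ` C)" using below by (meson bdd_belowI2)
  have m_le: "m \<le> J x" if "x \<in> C" for x
    unfolding m_def by (rule cINF_lower[OF bdd that])
  have "\<exists>x\<in>C. J x < m + 1 / Suc n" for n
    using cINF_less_iff[OF ne bdd, of "m + 1 / Suc n"] by (auto simp: m_def)
  then obtain X where X: "\<And>n. X n \<in> C" "\<And>n. J (X n) < m + 1 / Suc n" by metis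
  have lim: "(\<lambda>n. J (X n)) \<longlonglongrightarrow> m"
  proof (rule tendsto_sandwich[of "\<lambda>n. m" _ _ "\<lambda>n. m + 1 / Suc n"])
    show "(\<lambda>n. m + 1 / Suc n) \<longlonglongrightarrow> m"
      using tendsto_add[OF tendsto_const[of m] LIMSEQ_inverse_real_of_nat] by (simp add: inverse_eq_divide)
  qed (use X m_le in \<open>auto intro!: always_eventually less_imp_le simp del: of_nat_Suc\<close>)
  \<comment> \<open>The value at the midpoint is at least \<open>m\<close>, so the defect term is
    bounded by the excesses of the two values over \<open>m\<close>.\<close>
  have d: "(norm (X i - X j))\<^sup>2 \<le> 2 * (J (X i) - m) + 2 * (J (X j) - m)" for i j
    using J[OF X(1) X(1), of i j] m_le[OF mid[OF X(1) X(1)], of i j] by (simp add: field_simps)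
  have "Cauchy X"
  proof (rule CauchyI)
    fix e :: real assume "e > 0"
    then have "e\<^sup>2 / 4 > 0" by simp
    then obtain N where N: "\<And>n. n \<ge> N \<Longrightarrow> dist (J (X n)) m < e\<^sup>2 / 4"
      using lim unfolding lim_sequentially by blast
    have "norm (X i - X j) < e" if "i \<ge> N" "j \<ge> N" for i j
    proof (rule power2_less_imp_less)
      show "(norm (X i - X j))\<^sup>2 < e\<^sup>2"
      proof -
        have "J (X i) - m < e\<^sup>2 / 4" "J (X j) - m < e\<^sup>2 / 4"
          using N[OF that(1)] N[OF that(2)] unfolding dist_real_def
          by (metis abs_ge_self le_less_trans)+
        then have "2 * (J (X i) - m) + 2 * (J (X j) - m) < 2 * (e\<^sup>2 / 4) + 2 * (e\<^sup>2 / 4)"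
          by (intro add_strict_mono mult_strict_left_mono) auto
        then show ?thesis using d[of i j] by simp
      qed
    qed (use \<open>e > 0\<close> in simp)
    then show "\<exists>M. \<forall>i\<ge>M. \<forall>j\<ge>M. norm (X i - X j) < e" by blast
  qed
  then obtain p where p: "X \<longlonglongrightarrow> p" by (auto simp: Cauchy_convergent_iff convergent_def)
  then have "p \<in> closure C" using X(1) closure_sequential by blast
  then show ?thesis using that m_le X(1) lim p by blast
qed

text \<open>\<open>C\<close> is not assumed closed, since it will be the image of a ball of
  controls; the nearest point is only a limit of points of \<open>C\<close>. The first variation is
  read off from convex combinations of the minimising sequence with \<open>c\<close>: pass to the
  limit along the sequence, divide by \<open>t\<close>, and let \<open>t\<close> tend to 0.\<close>

lemma convex_projection:
  assumes C: "convex C" "C \<noteq> {}"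
  obtains p where "p \<in> closure C" "\<And>c. c \<in> C \<Longrightarrow> rip c (y - p) \<le> rip p (y - p)"
proof -
  define J where "J x = (norm (x - y))\<^sup>2" for x
  have mid: "(1/2) *\<^sub>R (x + z) \<in> C" if "x \<in> C" "z \<in> C" for x z
    using convexD[OF C(1) that, of "1/2" "1/2"] by (simp add: scaleR_add_right)
  have JJ: "J ((1/2) *\<^sub>R (x + z)) = (J x + J z) / 2 - (norm (x - z))\<^sup>2 / 4" for x z
    unfolding J_def rip_self[symmetric]
    by (simp add: rip_simps rip_commute[of z x] rip_commute[of y x] rip_commute[of y z] field_simps)
  obtain m X p where m: "\<And>x. x \<in> C \<Longrightarrow> m \<le> J x" and X: "\<And>n. X n \<in> C" "(\<lambda>n. J (X n)) \<longlonglongrightarrow> m"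
    and p: "X \<longlonglongrightarrow> p" "p \<in> closure C"
    using minimizing_sequence_converges[of C J 0, OF C(2) mid JJ] by (auto simp: J_def)
  have Jp: "J p = m"
    by (rule LIMSEQ_unique[OF _ X(2)]) (unfold J_def, intro tendsto_intros p)
  have "rip c (y - p) \<le> rip p (y - p)" if c: "c \<in> C" for c
  proof -
    have *: "2 * rip (c - p) (y - p) \<le> t * (norm (c - p))\<^sup>2" if t: "0 < t" "t \<le> 1" for t
    proof -
      have "(\<lambda>n. J ((1 - t) *\<^sub>R X n + t *\<^sub>R c)) \<longlonglongrightarrow> J ((1 - t) *\<^sub>R p + t *\<^sub>R c)"
        unfolding J_def by (intro tendsto_intros p)
      moreover have "m \<le> J ((1 - t) *\<^sub>R X n + t *\<^sub>R c)" for n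
        using t by (intro m convexD[OF C(1) X(1) c]) auto
      ultimately have le: "J p \<le> J ((1 - t) *\<^sub>R p + t *\<^sub>R c)"
        unfolding Jp by (intro LIMSEQ_le_const) auto
      have eq: "(1 - t) *\<^sub>R p + t *\<^sub>R c - y = (p - y) + t *\<^sub>R (c - p)"
        by (simp add: algebra_simps)
      have "J ((1 - t) *\<^sub>R p + t *\<^sub>R c) = J p + 2 * t * rip (p - y) (c - p) + t\<^sup>2 * (norm (c - p))\<^sup>2"
        unfolding J_def eq norm_add_sq[of "p - y" "t *\<^sub>R (c - p)"]
        by (simp only: ip_scaleR_right inner_scaleR_left norm_scaleR power_mult_distrib power2_abs
           mult.assoc real_scaleR_def)
      with le have "0 \<le> 2 * t * rip (p - y) (c - p) + t\<^sup>2 * (norm (c - p))\<^sup>2" by linarith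
      moreover have "rip (p - y) (c - p) = - rip (c - p) (y - p)"
        using rip_commute[of "c - p" "p - y"] ip_minus_right[of "c - p" "y - p"] by simp
      ultimately have "t * (2 * rip (c - p) (y - p)) \<le> t * (t * (norm (c - p))\<^sup>2)"
        by (simp add: power2_eq_square mult.assoc)
      then show ?thesis using t by simp
    qed
    have "((\<lambda>t. t * (norm (c - p))\<^sup>2) \<longlongrightarrow> 0 * (norm (c - p))\<^sup>2) (at_right 0)"
      by (intro tendsto_intros)
    moreover have "\<forall>\<^sub>F t in at_right 0. 2 * rip (c - p) (y - p) \<le> t * (norm (c - p))\<^sup>2"
      unfolding eventually_at_right_field by (intro exI[of _ 1]) (use * in auto)
    ultimately have "2 * rip (c - p) (y - p) \<le> 0 * (norm (c - p))\<^sup>2"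
      by (intro tendsto_lowerbound[of _ _ "at_right 0"]) auto
    then show ?thesis by (simp add: rip_simps)
  qed
  then show ?thesis using that p(2) by blast
qed

text \<open>Minimising \<open>\<parallel>\<phi>\<parallel>\<^sup>2 - 2 Re F \<phi>\<close> over \<open>M\<close> itself avoids extending \<open>F\<close> to the closure of \<open>M\<close>.\<close>

lemma Riesz_on_subspace:
  fixes F :: "'h \<Rightarrow> 'k"
  assumes M0: "0 \<in> M" and Madd: "\<And>x y. x \<in> M \<Longrightarrow> y \<in> M \<Longrightarrow> x + y \<in> M"
    and Mscal: "\<And>c x. x \<in> M \<Longrightarrow> scal c x \<in> M"
    and Fadd: "\<And>x y. x \<in> M \<Longrightarrow> y \<in> M \<Longrightarrow> F (x + y) = F x + F y"
    and Fscal: "\<And>c x. x \<in> M \<Longrightarrow> F (scal c x) = kcnj c * F x"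
    and Fb: "\<And>x. x \<in> M \<Longrightarrow> norm (F x) \<le> b * norm x"
  obtains h where "h \<in> closure M" "\<And>x. x \<in> M \<Longrightarrow> F x = ip h x"
proof -
  have MR: "r *\<^sub>R x \<in> M" if "x \<in> M" for r x
    using Mscal[OF that, of "of_real r"] by (simp add: scale_of_real)
  have FR: "F (r *\<^sub>R x) = r *\<^sub>R F x" if "x \<in> M" for r x
    using Fscal[OF that, of "of_real r"] by (simp add: scale_of_real scaleR_conv_of_real)
  define J where "J x = (norm x)\<^sup>2 - 2 * (F x \<bullet> 1)" for x
  have mid: "(1/2) *\<^sub>R (x + z) \<in> M" if "x \<in> M" "z \<in> M" for x z
    using that by (intro MR Madd)
  have JJ: "J ((1/2) *\<^sub>R (x + z)) = (J x + J z) / 2 - (norm (x - z))\<^sup>2 / 4"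
    if "x \<in> M" "z \<in> M" for x z
  proof -
    have a: "F ((1/2) *\<^sub>R (x + z)) \<bullet> 1 = (F x \<bullet> 1 + F z \<bullet> 1) / 2"
      by (simp only: FR[OF Madd[OF that]] Fadd[OF that]) (simp add: inner_add_left)
    have "(norm ((1/2) *\<^sub>R (x + z)))\<^sup>2 = (norm (x + z))\<^sup>2 / 4"
      by (simp only: norm_scaleR power_mult_distrib) (simp add: power_divide)
    then have b: "(norm ((1/2) *\<^sub>R (x + z)))\<^sup>2 = ((norm x)\<^sup>2 + 2 * rip x z + (norm z)\<^sup>2) / 4"
      unfolding norm_add_sq[of x z] .
    have c: "(A + 2 * r + B) / 4 - 2 * ((f + g) / 2) = ((A - 2 * f) + (B - 2 * g)) / 2 - (A - 2 * r + B) / 4"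
      for A B r f g :: real by (simp add: field_simps)
    show ?thesis
      unfolding J_def a b norm_diff_sq[of x z] by (rule c)
  qed
  have below: "- b\<^sup>2 \<le> J x" if "x \<in> M" for x
  proof -
    have "2 * (F x \<bullet> 1) \<le> 2 * (b * norm x)" using inner_1_le_norm[of "F x"] Fb[OF that] by linarith
    also have "\<dots> \<le> (norm x)\<^sup>2 + b\<^sup>2"
      using zero_le_power2[of "norm x - b"] by (simp add: power2_diff algebra_simps)
    finally show ?thesis by (simp add: J_def)
  qed
  have ne: "M \<noteq> {}" using M0 by auto
  obtain m X p where m: "\<And>x. x \<in> M \<Longrightarrow> m \<le> J x" and X: "\<And>n. X n \<in> M" "(\<lambda>n. J (X n)) \<longlonglongrightarrow> m"
    and p: "X \<longlonglongrightarrow> p" "p \<in> closure M"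
    using minimizing_sequence_converges[of M J "- b\<^sup>2", OF ne mid JJ below] by metis
  have re: "F c \<bullet> 1 = rip p c" if c: "c \<in> M" for c
  proof -
    define d where "d = rip p c - F c \<bullet> 1"
    \<comment> \<open>Shifting the minimising sequence by \<open>t *\<^sub>R c\<close> cannot bring
      the values below \<open>m\<close>; a quadratic that is nonnegative for all \<open>t\<close>
      and vanishes at 0 has linear coefficient 0.\<close>
    have q: "0 \<le> 2 * t * d + t\<^sup>2 * (norm c)\<^sup>2" for t :: real
    proof -
      have "(\<lambda>n. J (X n) + (2 * t * (rip (X n) c - F c \<bullet> 1) + t\<^sup>2 * (norm c)\<^sup>2)) \<longlonglongrightarrow>
          m + (2 * t * d + t\<^sup>2 * (norm c)\<^sup>2)"
        unfolding d_def
        by (intro tendsto_intros X bounded_linear.tendsto[OF bounded_linear_rip_left] p)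
      moreover have "m \<le> J (X n) + (2 * t * (rip (X n) c - F c \<bullet> 1) + t\<^sup>2 * (norm c)\<^sup>2)" for n
        using m[OF Madd[OF X(1) MR[OF c, of t]], of n]
        by (simp add: J_def norm_add_sq Fadd X MR c FR ip_scaleR_right power_mult_distrib
            inner_add_left algebra_simps)
      ultimately have "m \<le> m + (2 * t * d + t\<^sup>2 * (norm c)\<^sup>2)" by (intro LIMSEQ_le_const) auto
      then show ?thesis by simp
    qed
    have "d = 0"
    proof (rule ccontr)
      assume "d \<noteq> 0"
      \<comment> \<open>Nearly the minimiser of the quadratic; the added 1 covers the case
        \<open>c = 0\<close>.\<close>
      define t where "t = - d / ((norm c)\<^sup>2 + 1)"
      have pos: "(norm c)\<^sup>2 + 1 > 0" by (simp add: add_nonneg_pos)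
      have "t\<^sup>2 * (norm c)\<^sup>2 \<le> t\<^sup>2 * ((norm c)\<^sup>2 + 1)" by (intro mult_left_mono) auto
      also have "\<dots> = - t * d" using pos by (simp add: t_def power2_eq_square)
      finally have "0 \<le> t * d" using q[of t] by linarith
      moreover have "t * d < 0"
      proof -
        have "t * d = - (d * d) / ((norm c)\<^sup>2 + 1)" by (simp add: t_def)
        moreover have "d * d > 0" using \<open>d \<noteq> 0\<close> by (auto simp: zero_less_mult_iff linorder_neq_iff)
        ultimately show ?thesis using pos by (simp add: divide_pos_pos)
      qed
      ultimately show False by simp
    qed
    then show ?thesis by (simp add: d_def)
  qed
  \<comment> \<open>Both sides are conjugate-linear in \<open>x\<close>, so replacing
    \<open>x\<close> by its multiple with \<open>kcnj a\<close> multiplies them by \<open>a\<close>;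
    real parts of all multiples determine a scalar.\<close>
  have "F x = ip p x" if x: "x \<in> M" for x
  proof (rule scalar_eqI)
    fix a
    show "(a * F x) \<bullet> 1 = (a * ip p x) \<bullet> 1"
      using re[OF Mscal[OF x, of "kcnj a"]] by (simp add: Fscal x ip_scale_right)
  qed
  then show ?thesis using that p(2) by blast
qed

text \<open>The Riesz vector \<open>h\<close> of \<open>ip y\<close> on \<open>M\<close> lies in the
  closure of \<open>M\<close>, and \<open>y - h\<close> is orthogonal to \<open>M\<close>, hence
  zero.\<close>

lemma dense_if_trivial_complement:
  assumes M0: "0 \<in> M" and Madd: "\<And>x y. x \<in> M \<Longrightarrow> y \<in> M \<Longrightarrow> x + y \<in> M"
    and Mscal: "\<And>c x. x \<in> M \<Longrightarrow> scal c x \<in> M"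
    and triv: "\<And>y. (\<And>x. x \<in> M \<Longrightarrow> ip y x = 0) \<Longrightarrow> y = 0"
  shows "closure M = UNIV"
proof -
  have "y \<in> closure M" for y
  proof -
    obtain h where h: "h \<in> closure M" "\<And>x. x \<in> M \<Longrightarrow> ip y x = ip h x"
      using Riesz_on_subspace[of M "ip y" "norm y", OF M0 Madd Mscal ip_add_right ip_scale_right norm_ip_le]
      by blast
    have "y - h = 0" by (rule triv) (simp add: ip_diff_left h(2))
    then show ?thesis using h(1) by simp
  qed
  then show ?thesis by blast
qed

section \<open>Bounded operators and their Hilbert adjoints\<close>

lemma bounded_operatorD:
  assumes "bounded_operator scal V"
  shows "bounded_linear V" "\<And>c x. V (scal c x) = scal c (V x)"
proof -
  interpret V: Vector_Spaces.linear scal scal V using assms by (simp add: bounded_operator_def)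
  obtain C where C: "\<And>x. norm (V x) \<le> C * norm x" using assms by (auto simp: bounded_operator_def)
  show sc: "V (scal c x) = scal c (V x)" for c x by (rule V.scale)
  show "bounded_linear V"
    by (rule bounded_linear_intro[of _ C])
      (auto simp: V.add C mult.commute scale_of_real[symmetric] sc)
qed

lemma bounded_operatorI:
  assumes "bounded_linear V" "\<And>c x. V (scal c x) = scal c (V x)"
  shows "bounded_operator scal V"
proof -
  interpret V: bounded_linear V by fact
  have "Vector_Spaces.linear scal scal V"
    by unfold_locales (auto simp: V.add assms(2) scale_right_distrib scale_left_distrib)
  then show ?thesis
    using V.nonneg_bounded by (auto simp: bounded_operator_def mult.commute)
qed

lemma adj_UNIV_eqI:
  assumes "\<And>x. ip (V x) \<phi> = ip x \<psi>"
  shows "adj ip UNIV V \<phi> = \<psi>"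
  unfolding adj_def
proof (rule the_equality)
  show "\<forall>x\<in>UNIV. ip (V x) \<phi> = ip x \<psi>" using assms by simp
  fix \<psi>' assume "\<forall>x\<in>UNIV. ip (V x) \<phi> = ip x \<psi>'"
  then show "\<psi>' = \<psi>"
    using assms by (intro ip_eqI) (metis UNIV_I ip_commute)
qed

text \<open>Riesz representation of \<open>\<lambda>x. ip \<phi> (V x)\<close> supplies the vector
  that the definite description in \<open>adj\<close> asks for.\<close>

lemma ip_adj_UNIV:
  assumes V: "bounded_operator scal V"
  shows "ip (V x) \<phi> = ip x (adj ip UNIV V \<phi>)"
proof -
  interpret V: bounded_linear V by (rule bounded_operatorD[OF V])
  obtain C where C: "\<And>x. norm (V x) \<le> norm x * C" using V.bounded by blast
  obtain h where h: "\<And>x. ip \<phi> (V x) = ip h x"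
  proof (rule Riesz_on_subspace[of UNIV "\<lambda>x. ip \<phi> (V x)" "norm \<phi> * C"])
    show "norm (ip \<phi> (V x)) \<le> norm \<phi> * C * norm x" for x
      using norm_ip_le[of \<phi> "V x"] mult_left_mono[OF C[of x], of "norm \<phi>"]
      by (simp add: algebra_simps)
  qed (auto simp: V.add ip_add_right bounded_operatorD(2)[OF V] ip_scale_right)
  have *: "ip (V x) \<phi> = ip x h" for x using h[of x] by (metis ip_commute)
  show ?thesis using * adj_UNIV_eqI[of V \<phi> h, OF *] by simp
qed

lemma adj_UNIV_add:
  assumes V: "bounded_operator scal V"
  shows "adj ip UNIV V (\<phi> + \<psi>) = adj ip UNIV V \<phi> + adj ip UNIV V \<psi>"
  by (rule adj_UNIV_eqI) (simp add: ip_add_right ip_adj_UNIV[OF V])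

lemma adj_UNIV_scal:
  assumes V: "bounded_operator scal V"
  shows "adj ip UNIV V (scal c \<phi>) = scal c (adj ip UNIV V \<phi>)"
  by (rule adj_UNIV_eqI) (simp add: ip_scale_right ip_adj_UNIV[OF V])

text \<open>Testing the adjoint identity at the vector \<open>adj ip UNIV V \<phi>\<close> itself
  produces its squared norm.\<close>

lemma norm_adj_UNIV_le:
  assumes V: "bounded_operator scal V" and C: "\<And>x. norm (V x) \<le> C * norm x"
  shows "norm (adj ip UNIV V \<phi>) \<le> C * norm \<phi>"
proof (cases "adj ip UNIV V \<phi> = 0")
  case True
  have "0 \<le> C * norm \<phi>"
    using order_trans[OF norm_ge_zero C[of \<phi>]] by simp
  then show ?thesis using True by simp
next
  case False
  let ?a = "adj ip UNIV V \<phi>"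
  have "norm ?a * norm ?a = rip (V ?a) \<phi>"
    by (simp add: ip_adj_UNIV[OF V] rip_self power2_eq_square[symmetric])
  also have "\<dots> \<le> norm (V ?a) * norm \<phi>" by (rule rip_le)
  also have "\<dots> \<le> (C * norm ?a) * norm \<phi>" by (intro mult_right_mono C) simp
  finally show ?thesis using False by (simp add: mult.assoc mult.left_commute)
qed

end

section \<open>Uniform boundedness\<close>

text \<open>
  A gliding hump argument: the near-norming vectors \<open>w n\<close> are chosen first, and the sign of the
  \<open>n\<close>-th coefficient makes the partial sum at least as large as its last term. Completeness enters
  only through the first hypothesis, so that no norm on the domain is needed.
\<close>

lemma uniform_boundedness:
  fixes f :: "'i \<Rightarrow> 'x \<Rightarrow> 'b::real_normed_vector"
  assumes combine: "\<And>w e. (\<And>n. w n \<in> X) \<Longrightarrow> (\<And>n. \<bar>e n :: real\<bar> \<le> (1/2) ^ n) \<Longrightarrow>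
      \<exists>x\<in>Y. \<forall>i\<in>I. (\<lambda>n. e n *\<^sub>R f i (w n)) sums f i x"
    and pointwise: "\<And>x. x \<in> Y \<Longrightarrow> \<exists>K. \<forall>i\<in>I. norm (f i x) \<le> K"
    and bounded: "\<And>i. i \<in> I \<Longrightarrow> \<exists>c. \<forall>x\<in>X. norm (f i x) \<le> c"
  shows "\<exists>C. \<forall>i\<in>I. \<forall>x\<in>X. norm (f i x) \<le> C"
proof (rule ccontr)
  assume unb: "\<not> ?thesis"
  \<comment> \<open>A lower bound of 16^n survives multiplication by the later coefficient of size
    4^-n and leaves a term of size at least 4^n. The factor 2 says that \<open>w\<close> is within
    half of the supremum over \<open>X\<close>.\<close>
  have "\<exists>i w. i \<in> I \<and> w \<in> X \<and> norm (f i w) > 16 ^ n \<and> (\<forall>x\<in>X. norm (f i x) \<le> 2 * norm (f i w))"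
    for n :: nat
  proof -
    obtain i x0 where i: "i \<in> I" "x0 \<in> X" "norm (f i x0) > 2 * 16 ^ n"
      using unb by (meson not_le)
    obtain c where c: "\<And>x. x \<in> X \<Longrightarrow> norm (f i x) \<le> c" using bounded[OF i(1)] by blast
    define s where "s = (SUP x\<in>X. norm (f i x))"
    have bdd: "bdd_above ((\<lambda>x. norm (f i x)) ` X)" using c by (meson bdd_aboveI2)
    have s: "norm (f i x) \<le> s" if "x \<in> X" for x
      unfolding s_def by (rule cSUP_upper[OF that bdd])
    have pos: "s > 2 * 16 ^ n" using s[OF i(2)] i(3) by linarith
    then have "s / 2 < s" using zero_less_power[of "16::real" n] by linarith
    then obtain w where w: "w \<in> X" "s / 2 < norm (f i w)"
      using less_cSUP_iff[of X "\<lambda>x. norm (f i x)" "s / 2"] bdd i(2) unfolding s_def by blast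
    have "norm (f i x) \<le> 2 * norm (f i w)" if "x \<in> X" for x
      using s[OF that] w(2) by linarith
    then show ?thesis using i(1) w pos by (intro exI[of _ i] exI[of _ w]) auto
  qed
  then obtain i w where i: "\<And>n. i n \<in> I" and w: "\<And>n. w n \<in> X"
    and big: "\<And>n. norm (f (i n) (w n)) > 16 ^ n"
    and near: "\<And>n x. x \<in> X \<Longrightarrow> norm (f (i n) x) \<le> 2 * norm (f (i n) (w n))"
    by metis
  define \<sigma> where "\<sigma> n a = (if norm (a + (1/4) ^ n *\<^sub>R f (i n) (w n)) \<ge> norm ((1/4) ^ n *\<^sub>R f (i n) (w n))
      then (1/4) ^ n else - ((1/4) ^ n) :: real)" for n :: nat and a
  \<comment> \<open>The sign at stage n depends on the partial sum at the index \<open>i n\<close>,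
    so the partial sums at all indices are built in one recursion.\<close>
  define S where "S = rec_nat (\<lambda>j. 0) (\<lambda>n s j. s j + \<sigma> n (s (i n)) *\<^sub>R f j (w n))"
  define e where "e n = \<sigma> n (S n (i n))" for n
  have S: "S n j = (\<Sum>k<n. e k *\<^sub>R f j (w k))" for n j
    by (induction n) (auto simp: S_def e_def)
  have S_Suc: "S (Suc n) j = S n j + e n *\<^sub>R f j (w n)" for n j
    by (simp add: S)
  have e: "\<bar>e n\<bar> = (1/4) ^ n" for n by (simp add: e_def \<sigma>_def)
  have hump: "norm (a + \<sigma> n a *\<^sub>R f (i n) (w n)) \<ge> (1/4) ^ n * norm (f (i n) (w n))" for n a
  proof (cases "norm (a + (1/4) ^ n *\<^sub>R f (i n) (w n)) \<ge> norm ((1/4) ^ n *\<^sub>R f (i n) (w n))")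
    case True then show ?thesis by (simp add: \<sigma>_def)
  next
    case False
    let ?b = "(1/4) ^ n *\<^sub>R f (i n) (w n)"
    have "norm ((a + ?b) - (a - ?b)) \<le> norm (a + ?b) + norm (a - ?b)" by (rule norm_triangle_ineq4)
    also have "(a + ?b) - (a - ?b) = 2 *\<^sub>R ?b" by (simp flip: scaleR_2)
    finally have "2 * norm ?b \<le> norm (a + ?b) + norm (a - ?b)" by simp
    then have "norm (a - ?b) \<ge> norm ?b" using False by linarith
    then show ?thesis using False by (simp add: \<sigma>_def)
  qed
  have e2: "\<bar>e n\<bar> \<le> (1/2) ^ n" for n unfolding e by (rule power_mono) auto
  obtain x where x: "x \<in> Y" "\<And>j. j \<in> I \<Longrightarrow> (\<lambda>n. e n *\<^sub>R f j (w n)) sums f j x"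
    using combine[of w e, OF w e2] by blast
  obtain K where K: "\<And>j. j \<in> I \<Longrightarrow> norm (f j x) \<le> K" using pointwise[OF x(1)] by blast
  \<comment> \<open>With N the norm of the n-th hump, the partial sum through stage n has norm at
    least 4^-n N, while the geometric tail is at most 2/3 of that; one third remains, and N exceeds
    16^n.\<close>
  have lower: "4 ^ n / 3 \<le> K" for n
  proof -
    let ?N = "norm (f (i n) (w n))"
    let ?t = "\<lambda>k. e (k + Suc n) *\<^sub>R f (i n) (w (k + Suc n))"
    have tail: "?t sums (f (i n) x - S (Suc n) (i n))"
      using sums_split_initial_segment[OF x(2)[OF i[of n]], of "Suc n"] by (simp only: S)
    have g: "(\<lambda>k. (1/4) ^ (k + Suc n) * (2 * ?N)) sums ((1/4) ^ Suc n * (2 * ?N) * (1 / (1 - 1/4)))"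
      using sums_mult[OF geometric_sums[of "1/4::real"], of "(1/4) ^ Suc n * (2 * ?N)"]
      by (simp add: power_add mult_ac)
    have tb: "norm (?t k) \<le> (1/4) ^ (k + Suc n) * (2 * ?N)" for k
      using near[OF w, of n "k + Suc n"] by (simp only: norm_scaleR e) (intro mult_left_mono, auto)
    have "norm (f (i n) x - S (Suc n) (i n)) \<le> (1/4) ^ Suc n * (2 * ?N) * (1 / (1 - 1/4))"
    proof (rule LIMSEQ_le_const2)
      show "(\<lambda>m. norm (\<Sum>k<m. ?t k)) \<longlonglongrightarrow> norm (f (i n) x - S (Suc n) (i n))"
        using tail unfolding sums_def by (intro tendsto_norm)
      have "norm (\<Sum>k<m. ?t k) \<le> (1/4) ^ Suc n * (2 * ?N) * (1 / (1 - 1/4))" for m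
      proof -
        have "norm (\<Sum>k<m. ?t k) \<le> (\<Sum>k<m. (1/4) ^ (k + Suc n) * (2 * ?N))"
          using tb by (intro sum_norm_le) blast
        also have "\<dots> \<le> (\<Sum>k. (1/4) ^ (k + Suc n) * (2 * ?N))"
          using sums_summable[OF g] by (intro sum_le_suminf) auto
        also have "\<dots> = (1/4) ^ Suc n * (2 * ?N) * (1 / (1 - 1/4))"
          by (rule sums_unique[OF g, symmetric])
        finally show ?thesis .
      qed
      then show "\<exists>N. \<forall>m\<ge>N. norm (\<Sum>k<m. ?t k) \<le> (1/4) ^ Suc n * (2 * ?N) * (1 / (1 - 1/4))"
        by blast
    qed
    moreover have "norm (S (Suc n) (i n)) \<ge> (1/4) ^ n * ?N"
      using hump[of n "S n (i n)"] unfolding S_Suc e_def .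
    moreover have "norm (S (Suc n) (i n)) \<le> norm (f (i n) x) + norm (f (i n) x - S (Suc n) (i n))"
      using norm_triangle_sub[of "S (Suc n) (i n)" "f (i n) x"] by (simp add: norm_minus_commute)
    moreover have "(1/4) ^ n * ?N \<ge> 4 ^ n"
    proof -
      have "(1/4) ^ n * 16 ^ n \<le> (1/4) ^ n * ?N" using big[of n] by (intro mult_left_mono) auto
      then show ?thesis by (simp add: power_mult_distrib[symmetric])
    qed
    moreover have "(1/4) ^ Suc n * (2 * ?N) * (1 / (1 - 1/4)) = 2 / 3 * ((1/4) ^ n * ?N)" by simp
    ultimately have "4 ^ n / 3 \<le> norm (f (i n) x)" by linarith
    then show ?thesis using K[OF i[of n]] by linarith
  qed
  obtain n where "3 * K < 4 ^ n" using real_arch_pow[of 4 "3 * K"] by auto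
  then show False using lower[of n] by simp
qed

text \<open>In a Banach space the series required by \<open>combine\<close> converges absolutely, so
  the gliding hump applies to the unit ball.\<close>

corollary uniform_boundedness_banach:
  fixes f :: "'i \<Rightarrow> 'x::banach \<Rightarrow> 'b::real_normed_vector"
  assumes lin: "\<And>i. i \<in> I \<Longrightarrow> bounded_linear (f i)"
    and pointwise: "\<And>x. \<exists>K. \<forall>i\<in>I. norm (f i x) \<le> K"
  shows "\<exists>C\<ge>0. \<forall>i\<in>I. \<forall>x. norm (f i x) \<le> C * norm x"
proof -
  have "\<exists>C. \<forall>i\<in>I. \<forall>x\<in>cball 0 1. norm (f i x) \<le> C"
  proof (rule uniform_boundedness[where Y = UNIV])
    fix w :: "nat \<Rightarrow> 'x" and e :: "nat \<Rightarrow> real"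
    assume w: "\<And>n. w n \<in> cball 0 1" and e: "\<And>n. \<bar>e n\<bar> \<le> (1/2) ^ n"
    have "norm (e n *\<^sub>R w n) \<le> (1/2) ^ n" for n
      using mult_mono[OF e[of n], of "norm (w n)" 1] w[of n] by simp
    then have "summable (\<lambda>n. e n *\<^sub>R w n)"
      by (intro summable_comparison_test'[OF summable_geometric[of "1/2::real"], of 0]) auto
    then have s: "(\<lambda>n. e n *\<^sub>R w n) sums (\<Sum>n. e n *\<^sub>R w n)" by (rule summable_sums)
    have "(\<lambda>n. e n *\<^sub>R f i (w n)) sums f i (\<Sum>n. e n *\<^sub>R w n)" if "i \<in> I" for i
      using bounded_linear.sums[OF lin[OF that] s]
      by (simp add: linear_scale[OF bounded_linear.linear[OF lin[OF that]]])
    then show "\<exists>x\<in>UNIV. \<forall>i\<in>I. (\<lambda>n. e n *\<^sub>R f i (w n)) sums f i x" by blast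
  next
    fix i assume "i \<in> I"
    then obtain K where K: "K \<ge> 0" "\<And>x. norm (f i x) \<le> norm x * K"
      using bounded_linear.nonneg_bounded[OF lin] by blast
    have "norm (f i x) \<le> K" if "x \<in> cball 0 1" for x
      using K(2)[of x] mult_right_mono[of "norm x" 1 K] that K(1) by simp
    then show "\<exists>c. \<forall>x\<in>cball 0 1. norm (f i x) \<le> c" by blast
  qed (use pointwise in blast)
  then obtain C where C: "\<And>i x. i \<in> I \<Longrightarrow> norm x \<le> 1 \<Longrightarrow> norm (f i x) \<le> C"
    by (metis mem_cball_0)
  have "norm (f i x) \<le> max C 0 * norm x" if "i \<in> I" for i x
  proof (cases "x = 0")
    case True
    then show ?thesis using linear_0[OF bounded_linear.linear[OF lin[OF that]]] by simp
  next
    case False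
    have "norm (f i ((1 / norm x) *\<^sub>R x)) \<le> C" using False by (intro C that) simp
    then have "norm (f i x) \<le> C * norm x"
      using False by (simp add: linear_scale[OF bounded_linear.linear[OF lin[OF that]]] field_simps)
    also have "\<dots> \<le> max C 0 * norm x" by (rule mult_right_mono) auto
    finally show ?thesis .
  qed
  then show ?thesis by (intro exI[of _ "max C 0"]) auto
qed

section \<open>Semigroups\<close>

text \<open>Difference quotients suit products with a family of operators that is only strongly
  continuous, as in Duhamel's formula.\<close>

lemma has_vector_derivative_iff_quotient:
  fixes f :: "real \<Rightarrow> 'a::real_normed_vector"
  shows "(f has_vector_derivative d) (at x within S) \<longleftrightarrow>
    ((\<lambda>y. (1 / (y - x)) *\<^sub>R (f y - f x)) \<longlongrightarrow> d) (at x within S)"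
proof -
  have eq: "norm ((f y - f x) - (y - x) *\<^sub>R d) / norm (y - x) =
      norm ((1 / (y - x)) *\<^sub>R (f y - f x) - d)" if "y \<noteq> x" for y
  proof -
    have "(1 / (y - x)) *\<^sub>R (f y - f x) - d = (1 / (y - x)) *\<^sub>R ((f y - f x) - (y - x) *\<^sub>R d)"
      using that by (simp add: scaleR_diff_right)
    then show ?thesis using that by (simp add: divide_inverse mult.commute)
  qed
  have "((\<lambda>y. norm ((f y - f x) - (y - x) *\<^sub>R d) / norm (y - x)) \<longlongrightarrow> 0) (at x within S) \<longleftrightarrow>
      ((\<lambda>y. norm ((1 / (y - x)) *\<^sub>R (f y - f x) - d)) \<longlongrightarrow> 0) (at x within S)"
    by (intro tendsto_cong) (use eq in \<open>auto simp: eventually_at_filter\<close>)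
  then show ?thesis
    unfolding has_vector_derivative_def has_derivative_iff_norm
    by (simp add: tendsto_norm_zero_iff LIM_zero_iff bounded_linear_scaleR_left)
qed

lemma right_quotient_tendsto:
  fixes f :: "real \<Rightarrow> 'a::real_normed_vector"
  assumes "(f has_vector_derivative d) (at a within {a..b})" "a < b"
  shows "((\<lambda>h. (1 / h) *\<^sub>R (f (a + h) - f a)) \<longlongrightarrow> d) (at_right 0)"
  using assms unfolding has_vector_derivative_iff_quotient at_within_Icc_at_right[OF assms(2)]
  by (simp add: filterlim_at_right_to_0[of _ _ a] add.commute)

section \<open>Growth and joint continuity of semigroups\<close>

locale semigroup = hilbert_space scal ip
  for scal :: "'k::real_or_complex \<Rightarrow> 'h::banach \<Rightarrow> 'h" and ip :: "'h \<Rightarrow> 'h \<Rightarrow> 'k" +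
  fixes S :: "real \<Rightarrow> 'h \<Rightarrow> 'h"
  assumes C0: "C0_semigroup scal S"
begin

lemma op: "0 \<le> t \<Longrightarrow> bounded_operator scal (S t)"
  and S_0 [simp]: "S 0 x = x"
  and S_add: "0 \<le> s \<Longrightarrow> 0 \<le> t \<Longrightarrow> S (s + t) x = S s (S t x)"
  and S_right: "((\<lambda>t. S t x) \<longlongrightarrow> x) (at_right 0)"
  using C0 by (auto simp: C0_semigroup_def)

lemmas S_linear = bounded_operatorD(1)[OF op]
lemmas S_scal = bounded_operatorD(2)[OF op]

lemma S_plus: "0 \<le> t \<Longrightarrow> S t (x + y) = S t x + S t y"
  by (rule linear_add[OF bounded_linear.linear[OF S_linear]])

lemma S_diff: "0 \<le> t \<Longrightarrow> S t (x - y) = S t x - S t y"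
  by (rule linear_diff[OF bounded_linear.linear[OF S_linear]])

lemma S_scaleR: "0 \<le> t \<Longrightarrow> S t (r *\<^sub>R x) = r *\<^sub>R S t x"
  by (rule linear_scale[OF bounded_linear.linear[OF S_linear]])

lemma S_commute: "0 \<le> s \<Longrightarrow> 0 \<le> t \<Longrightarrow> S s (S t x) = S t (S s x)"
  by (metis S_add add.commute)

text \<open>Otherwise there are times tending to 0 whose operators exceed every bound, although
  strong continuity at 0 bounds each orbit along them; this contradicts uniform boundedness.\<close>

lemma bounded_near_0: "\<exists>\<delta>>0. \<exists>M. \<forall>t. 0 \<le> t \<longrightarrow> t \<le> \<delta> \<longrightarrow> (\<forall>x. norm (S t x) \<le> M * norm x)"
proof (rule ccontr)
  assume "\<not> ?thesis"
  then have "\<forall>n::nat. \<exists>t. 0 \<le> t \<and> t \<le> 1 / Suc n \<and> (\<exists>x. norm (S t x) > real n * norm x)"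
    by (metis not_le zero_less_divide_1_iff of_nat_0_less_iff zero_less_Suc)
  then obtain t where t: "\<And>n::nat. 0 \<le> t n" "\<And>n::nat. t n \<le> 1 / Suc n"
    and x: "\<And>n::nat. \<exists>x. norm (S (t n) x) > real n * norm x" by metis
  have t0: "t \<longlonglongrightarrow> 0"
  proof (rule tendsto_sandwich[of "\<lambda>n. 0" _ _ "\<lambda>n. 1 / Suc n"])
    show "(\<lambda>n. 1 / Suc n) \<longlonglongrightarrow> 0"
      using LIMSEQ_inverse_real_of_nat by (simp add: inverse_eq_divide)
  qed (use t in \<open>auto intro!: always_eventually simp del: of_nat_Suc\<close>)
  have "\<exists>K. \<forall>n\<in>UNIV. norm (S (t n) x) \<le> K" for x
  proof -
    have "continuous (at 0 within {0..}) (\<lambda>s. S s x)"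
      unfolding continuous_within at_within_Ici_at_right using S_right[of x] by simp
    then have "(\<lambda>n. S (t n) x) \<longlonglongrightarrow> S 0 x"
      by (rule continuous_within_tendsto_compose') (use t t0 in auto)
    then have "Bseq (\<lambda>n. S (t n) x)" by (intro convergent_imp_Bseq convergentI)
    then show ?thesis by (auto simp: Bseq_def)
  qed
  then obtain C where C: "\<And>n x. norm (S (t n) x) \<le> C * norm x"
    using uniform_boundedness_banach[of UNIV "\<lambda>n. S (t n)"] S_linear[OF t(1)] by blast
  obtain n :: nat where "C \<le> real n" using real_arch_simple by blast
  then have "norm (S (t n) x) \<le> real n * norm x" for x
    using C[of n x] mult_right_mono[of C "real n" "norm x"] by simp
  then show False using x[of n] by (meson not_le)
qed

text \<open>Iterating the bound \<open>M\<close> over steps of length \<open>\<delta>\<close> gives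
  the power \<open>M ^ Suc n\<close> for n the integer part of \<open>t / \<delta>\<close>; the
  exponent \<open>ln M / \<delta>\<close> turns \<open>M ^ n\<close> into an exponential in
  \<open>t\<close>.\<close>

lemma growth: "\<exists>M\<ge>1. \<exists>\<omega>\<ge>0. \<forall>t\<ge>0. \<forall>x. norm (S t x) \<le> M * exp (\<omega> * t) * norm x"
proof -
  obtain \<delta> M0 where \<delta>: "\<delta> > 0" and M0: "\<And>t x. 0 \<le> t \<Longrightarrow> t \<le> \<delta> \<Longrightarrow> norm (S t x) \<le> M0 * norm x"
    using bounded_near_0 by blast
  define M where "M = max M0 1"
  have M1: "M \<ge> 1" by (simp add: M_def)
  have M: "norm (S t x) \<le> M * norm x" if "0 \<le> t" "t \<le> \<delta>" for t x
    using M0[OF that, of x] mult_right_mono[of M0 M "norm x"] by (simp add: M_def)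
  have pow: "0 \<le> t \<Longrightarrow> t \<le> Suc n * \<delta> \<Longrightarrow> norm (S t x) \<le> M ^ Suc n * norm x" for n t x
  proof (induction n arbitrary: t x)
    case 0 then show ?case using M by simp
  next
    case (Suc n)
    show ?case
    proof (cases "t \<le> \<delta>")
      case True
      have "M * norm x \<le> M ^ Suc (Suc n) * norm x"
        using M1 power_increasing[of 1 "Suc (Suc n)" M] by (intro mult_right_mono) auto
      then show ?thesis using M[OF Suc.prems(1) True, of x] by linarith
    next
      case False
      then have "S t x = S (t - \<delta>) (S \<delta> x)" using S_add[of "t - \<delta>" \<delta> x] \<delta> by simp
      moreover have "norm (S (t - \<delta>) (S \<delta> x)) \<le> M ^ Suc n * norm (S \<delta> x)"
        using False Suc.prems by (intro Suc.IH) (auto simp: algebra_simps)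
      moreover have "\<dots> \<le> M ^ Suc n * (M * norm x)"
        using M1 \<delta> by (intro mult_left_mono M) auto
      ultimately show ?thesis by (simp add: mult_ac)
    qed
  qed
  define \<omega> where "\<omega> = ln M / \<delta>"
  have "norm (S t x) \<le> M * exp (\<omega> * t) * norm x" if t: "t \<ge> 0" for t x
  proof -
    define n where "n = nat \<lfloor>t / \<delta>\<rfloor>"
    have n: "real n \<le> t / \<delta>" "t / \<delta> \<le> real (Suc n)"
      using t \<delta> by (auto simp: n_def) linarith+
    have "norm (S t x) \<le> M ^ Suc n * norm x"
      using n(2) \<delta> t by (intro pow) (auto simp: field_simps)
    also have "M ^ n = exp (ln M * n)" using M1 by (simp add: exp_of_nat2_mult)
    then have "M ^ Suc n \<le> M * exp (\<omega> * t)"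
      using M1 mult_left_mono[OF n(1), of "ln M"] by (simp add: \<omega>_def)
    then have "M ^ Suc n * norm x \<le> M * exp (\<omega> * t) * norm x" by (rule mult_right_mono) simp
    finally show ?thesis .
  qed
  moreover have "\<omega> \<ge> 0" using M1 \<delta> by (simp add: \<omega>_def)
  ultimately show ?thesis using M1 by blast
qed

lemma local_bound:
  obtains M where "M \<ge> 1" "\<And>t x. 0 \<le> t \<Longrightarrow> t \<le> T \<Longrightarrow> norm (S t x) \<le> M * norm x"
proof -
  obtain M \<omega> where M: "M \<ge> 1" "\<omega> \<ge> 0" and
    b: "\<And>t x. t \<ge> 0 \<Longrightarrow> norm (S t x) \<le> M * exp (\<omega> * t) * norm x" using growth by blast
  have e: "exp (\<omega> * t) \<le> exp (\<omega> * \<bar>T\<bar>)" if "0 \<le> t" "t \<le> T" for t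
    using that M(2) by (auto intro!: mult_left_mono)
  have "norm (S t x) \<le> M * exp (\<omega> * \<bar>T\<bar>) * norm x" if "0 \<le> t" "t \<le> T" for t x
  proof -
    have "M * exp (\<omega> * t) * norm x \<le> M * exp (\<omega> * \<bar>T\<bar>) * norm x"
      using M by (intro mult_right_mono mult_left_mono e that) auto
    then show ?thesis using b[OF that(1), of x] by linarith
  qed
  moreover have "M * exp (\<omega> * \<bar>T\<bar>) \<ge> 1"
    using M mult_mono[of 1 M 1 "exp (\<omega> * \<bar>T\<bar>)"] by simp
  ultimately show ?thesis using that by blast
qed

text \<open>Factoring out the semigroup at the smaller of the two times leaves an increment at time
  0, where only right continuity is known. This gives continuity from both sides, and the local
  bound makes it joint in time and vector.\<close>

lemma tendsto_S:
  assumes f: "(f \<longlongrightarrow> t) F" and g: "(g \<longlongrightarrow> x) F" and ev: "\<forall>\<^sub>F z in F. 0 \<le> f z" and t: "0 \<le> t"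
  shows "((\<lambda>z. S (f z) (g z)) \<longlongrightarrow> S t x) F"
proof -
  obtain M where M: "M \<ge> 1" "\<And>s x. 0 \<le> s \<Longrightarrow> s \<le> t + 1 \<Longrightarrow> norm (S s x) \<le> M * norm x"
    using local_bound[of "t + 1"] by metis
  have ev2: "\<forall>\<^sub>F z in F. f z < t + 1" using order_tendstoD(2)[OF f, of "t + 1"] by simp
  have c: "continuous (at 0 within {0..}) (\<lambda>s. S s x)"
    unfolding continuous_within at_within_Ici_at_right using S_right[of x] by simp
  have d: "((\<lambda>z. S \<bar>f z - t\<bar> x) \<longlongrightarrow> S 0 x) F"
  proof (rule continuous_within_tendsto_compose'[OF c])
    show "((\<lambda>z. \<bar>f z - t\<bar>) \<longlongrightarrow> 0) F" using f by (simp add: tendsto_rabs_zero_iff LIM_zero_iff)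
  qed simp
  have "((\<lambda>z. S (f z) (g z) - S t x) \<longlongrightarrow> 0) F"
  proof (rule Lim_null_comparison)
    show "\<forall>\<^sub>F z in F. norm (S (f z) (g z) - S t x) \<le> M * norm (g z - x) + M * norm (S \<bar>f z - t\<bar> x - x)"
      using ev ev2
    proof eventually_elim
      case (elim z)
      have "norm (S (f z) x - S t x) \<le> M * norm (S \<bar>f z - t\<bar> x - x)"
      proof (cases "f z \<le> t")
        case True
        have "S t x = S (f z) (S (t - f z) x)" using S_add[of "f z" "t - f z" x] elim True by simp
        then have "S (f z) x - S t x = S (f z) (x - S (t - f z) x)" using elim by (simp add: S_diff)
        then show ?thesis using M(2)[of "f z" "x - S (t - f z) x"] elim True
          by (simp add: norm_minus_commute)
      next
        case False
        then have "S (f z) x = S t (S (f z - t) x)" using S_add[of t "f z - t" x] t by simp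
        then have "S (f z) x - S t x = S t (S (f z - t) x - x)" using t by (simp add: S_diff)
        then show ?thesis using M(2)[of t "S (f z - t) x - x"] t False by simp
      qed
      moreover have "norm (S (f z) (g z) - S (f z) x) \<le> M * norm (g z - x)"
        using M(2)[of "f z" "g z - x"] elim by (simp add: S_diff)
      ultimately show ?case
        using norm_triangle_ineq[of "S (f z) (g z) - S (f z) x" "S (f z) x - S t x"] by simp
    qed
    have "((\<lambda>z. M * norm (g z - x) + M * norm (S \<bar>f z - t\<bar> x - x)) \<longlongrightarrow>
        M * norm (x - x) + M * norm (S 0 x - x)) F"
      by (intro tendsto_intros g d)
    then show "((\<lambda>z. M * norm (g z - x) + M * norm (S \<bar>f z - t\<bar> x - x)) \<longlongrightarrow> 0) F" by simp
  qed
  then show ?thesis by (rule LIM_zero_cancel)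
qed

lemma continuous_on_S:
  assumes "continuous_on Z f" "continuous_on Z g" "\<And>z. z \<in> Z \<Longrightarrow> 0 \<le> f z"
  shows "continuous_on Z (\<lambda>z. S (f z) (g z))"
  using assms unfolding continuous_on_def
  by (auto intro!: tendsto_S simp: eventually_at_filter)

section \<open>Integrals of orbits, the source of vectors in the domain of the generator\<close>

definition Int_S :: "real \<Rightarrow> 'h \<Rightarrow> 'h" where
  "Int_S t x = integral {0..t} (\<lambda>s. S s x)"

lemma integrable_S: "0 \<le> a \<Longrightarrow> (\<lambda>s. S s x) integrable_on {a..b}"
  by (intro integrable_continuous_real continuous_on_S) auto

lemma norm_Int_S_le:
  assumes "0 \<le> t" "\<And>s. 0 \<le> s \<Longrightarrow> s \<le> t \<Longrightarrow> norm (S s x) \<le> b"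
  shows "norm (Int_S t x) \<le> b * t"
proof -
  have "continuous_on {0..t} (\<lambda>s. S s x)" by (intro continuous_on_S continuous_intros) auto
  then show ?thesis using integral_bound[of 0 t "\<lambda>s. S s x" b] assms by (simp add: Int_S_def)
qed

lemma Int_S_add: "Int_S t (x + y) = Int_S t x + Int_S t y"
proof -
  have "Int_S t (x + y) = integral {0..t} (\<lambda>s. S s x + S s y)"
    unfolding Int_S_def by (intro integral_cong) (auto simp: S_plus)
  then show ?thesis by (simp add: Int_S_def integral_add integrable_S)
qed

lemma scal_bounded_linear: "bounded_linear (scal c)"
proof (rule bounded_linear_intro[of _ "norm c"])
  show "scal c (r *\<^sub>R x) = r *\<^sub>R scal c x" for r x
    by (simp add: scale_of_real[symmetric] mult.commute)
qed (auto simp: scale_right_distrib mult.commute)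

lemma Int_S_scal: "Int_S t (scal c x) = scal c (Int_S t x)"
proof -
  have "Int_S t (scal c x) = integral {0..t} (scal c \<circ> (\<lambda>s. S s x))"
    unfolding Int_S_def by (intro integral_cong) (auto simp: S_scal)
  then show ?thesis
    using integral_linear[OF integrable_S scal_bounded_linear] by (simp add: Int_S_def)
qed

lemma Int_S_scaleR: "Int_S t (r *\<^sub>R x) = r *\<^sub>R Int_S t x"
  using Int_S_scal[of t "of_real r" x] by (simp add: scale_of_real)

lemma Int_S_operator:
  assumes "0 \<le> t"
  shows "bounded_operator scal (Int_S t)"
proof (rule bounded_operatorI)
  obtain M where M: "M \<ge> 1" "\<And>s x. 0 \<le> s \<Longrightarrow> s \<le> t \<Longrightarrow> norm (S s x) \<le> M * norm x"
    using local_bound[of t] by metis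
  show "bounded_linear (Int_S t)"
  proof (rule bounded_linear_intro[of _ "M * t"])
    show "norm (Int_S t x) \<le> norm x * (M * t)" for x
      using norm_Int_S_le[OF assms, of x "M * norm x"] M by (simp add: mult_ac)
  qed (auto simp: Int_S_add Int_S_scaleR)
qed (rule Int_S_scal)

lemma S_Int_S_eq_Int_S_S:
  assumes "0 \<le> h" "0 \<le> t"
  shows "S h (Int_S t x) = Int_S t (S h x)"
proof -
  have "S h (Int_S t x) = integral {0..t} (S h \<circ> (\<lambda>s. S s x))"
    unfolding Int_S_def using integral_linear[OF integrable_S S_linear[OF assms(1)]] by simp
  also have "\<dots> = Int_S t (S h x)"
    unfolding Int_S_def using assms by (intro integral_cong) (auto simp: S_commute)
  finally show ?thesis .
qed

lemma Int_S_split: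
  assumes "0 \<le> h" "0 \<le> t"
  shows "Int_S (h + t) x = Int_S h x + S h (Int_S t x)"
proof -
  have "S h (Int_S t x) = integral {0..t} (S h \<circ> (\<lambda>s. S s x))"
    unfolding Int_S_def using integral_linear[OF integrable_S S_linear[OF assms(1)]] by simp
  also have "\<dots> = integral {0..t} ((\<lambda>s. S s x) \<circ> (+) h)"
    using assms by (intro integral_cong) (auto simp: S_add)
  also have "\<dots> = integral {h..h + t} (\<lambda>s. S s x)"
    by (subst integral_shift_Icc_real) (simp add: add.commute)
  finally show ?thesis
    using Henstock_Kurzweil_Integration.integral_combine[of 0 h "h + t" "\<lambda>s. S s x"] assms integrable_S by (simp add: Int_S_def)
qed

lemma Int_S_quotient: "((\<lambda>h. (1 / h) *\<^sub>R Int_S h x) \<longlongrightarrow> x) (at_right 0)"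
proof -
  have "((\<lambda>u. integral {0..u} (\<lambda>s. S s x)) has_vector_derivative S 0 x) (at 0 within {0..1})"
    by (intro integral_has_vector_derivative continuous_on_S) (auto intro: continuous_intros)
  from right_quotient_tendsto[OF this] show ?thesis by (simp add: Int_S_def)
qed

lemma quotient_Int_S:
  assumes t: "0 \<le> t"
  shows "((\<lambda>h. (1 / h) *\<^sub>R (S h (Int_S t x) - Int_S t x)) \<longlongrightarrow> S t x - x) (at_right 0)"
proof -
  \<comment> \<open>Splitting the integral over [0, h + t] at \<open>h\<close> and at
    \<open>t\<close> exchanges the two lengths, so the quotient in \<open>h\<close> acts on a mean
    over the short interval.\<close>
  have eq: "S h (Int_S t x) - Int_S t x = S t (Int_S h x) - Int_S h x" if "0 \<le> h" for h
  proof -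
    have "Int_S h x + S h (Int_S t x) = Int_S t x + S t (Int_S h x)"
      using Int_S_split[OF that t, of x] Int_S_split[OF t that, of x] add.commute[of h t] by metis
    then show ?thesis by (simp add: algebra_simps)
  qed
  have ev: "\<forall>\<^sub>F h in at_right 0. S t ((1 / h) *\<^sub>R Int_S h x) - (1 / h) *\<^sub>R Int_S h x =
      (1 / h) *\<^sub>R (S h (Int_S t x) - Int_S t x)"
    unfolding eventually_at_right_field
    by (intro exI[of _ 1]) (use t in \<open>auto simp: eq S_scaleR scaleR_diff_right\<close>)
  have "((\<lambda>h. S t ((1 / h) *\<^sub>R Int_S h x) - (1 / h) *\<^sub>R Int_S h x) \<longlongrightarrow> S t x - x) (at_right 0)"
    using t by (intro tendsto_intros tendsto_S Int_S_quotient) auto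
  then show ?thesis using tendsto_cong[OF ev] by blast
qed

end

section \<open>The generator on its domain and the derivative of orbits\<close>

locale generator = semigroup scal ip S
  for scal :: "'k::real_or_complex \<Rightarrow> 'h::banach \<Rightarrow> 'h" and ip :: "'h \<Rightarrow> 'h \<Rightarrow> 'k" and S +
  fixes D :: "'h set" and A :: "'h \<Rightarrow> 'h"
  assumes gen: "generates scal D A S"
begin

lemma D_iff: "x \<in> D \<longleftrightarrow> (\<exists>y. ((\<lambda>t. (1 / t) *\<^sub>R (S t x - x)) \<longlongrightarrow> y) (at_right 0))"
  using gen by (auto simp: generates_def)

lemma A_lim: "x \<in> D \<Longrightarrow> ((\<lambda>t. (1 / t) *\<^sub>R (S t x - x)) \<longlongrightarrow> A x) (at_right 0)"
  using gen by (auto simp: generates_def)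

lemma DI:
  assumes "((\<lambda>t. (1 / t) *\<^sub>R (S t x - x)) \<longlongrightarrow> y) (at_right 0)"
  shows "x \<in> D" "A x = y"
proof -
  show "x \<in> D" using assms D_iff by blast
  from A_lim[OF this] assms show "A x = y" by (rule tendsto_unique[rotated]) simp
qed

lemma Int_S_D:
  assumes "0 \<le> t" shows "Int_S t x \<in> D" "A (Int_S t x) = S t x - x"
  using DI[OF quotient_Int_S[OF assms]] by auto

lemma D_dense: "closure D = UNIV"
proof -
  have "x \<in> closure D" for x
  proof (rule Lim_in_closed_set[OF closed_closure _ _ Int_S_quotient])
    have "(1 / h) *\<^sub>R Int_S h x \<in> closure D" if "0 < h" for h
      using Int_S_D(1)[of h "(1 / h) *\<^sub>R x"] closure_subset[of D] that
      by (auto simp: Int_S_scaleR)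
    then show "\<forall>\<^sub>F h in at_right 0. (1 / h) *\<^sub>R Int_S h x \<in> closure D"
      unfolding eventually_at_right_field
      by (intro exI[of _ 1]) simp
  qed simp
  then show ?thesis by blast
qed

lemma S_D:
  assumes t: "0 \<le> t" and x: "x \<in> D"
  shows "S t x \<in> D" "A (S t x) = S t (A x)"
proof -
  have ev: "\<forall>\<^sub>F h in at_right 0. S t ((1 / h) *\<^sub>R (S h x - x)) = (1 / h) *\<^sub>R (S h (S t x) - S t x)"
  proof -
    have "S t ((1 / h) *\<^sub>R (S h x - x)) = (1 / h) *\<^sub>R (S h (S t x) - S t x)" if "h > 0" for h
      using S_commute[of h t x] that t by (simp add: S_scaleR S_diff)
    then show ?thesis unfolding eventually_at_right_field by (intro exI[of _ 1]) simp
  qed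
  have "((\<lambda>h. S t ((1 / h) *\<^sub>R (S h x - x))) \<longlongrightarrow> S t (A x)) (at_right 0)"
    using t by (intro tendsto_S A_lim x tendsto_const) auto
  then have "((\<lambda>h. (1 / h) *\<^sub>R (S h (S t x) - S t x)) \<longlongrightarrow> S t (A x)) (at_right 0)"
    using tendsto_cong[OF ev] by blast
  from DI[OF this] show "S t x \<in> D" "A (S t x) = S t (A x)" by auto
qed

text \<open>Since \<open>S h\<close> commutes with \<open>Int_S t\<close>, the quotient of the
  integral is the integral of the quotient; it has one limit for every \<open>x\<close> and another,
  in terms of \<open>A x\<close>, on \<open>D\<close>.\<close>

lemma Int_S_A:
  assumes t: "0 \<le> t" and x: "x \<in> D"
  shows "Int_S t (A x) = S t x - x"
proof -
  have ev: "\<forall>\<^sub>F h in at_right 0. (1 / h) *\<^sub>R (S h (Int_S t x) - Int_S t x) = Int_S t ((1 / h) *\<^sub>R (S h x - x))"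
  proof -
    have "(1 / h) *\<^sub>R (S h (Int_S t x) - Int_S t x) = Int_S t ((1 / h) *\<^sub>R (S h x - x))" if "h > 0" for h
      using Int_S_add[of t "S h x - x" x] S_Int_S_eq_Int_S_S[of h t x] that t
      by (simp add: Int_S_scaleR)
    then show ?thesis unfolding eventually_at_right_field by (intro exI[of _ 1]) simp
  qed
  have "((\<lambda>h. Int_S t ((1 / h) *\<^sub>R (S h x - x))) \<longlongrightarrow> Int_S t (A x)) (at_right 0)"
    by (intro bounded_linear.tendsto[OF bounded_operatorD(1)[OF Int_S_operator[OF t]]] A_lim x)
  moreover have "((\<lambda>h. Int_S t ((1 / h) *\<^sub>R (S h x - x))) \<longlongrightarrow> S t x - x) (at_right 0)"
    using tendsto_cong[OF ev] quotient_Int_S[OF t] by blast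
  ultimately show ?thesis by (rule tendsto_unique[rotated]) simp
qed

text \<open>The generator is defined by a right limit, but \<open>S s x = x + Int_S s (A x)\<close>
  presents the orbit as an integral, which is differentiable from both sides.\<close>

lemma orbit_derivative:
  assumes t: "t \<in> {0..T}" and x: "x \<in> D"
  shows "((\<lambda>s. S s x) has_vector_derivative S t (A x)) (at t within {0..T})"
proof (rule has_vector_derivative_transform[OF t])
  have "((\<lambda>u. integral {0..u} (\<lambda>s. S s (A x))) has_vector_derivative S t (A x)) (at t within {0..T})"
    using t by (intro integral_has_vector_derivative continuous_on_S) (auto intro: continuous_intros)
  then show "((\<lambda>s. x + Int_S s (A x)) has_vector_derivative S t (A x)) (at t within {0..T})"
    unfolding Int_S_def by (auto intro!: derivative_eq_intros)
  show "S s x = x + Int_S s (A x)" if "s \<in> {0..T}" for s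
    using Int_S_A[OF _ x] that by simp
qed

end

section \<open>Bounded perturbation of a generator\<close>

text \<open>The supremum s is finite and satisfies s \<le> c + s/2. Serves both uniqueness (c = 0)
  and the a priori bound of mild solutions.\<close>

lemma halving_bound:
  fixes n :: "'a \<Rightarrow> real"
  assumes step: "\<And>B. (\<And>t. t \<in> T \<Longrightarrow> n t \<le> B) \<Longrightarrow> (\<And>t. t \<in> T \<Longrightarrow> n t \<le> c + B / 2)"
    and bdd: "\<And>t. t \<in> T \<Longrightarrow> n t \<le> B" and t: "t \<in> T"
  shows "n t \<le> 2 * c"
proof -
  define s where "s = (SUP t\<in>T. n t)"
  have b: "bdd_above (n ` T)" using bdd by (meson bdd_aboveI2)
  have "s \<le> c + s / 2"
    unfolding s_def using t by (intro cSUP_least step cSUP_upper b) auto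
  then show ?thesis using cSUP_upper[OF t b] by (simp add: s_def)
qed

context semigroup
begin

text \<open>An exponential factor turns the growth bound into decay, and the inverse factor undoes
  this after the perturbation.\<close>

lemma C0_semigroup_scaled: "C0_semigroup scal (\<lambda>t x. exp (a * t) *\<^sub>R S t x)"
  unfolding C0_semigroup_def
proof (intro conjI allI impI)
  fix t :: real assume t: "0 \<le> t"
  show "bounded_operator scal (\<lambda>x. exp (a * t) *\<^sub>R S t x)"
  proof (rule bounded_operatorI)
    show "bounded_linear (\<lambda>x. exp (a * t) *\<^sub>R S t x)"
      using bounded_linear_compose[OF bounded_linear_scaleR_right S_linear[OF t]] .
    show "exp (a * t) *\<^sub>R S t (scal c x) = scal c (exp (a * t) *\<^sub>R S t x)" for c x
      by (simp add: S_scal[OF t] linear_scale[OF bounded_linear.linear[OF scal_bounded_linear]])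
  qed
next
  show "(\<lambda>x. exp (a * 0) *\<^sub>R S 0 x) = id" by auto
next
  fix s t :: real assume "0 \<le> s" "0 \<le> t"
  then show "(\<lambda>x. exp (a * (s + t)) *\<^sub>R S (s + t) x) =
      (\<lambda>x. exp (a * s) *\<^sub>R S s x) \<circ> (\<lambda>x. exp (a * t) *\<^sub>R S t x)"
    by (auto simp: S_add S_scaleR distrib_left exp_add fun_eq_iff)
next
  fix x
  have "((\<lambda>t. exp (a * t) *\<^sub>R S t x) \<longlongrightarrow> exp (a * 0) *\<^sub>R x) (at_right 0)"
    by (intro tendsto_intros S_right)
  then show "((\<lambda>t. exp (a * t) *\<^sub>R S t x) \<longlongrightarrow> x) (at_right 0)" by simp
qed

end

text \<open>The exponential decay makes the map \<open>w \<mapsto> S x + S * K w\<close> a contraction on the bounded continuous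
  functions on \<open>[0, \<infinity>)\<close>.\<close>

locale decaying_perturbation = semigroup scal ip S
  for scal :: "'k::real_or_complex \<Rightarrow> 'h::banach \<Rightarrow> 'h" and ip :: "'h \<Rightarrow> 'h \<Rightarrow> 'k" and S +
  fixes K :: "'h \<Rightarrow> 'h" and M k \<kappa> :: real
  assumes K: "bounded_operator scal K" and K_le: "\<And>x. norm (K x) \<le> k * norm x"
    and k: "0 \<le> k" and M: "1 \<le> M" and \<kappa>: "0 < \<kappa>" "2 * M * k \<le> \<kappa>"
    and decay: "\<And>t x. 0 \<le> t \<Longrightarrow> norm (S t x) \<le> M * exp (- \<kappa> * t) * norm x"
begin

lemmas K_linear = bounded_operatorD(1)[OF K]
lemmas K_scal = bounded_operatorD(2)[OF K]

lemma continuous_on_K: "continuous_on Z f \<Longrightarrow> continuous_on Z (\<lambda>z. K (f z))"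
  by (rule bounded_linear.continuous_on[OF K_linear])

definition conv :: "(real \<Rightarrow> 'h) \<Rightarrow> real \<Rightarrow> 'h" where
  "conv f t = integral {0..t} (\<lambda>s. S (t - s) (K (f s)))"

text \<open>The substitution s = t r moves \<open>t\<close> from the limits of integration into the
  integrand: continuity of the convolution becomes that of a parameter integral, and the value at 0
  is its right derivative \<open>K (f 0)\<close>.\<close>

definition mean_conv :: "(real \<Rightarrow> 'h) \<Rightarrow> real \<Rightarrow> 'h" where
  "mean_conv f t = integral {0..1} (\<lambda>s. S (t * (1 - s)) (K (f (t * s))))"

lemma conv_integrable:
  assumes "continuous_on {0..} f"
  shows "0 \<le> a \<Longrightarrow> b \<le> t \<Longrightarrow> (\<lambda>s. S (t - s) (K (f s))) integrable_on {a..b}"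
  using assms
  by (intro integrable_continuous_real continuous_on_S continuous_on_K continuous_intros)
    (auto elim: continuous_on_subset)

lemma conv_eq_mean_conv:
  assumes f: "continuous_on {0..} f" and t: "0 \<le> t"
  shows "conv f t = t *\<^sub>R mean_conv f t"
proof (cases "t = 0")
  case False
  with t have t: "t > 0" by simp
  have "((\<lambda>s. S (t - s) (K (f s))) has_integral conv f t) (cbox 0 t)"
    using conv_integrable[OF f, of 0 t t] unfolding conv_def by (simp add: has_integral_integral)
  from has_integral_affinity'[OF this t, of 0]
  have "((\<lambda>s. S (t * (1 - s)) (K (f (t * s)))) has_integral (conv f t /\<^sub>R t)) {0..1}"
    using t by (simp add: right_diff_distrib)
  then show ?thesis using t by (simp add: mean_conv_def integral_unique)
qed (simp add: conv_def)

lemma continuous_on_mean_conv: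
  assumes f: "continuous_on {0..} f"
  shows "continuous_on {0..} (mean_conv f)"
proof -
  have f': "continuous_on ({0..} \<times> {0..1}) (\<lambda>z. f (fst z * snd z))"
    by (rule continuous_on_compose2[OF f]) (auto intro!: continuous_intros)
  have "continuous_on ({0..} \<times> cbox 0 1) (\<lambda>(t, s). S (t * (1 - s)) (K (f (t * s))))"
    unfolding case_prod_unfold
    by (intro continuous_on_S continuous_on_K continuous_intros f'[unfolded box_real[symmetric]])
      (auto intro!: mult_nonneg_nonneg)
  from integral_continuous_on_param[OF this] show ?thesis
    by (simp add: mean_conv_def[abs_def])
qed

lemma continuous_on_conv:
  assumes f: "continuous_on {0..} f"
  shows "continuous_on {0..} (conv f)"
  using continuous_on_mean_conv[OF f]
  by (subst continuous_on_cong[OF refl conv_eq_mean_conv[OF f]]) (auto intro!: continuous_intros)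

text \<open>The kernel is dominated by M k exp(-\<kappa>(t-s)), whose integral is at most M k /
  \<kappa>; the hypothesis \<open>2 * M * k \<le> \<kappa>\<close> makes this at most 1/2.\<close>

lemma norm_conv_le:
  assumes f: "continuous_on {0..} f" and B: "\<And>s. 0 \<le> s \<Longrightarrow> norm (f s) \<le> B" and t: "0 \<le> t"
  shows "norm (conv f t) \<le> B / 2"
proof -
  have B0: "0 \<le> B" using order_trans[OF norm_ge_zero B[of 0]] by simp
  have "((\<lambda>s. exp (- \<kappa> * (t - s))) has_integral
      (exp (- \<kappa> * (t - t)) / \<kappa> - exp (- \<kappa> * (t - 0)) / \<kappa>)) {0..t}"
    using \<kappa>(1) t
    by (intro fundamental_theorem_of_calculus)
      (auto intro!: derivative_eq_intros simp flip: has_real_derivative_iff_has_vector_derivative)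
  from has_integral_mult_right[OF this, of "M * k * B"]
  have I: "((\<lambda>s. M * k * B * exp (- \<kappa> * (t - s))) has_integral
      M * k * B * ((1 - exp (- \<kappa> * t)) / \<kappa>)) {0..t}"
    by (simp add: diff_divide_distrib)
  have "norm (conv f t) \<le> integral {0..t} (\<lambda>s. M * k * B * exp (- \<kappa> * (t - s)))"
    unfolding conv_def
  proof (rule integral_norm_bound_integral)
    show "(\<lambda>s. S (t - s) (K (f s))) integrable_on {0..t}" using conv_integrable[OF f, of 0 t t] by simp
    show "(\<lambda>s. M * k * B * exp (- \<kappa> * (t - s))) integrable_on {0..t}" using I by blast
    fix s assume s: "s \<in> {0..t}"
    have "norm (S (t - s) (K (f s))) \<le> M * exp (- \<kappa> * (t - s)) * norm (K (f s))"
      using decay s by simp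
    also have "\<dots> \<le> M * exp (- \<kappa> * (t - s)) * (k * B)"
      using M order_trans[OF K_le mult_left_mono[OF B k]] s by (intro mult_left_mono) auto
    finally show "norm (S (t - s) (K (f s))) \<le> M * k * B * exp (- \<kappa> * (t - s))"
      by (simp add: mult_ac)
  qed
  also have "\<dots> = M * k * B * ((1 - exp (- \<kappa> * t)) / \<kappa>)" by (rule integral_unique[OF I])
  also have "\<dots> \<le> M * k * B * (1 / \<kappa>)"
    using M k B0 \<kappa>(1) by (intro mult_left_mono divide_right_mono) auto
  also have "\<dots> = (2 * M * k) / \<kappa> * (B / 2)" using \<kappa> by simp
  also have "\<dots> \<le> 1 * (B / 2)" using \<kappa> B0 by (intro mult_right_mono) auto
  finally show ?thesis by simp
qed

lemma conv_diff:
  assumes "continuous_on {0..} f" "continuous_on {0..} g" "0 \<le> t"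
  shows "conv f t - conv g t = conv (\<lambda>s. f s - g s) t"
proof -
  have "conv (\<lambda>s. f s - g s) t = integral {0..t} (\<lambda>s. S (t - s) (K (f s)) - S (t - s) (K (g s)))"
    unfolding conv_def
    by (intro integral_cong) (auto simp: S_diff linear_diff[OF bounded_linear.linear[OF K_linear]])
  then show ?thesis
    using assms by (simp add: conv_def integral_diff conv_integrable)
qed

lemma conv_add:
  assumes "continuous_on {0..} f" "continuous_on {0..} g" "0 \<le> t"
  shows "conv f t + conv g t = conv (\<lambda>s. f s + g s) t"
proof -
  have "conv (\<lambda>s. f s + g s) t = integral {0..t} (\<lambda>s. S (t - s) (K (f s)) + S (t - s) (K (g s)))"
    unfolding conv_def
    by (intro integral_cong) (auto simp: S_plus linear_add[OF bounded_linear.linear[OF K_linear]])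
  then show ?thesis
    using assms by (simp add: conv_def integral_add conv_integrable)
qed

lemma conv_scal:
  assumes "continuous_on {0..} f" "0 \<le> t"
  shows "scal c (conv f t) = conv (\<lambda>s. scal c (f s)) t"
proof -
  have "conv (\<lambda>s. scal c (f s)) t = integral {0..t} (scal c \<circ> (\<lambda>s. S (t - s) (K (f s))))"
    unfolding conv_def by (intro integral_cong) (auto simp: S_scal K_scal)
  then show ?thesis
    using integral_linear[OF conv_integrable[OF assms(1)] scal_bounded_linear] assms
    by (simp add: conv_def)
qed

text \<open>Together with uniqueness this yields the semigroup law: the solution restarted at time
  \<open>r\<close> solves the same equation.\<close>

lemma conv_split:
  assumes f: "continuous_on {0..} f" and r: "0 \<le> r" "0 \<le> t"
  shows "conv f (r + t) = S t (conv f r) + conv (\<lambda>s. f (r + s)) t"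
proof -
  let ?g = "\<lambda>s. S (r + t - s) (K (f s))"
  have "S t (conv f r) = integral {0..r} (S t \<circ> (\<lambda>s. S (r - s) (K (f s))))"
    unfolding conv_def using integral_linear[OF conv_integrable[OF f] S_linear[OF r(2)]] r by simp
  also have "\<dots> = integral {0..r} ?g"
  proof (rule integral_cong)
    fix s assume "s \<in> {0..r}"
    then show "(S t \<circ> (\<lambda>s. S (r - s) (K (f s)))) s = ?g s"
      using S_add[of t "r - s" "K (f s)"] r by (simp add: algebra_simps)
  qed
  finally have 1: "S t (conv f r) = integral {0..r} ?g" .
  have "conv (\<lambda>s. f (r + s)) t = integral {0..t} (?g \<circ> (+) r)"
    unfolding conv_def by (intro integral_cong) (auto simp: algebra_simps)
  also have "\<dots> = integral {r..r + t} ?g" by (subst integral_shift_Icc_real) (simp add: add.commute)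
  finally show ?thesis
    using Henstock_Kurzweil_Integration.integral_combine[of 0 r "r + t" ?g] conv_integrable[OF f, of 0 "r + t" "r + t"] r
    unfolding 1 by (simp add: conv_def)
qed

text \<open>Mild solutions of the perturbed equation. Boundedness is part of the notion because
  \<open>halving_bound\<close> needs a finite supremum.\<close>

definition solves :: "'h \<Rightarrow> (real \<Rightarrow> 'h) \<Rightarrow> bool" where
  "solves x w \<longleftrightarrow> continuous_on {0..} w \<and> (\<exists>B. \<forall>t\<ge>0. norm (w t) \<le> B) \<and>
    (\<forall>t\<ge>0. w t = S t x + conv w t)"

lemma solves_unique:
  assumes "solves x v" "solves x w" "0 \<le> t"
  shows "v t = w t"
proof -
  have c: "continuous_on {0..} v" "continuous_on {0..} w" using assms by (auto simp: solves_def)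
  obtain B1 B2 where B: "\<And>t. t \<ge> 0 \<Longrightarrow> norm (v t) \<le> B1" "\<And>t. t \<ge> 0 \<Longrightarrow> norm (w t) \<le> B2"
    using assms unfolding solves_def by meson
  have eq: "v t - w t = conv (\<lambda>s. v s - w s) t" if "0 \<le> t" for t
    using assms(1,2) that by (subst conv_diff[OF c that, symmetric]) (simp add: solves_def)
  have "norm (v t - w t) \<le> 2 * 0"
  proof (rule halving_bound[where n = "\<lambda>t. norm (v t - w t)" and T = "{0..}" and B = "B1 + B2"])
    fix B t assume "\<And>t. t \<in> {0..} \<Longrightarrow> norm (v t - w t) \<le> B" "t \<in> {0::real..}"
    then show "norm (v t - w t) \<le> 0 + B / 2"
      using norm_conv_le[of "\<lambda>s. v s - w s" B t] c by (simp add: eq continuous_on_diff)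
  next
    fix t assume "t \<in> {0::real..}"
    then show "norm (v t - w t) \<le> B1 + B2"
      using norm_triangle_ineq4[of "v t" "w t"] B[of t] by simp
  qed (use assms in auto)
  then show ?thesis by simp
qed

lemma solves_bound:
  assumes "solves x w" "0 \<le> t"
  shows "norm (w t) \<le> 2 * (M * norm x)"
proof -
  obtain B where B: "\<And>t. t \<ge> 0 \<Longrightarrow> norm (w t) \<le> B" using assms unfolding solves_def by meson
  show ?thesis
  proof (rule halving_bound[where n = "\<lambda>t. norm (w t)" and T = "{0..}" and B = B])
    fix B t assume *: "\<And>t. t \<in> {0..} \<Longrightarrow> norm (w t) \<le> B" and t: "t \<in> {0::real..}"
    have "norm (S t x) \<le> M * exp (- \<kappa> * t) * norm x" using decay t by simp
    also have "\<dots> \<le> M * 1 * norm x"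
      using t M \<kappa>(1) by (intro mult_right_mono mult_left_mono) auto
    finally have "norm (S t x) \<le> M * norm x" by simp
    moreover have "norm (conv w t) \<le> B / 2"
      using * t assms by (intro norm_conv_le) (auto simp: solves_def)
    ultimately have "norm (S t x + conv w t) \<le> M * norm x + B / 2"
      using norm_triangle_ineq[of "S t x" "conv w t"] by linarith
    moreover have "w t = S t x + conv w t" using assms(1) t by (simp add: solves_def)
    ultimately show "norm (w t) \<le> M * norm x + B / 2" by simp
  qed (use assms B in auto)
qed

lemma solves_exists: "\<exists>w. solves x w"
proof -
  \<comment> \<open>The Banach space of bounded continuous functions lives on the whole line;
    \<open>max 0 t\<close> continues the values constantly to negative times.\<close>
  define \<Gamma> where "\<Gamma> w t = S (max 0 t) x + conv w (max 0 t)" for w t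
  have cw: "continuous_on {0..} (apply_bcontfun w)" for w :: "real \<Rightarrow>\<^sub>C 'h" by simp
  have bw: "norm (apply_bcontfun w t) \<le> norm w" for w :: "real \<Rightarrow>\<^sub>C 'h" and t
    by (rule norm_bounded)
  have \<Gamma>: "\<Gamma> (apply_bcontfun w) \<in> bcontfun" for w :: "real \<Rightarrow>\<^sub>C 'h"
    unfolding bcontfun_def
  proof (intro CollectI conjI)
    show "continuous_on UNIV (\<Gamma> (apply_bcontfun w))"
      unfolding \<Gamma>_def
      by (intro continuous_on_add continuous_on_S continuous_on_compose2[OF continuous_on_conv[OF cw]]
          continuous_intros) auto
    have "norm (\<Gamma> (apply_bcontfun w) t) \<le> M * norm x + norm w / 2" for t
    proof -
      have "norm (S (max 0 t) x) \<le> M * exp (- \<kappa> * max 0 t) * norm x" by (rule decay) simp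
      also have "\<dots> \<le> M * 1 * norm x"
        using M \<kappa>(1) by (intro mult_right_mono mult_left_mono) auto
      finally have "norm (S (max 0 t) x) \<le> M * norm x" by simp
      moreover have "norm (conv (apply_bcontfun w) (max 0 t)) \<le> norm w / 2"
        using bw by (intro norm_conv_le cw) auto
      ultimately show ?thesis
        unfolding \<Gamma>_def by (intro norm_triangle_le) linarith
    qed
    then show "bounded (range (\<Gamma> (apply_bcontfun w)))" by (auto intro!: boundedI)
  qed
  have app: "apply_bcontfun (Bcontfun (\<Gamma> (apply_bcontfun w))) = \<Gamma> (apply_bcontfun w)" for w :: "real \<Rightarrow>\<^sub>C 'h"
    by (rule Bcontfun_inverse[OF \<Gamma>])
  have contr: "dist (Bcontfun (\<Gamma> (apply_bcontfun v))) (Bcontfun (\<Gamma> (apply_bcontfun w))) \<le> 1/2 * dist v w"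
    for v w :: "real \<Rightarrow>\<^sub>C 'h"
  proof (rule dist_bound)
    fix t
    have "norm (conv (\<lambda>s. apply_bcontfun v s - apply_bcontfun w s) (max 0 t)) \<le> dist v w / 2"
      by (intro norm_conv_le continuous_on_diff cw) (auto simp: dist_norm[symmetric] dist_bounded)
    then show "dist (apply_bcontfun (Bcontfun (\<Gamma> (apply_bcontfun v))) t)
        (apply_bcontfun (Bcontfun (\<Gamma> (apply_bcontfun w))) t) \<le> 1/2 * dist v w"
      unfolding app by (simp add: \<Gamma>_def dist_norm conv_diff[OF cw cw])
  qed
  have "\<exists>!w::real \<Rightarrow>\<^sub>C 'h. Bcontfun (\<Gamma> (apply_bcontfun w)) = w"
    by (rule banach_fix_type[of "1/2"]) (use contr in auto)
  then obtain w :: "real \<Rightarrow>\<^sub>C 'h" where w: "Bcontfun (\<Gamma> (apply_bcontfun w)) = w" by blast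
  have "apply_bcontfun w t = S t x + conv w t" if "0 \<le> t" for t
    using arg_cong[OF w, of apply_bcontfun] that unfolding app by (metis \<Gamma>_def max_absorb2)
  moreover have "continuous_on {0..} (apply_bcontfun w)" by simp
  ultimately have "solves x (apply_bcontfun w)"
    unfolding solves_def using bw by blast
  then show ?thesis by blast
qed

definition W :: "real \<Rightarrow> 'h \<Rightarrow> 'h" where
  "W t x = (SOME w. solves x w) t"

lemma solves_W: "solves x (\<lambda>t. W t x)"
  unfolding W_def using someI_ex[OF solves_exists] .

lemma W_eqI: "solves x w \<Longrightarrow> 0 \<le> t \<Longrightarrow> W t x = w t"
  using solves_unique[OF solves_W] .

lemma continuous_on_W: "continuous_on {0..} (\<lambda>t. W t x)"
  using solves_W by (simp add: solves_def)

lemma W_eq: "0 \<le> t \<Longrightarrow> W t x = S t x + conv (\<lambda>t. W t x) t"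
  using solves_W[of x] by (simp add: solves_def)

lemma W_0: "W 0 x = x"
  using W_eq[of 0 x] by (simp add: conv_def)

text \<open>Linearity and the semigroup law all follow from uniqueness, by checking that the
  expected expression is a mild solution with the right initial value.\<close>

lemma C0_semigroup_W: "C0_semigroup scal W"
  unfolding C0_semigroup_def
proof (intro conjI allI impI)
  fix t :: real assume t: "0 \<le> t"
  have scal: "W t (scal c x) = scal c (W t x)" for c x
  proof (rule W_eqI[OF _ t])
    show "solves (scal c x) (\<lambda>t. scal c (W t x))"
      unfolding solves_def
    proof (intro conjI allI impI)
      show "continuous_on {0..} (\<lambda>t. scal c (W t x))"
        by (intro bounded_linear.continuous_on[OF scal_bounded_linear] continuous_on_W)
      show "\<exists>B. \<forall>t\<ge>0. norm (scal c (W t x)) \<le> B"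
        using solves_bound[OF solves_W, of _ x]
        by (intro exI[of _ "norm c * (2 * (M * norm x))"]) (auto intro!: mult_left_mono)
      show "scal c (W t x) = S t (scal c x) + conv (\<lambda>t. scal c (W t x)) t" if "0 \<le> t" for t
        using arg_cong[OF W_eq[OF that, of x], of "scal c"]
        by (simp only: S_scal[OF that] scale_right_distrib conv_scal[OF continuous_on_W that, of c x])
    qed
  qed
  have add: "W t (x + y) = W t x + W t y" for x y
  proof (rule W_eqI[OF _ t])
    show "solves (x + y) (\<lambda>t. W t x + W t y)"
      unfolding solves_def
    proof (intro conjI allI impI)
      show "continuous_on {0..} (\<lambda>t. W t x + W t y)"
        by (intro continuous_on_add continuous_on_W)
      show "\<exists>B. \<forall>t\<ge>0. norm (W t x + W t y) \<le> B"
        using solves_bound[OF solves_W, of _ x] solves_bound[OF solves_W, of _ y]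
        by (auto intro!: exI norm_triangle_mono)
      show "W t x + W t y = S t (x + y) + conv (\<lambda>t. W t x + W t y) t" if "0 \<le> t" for t
      proof -
        have "W t x + W t y = (S t x + conv (\<lambda>t. W t x) t) + (S t y + conv (\<lambda>t. W t y) t)"
          by (rule arg_cong2[OF W_eq[OF that] W_eq[OF that]])
        also have "\<dots> = S t (x + y) + (conv (\<lambda>t. W t x) t + conv (\<lambda>t. W t y) t)"
          by (simp add: S_plus[OF that])
        finally show ?thesis unfolding conv_add[OF continuous_on_W continuous_on_W that] .
      qed
    qed
  qed
  show "bounded_operator scal (W t)"
  proof (rule bounded_operatorI)
    show "bounded_linear (W t)"
    proof (rule bounded_linear_intro[of _ "2 * M"])
      show "W t (r *\<^sub>R x) = r *\<^sub>R W t x" for r x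
        using scal[of "of_real r" x] by (simp add: scale_of_real)
      show "norm (W t x) \<le> norm x * (2 * M)" for x
        using solves_bound[OF solves_W t, of x] by (simp add: mult_ac)
    qed (rule add)
  qed (rule scal)
next
  show "W 0 = id" by (auto simp: W_0)
next
  fix s t :: real assume st: "0 \<le> s" "0 \<le> t"
  show "W (s + t) = W s \<circ> W t"
  proof
    fix x
    have "W s (W t x) = W (t + s) x"
    proof (rule W_eqI[OF _ st(1)])
      show "solves (W t x) (\<lambda>s. W (t + s) x)"
        unfolding solves_def
      proof (intro conjI allI impI)
        show "continuous_on {0..} (\<lambda>s. W (t + s) x)"
          using st by (intro continuous_on_compose2[OF continuous_on_W] continuous_intros) auto
        show "\<exists>B. \<forall>s\<ge>0. norm (W (t + s) x) \<le> B"
          using solves_bound[OF solves_W, of _ x] st by (intro exI[of _ "2 * (M * norm x)"]) simp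
        fix r :: real assume r: "0 \<le> r"
        have "W (t + r) x = S (r + t) x + conv (\<lambda>t. W t x) (t + r)"
          using W_eq[of "t + r" x] st r by (simp add: add.commute)
        also have "\<dots> = S r (S t x + conv (\<lambda>t. W t x) t) + conv (\<lambda>s. W (t + s) x) r"
          using st r by (simp add: conv_split[OF continuous_on_W] S_add S_plus)
        also have "S t x + conv (\<lambda>t. W t x) t = W t x" using W_eq[of t x] st by simp
        finally show "W (t + r) x = S r (W t x) + conv (\<lambda>s. W (t + s) x) r" .
      qed
    qed
    then show "W (s + t) x = (W s \<circ> W t) x" by (simp add: add.commute)
  qed
next
  fix x
  show "((\<lambda>t. W t x) \<longlongrightarrow> x) (at_right 0)"
    using continuous_on_W[of x] unfolding continuous_on_def
    by (metis W_0 at_within_Ici_at_right atLeast_iff order_refl)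
qed

text \<open>The convolution divided by \<open>t\<close> is \<open>mean_conv\<close>, continuous up
  to 0. As the limit exists for every \<open>x\<close>, the difference quotients of both semigroups
  converge for the same \<open>x\<close>: the domain is unchanged and the generator changes by
  \<open>K\<close>.\<close>

lemma W_quotient: "((\<lambda>t. (1 / t) *\<^sub>R (W t x - S t x)) \<longlongrightarrow> K x) (at_right 0)"
proof -
  have "(mean_conv (\<lambda>t. W t x) \<longlongrightarrow> mean_conv (\<lambda>t. W t x) 0) (at_right 0)"
    using continuous_on_mean_conv[OF continuous_on_W, of x] unfolding continuous_on_def
    by (metis at_within_Ici_at_right atLeast_iff order_refl)
  moreover have "mean_conv (\<lambda>t. W t x) 0 = K x" by (simp add: mean_conv_def W_0)
  moreover have "\<forall>\<^sub>F t in at_right 0. mean_conv (\<lambda>t. W t x) t = (1 / t) *\<^sub>R (W t x - S t x)"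
    unfolding eventually_at_right_field
    by (intro exI[of _ 1]) (auto simp: W_eq conv_eq_mean_conv[OF continuous_on_W] )
  ultimately show ?thesis by (auto intro: Lim_transform_eventually)
qed

end

theorem (in generator) bounded_perturbation:
  assumes K: "bounded_operator scal K"
  shows "is_generator scal D (\<lambda>x. A x + K x)"
proof -
  obtain M \<omega> where M: "M \<ge> 1" "\<omega> \<ge> 0" and
    b: "\<And>t x. t \<ge> 0 \<Longrightarrow> norm (S t x) \<le> M * exp (\<omega> * t) * norm x" using growth by blast
  obtain k where k: "k \<ge> 0" "\<And>x. norm (K x) \<le> norm x * k"
    using bounded_linear.nonneg_bounded[OF bounded_operatorD(1)[OF K]] by blast
  \<comment> \<open>The added 1 keeps \<open>\<kappa>\<close> positive for \<open>k = 0\<close>;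
    shifting by \<open>\<omega> + \<kappa>\<close> turns growth at rate \<open>\<omega>\<close> into
    decay at rate \<open>\<kappa>\<close>.\<close>
  define \<kappa> where "\<kappa> = 2 * M * k + 1"
  define l where "l = \<omega> + \<kappa>"
  define G where "G t x = exp (- l * t) *\<^sub>R S t x" for t x
  have "C0_semigroup scal G" unfolding G_def[abs_def] by (rule C0_semigroup_scaled)
  then interpret G: semigroup scal ip G by unfold_locales
  interpret G: decaying_perturbation scal ip G K M k \<kappa>
  proof unfold_locales
    show "norm (G t x) \<le> M * exp (- \<kappa> * t) * norm x" if "0 \<le> t" for t x
    proof -
      have "norm (G t x) \<le> exp (- l * t) * (M * exp (\<omega> * t) * norm x)"
        using b[OF that, of x] by (simp add: G_def)
      also have "\<dots> = M * (exp (- l * t) * exp (\<omega> * t)) * norm x" by simp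
      also have "exp (- l * t) * exp (\<omega> * t) = exp (- \<kappa> * t)"
        unfolding exp_add[symmetric] by (simp add: l_def algebra_simps)
      finally show ?thesis .
    qed
    show "norm (K x) \<le> k * norm x" for x using k(2)[of x] by (simp only: mult.commute)
    show "0 < \<kappa>" using M(1) k(1) by (auto simp: \<kappa>_def intro!: add_nonneg_pos mult_nonneg_nonneg)
  qed (use M(1) k(1) K in \<open>simp_all add: \<kappa>_def\<close>)
  interpret W: semigroup scal ip G.W by unfold_locales (rule G.C0_semigroup_W)
  define P where "P t x = exp (l * t) *\<^sub>R G.W t x" for t x
  have P: "C0_semigroup scal P" unfolding P_def[abs_def] by (rule W.C0_semigroup_scaled)
  have PK: "((\<lambda>t. (1 / t) *\<^sub>R (P t x - S t x)) \<longlongrightarrow> K x) (at_right 0)" for x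
  proof -
    have "((\<lambda>t. exp (l * t) *\<^sub>R ((1 / t) *\<^sub>R (G.W t x - G t x))) \<longlongrightarrow> exp (l * 0) *\<^sub>R K x) (at_right 0)"
      by (intro tendsto_intros G.W_quotient)
    moreover have "exp (l * t) *\<^sub>R ((1 / t) *\<^sub>R (G.W t x - G t x)) = (1 / t) *\<^sub>R (P t x - S t x)" for t
    proof -
      have *: "S t x = exp (l * t) *\<^sub>R G t x" by (simp add: G_def flip: exp_add)
      show ?thesis unfolding P_def * by (simp add: scaleR_diff_right)
    qed
    ultimately show ?thesis by simp
  qed
  have split: "(1 / t) *\<^sub>R (P t x - x) = (1 / t) *\<^sub>R (P t x - S t x) + (1 / t) *\<^sub>R (S t x - x)" for t x
    by (simp flip: scaleR_add_right)
  have split': "(1 / t) *\<^sub>R (S t x - x) = (1 / t) *\<^sub>R (P t x - x) - (1 / t) *\<^sub>R (P t x - S t x)" for t x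
    by (simp flip: scaleR_diff_right)
  have lim: "((\<lambda>t. (1 / t) *\<^sub>R (P t x - x)) \<longlongrightarrow> A x + K x) (at_right 0)" if "x \<in> D" for x
    using tendsto_add[OF PK A_lim[OF that]] unfolding split by (simp add: add.commute)
  have "x \<in> D" if "((\<lambda>t. (1 / t) *\<^sub>R (P t x - x)) \<longlongrightarrow> y) (at_right 0)" for x y
    using tendsto_diff[OF that PK[of x]] unfolding split'[symmetric] by (rule DI)
  then have "generates scal D (\<lambda>x. A x + K x) P"
    unfolding generates_def using P lim by blast
  then show ?thesis by (auto simp: is_generator_def)
qed

lemma closed_dense_UNIV:
  assumes "closure D = UNIV" "closed {x. P x}" "\<And>x. x \<in> D \<Longrightarrow> P x"
  shows "P x"
  using closure_minimal[of D "{x. P x}"] assms by auto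

section \<open>Duhamel's formula\<close>

locale perturbed_generator = hilbert_space scal ip + S: generator scal ip S D A +
    P: generator scal ip P D "\<lambda>x. A x + K x"
  for scal :: "'k::real_or_complex \<Rightarrow> 'h::banach \<Rightarrow> 'h" and ip :: "'h \<Rightarrow> 'h \<Rightarrow> 'k"
    and S P D A K +
  assumes K: "bounded_operator scal K"
begin

lemmas K_linear = bounded_operatorD(1)[OF K]

text \<open>Differentiating \<open>P s (S (t - s) x)\<close> in \<open>s\<close>, the two terms with
  \<open>A\<close> cancel because both generators act on the common domain \<open>D\<close>; only
  the term with \<open>K\<close> is left to integrate.\<close>

lemma Duhamel_D:
  assumes x: "x \<in> D" and t: "0 \<le> t"
  shows "((\<lambda>s. P s (K (S (t - s) x))) has_integral (P t x - S t x)) {0..t}"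
proof -
  have "((\<lambda>s. P s (K (S (t - s) x))) has_integral (P t (S (t - t) x) - P 0 (S (t - 0) x))) {0..t}"
  proof (rule fundamental_theorem_of_calculus[OF t])
    fix s assume s: "s \<in> {0..t}"
    define z where "z = S (t - s) x"
    have z: "z \<in> D" "A z = S (t - s) (A x)" unfolding z_def using S.S_D[OF _ x] s by auto
    have img: "(\<lambda>y. t - y) ` {0..t} = {0..t}" using t by (auto intro!: image_eqI[of _ _ "t - _"])
    have "((\<lambda>y. t - y) has_vector_derivative -1) (at s within {0..t})"
      by (auto intro!: derivative_eq_intros)
    moreover have "((\<lambda>y. S y x) has_vector_derivative A z) (at (t - s) within (\<lambda>y. t - y) ` {0..t})"
      unfolding img z(2) using s by (intro S.orbit_derivative x) auto
    ultimately have "((\<lambda>y. S y x) \<circ> (\<lambda>y. t - y) has_vector_derivative - 1 *\<^sub>R A z) (at s within {0..t})"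
      by (rule vector_diff_chain_within)
    then have 1: "((\<lambda>y. (1 / (y - s)) *\<^sub>R (S (t - y) x - z)) \<longlongrightarrow> - A z) (at s within {0..t})"
      by (simp add: has_vector_derivative_iff_quotient z_def o_def)
    have 2: "((\<lambda>y. (1 / (y - s)) *\<^sub>R (P y z - P s z)) \<longlongrightarrow> P s (A z + K z)) (at s within {0..t})"
      using P.orbit_derivative[OF s z(1)] by (simp add: has_vector_derivative_iff_quotient)
    have ev: "\<forall>\<^sub>F y in at s within {0..t}. 0 \<le> y" by (auto simp: eventually_at_filter)
    have s0: "0 \<le> s" using s by simp
    \<comment> \<open>The increment is split so that the moving operator \<open>P y\<close> stands
      before the quotient of the \<open>S\<close> orbit; its limit uses joint continuity in time and
      vector.\<close>
    have "((\<lambda>y. P y ((1 / (y - s)) *\<^sub>R (S (t - y) x - z)) + (1 / (y - s)) *\<^sub>R (P y z - P s z))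
        \<longlongrightarrow> P s (- A z) + P s (A z + K z)) (at s within {0..t})"
      by (intro tendsto_add 2 P.tendsto_S[OF tendsto_ident_at 1 ev s0])
    also have "P s (- A z) + P s (A z + K z) = P s (K z)"
      by (simp flip: P.S_plus[OF s0])
    finally have lim: "((\<lambda>y. P y ((1 / (y - s)) *\<^sub>R (S (t - y) x - z)) + (1 / (y - s)) *\<^sub>R (P y z - P s z))
        \<longlongrightarrow> P s (K z)) (at s within {0..t})" .
    have "P y ((1 / (y - s)) *\<^sub>R (S (t - y) x - z)) + (1 / (y - s)) *\<^sub>R (P y z - P s z) =
        (1 / (y - s)) *\<^sub>R (P y (S (t - y) x) - P s (S (t - s) x))" if "0 \<le> y" for y
      using that by (simp add: P.S_scaleR P.S_diff z_def flip: scaleR_add_right)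
    then have "\<forall>\<^sub>F y in at s within {0..t}. P y ((1 / (y - s)) *\<^sub>R (S (t - y) x - z)) + (1 / (y - s)) *\<^sub>R (P y z - P s z) =
        (1 / (y - s)) *\<^sub>R (P y (S (t - y) x) - P s (S (t - s) x))"
      using ev by (auto elim: eventually_mono)
    then show "((\<lambda>s. P s (S (t - s) x)) has_vector_derivative P s (K (S (t - s) x))) (at s within {0..t})"
      unfolding has_vector_derivative_iff_quotient z_def[symmetric]
      using lim Lim_transform_eventually by (fastforce simp: z_def)
  qed
  then show ?thesis by simp
qed

lemma Duhamel_continuous: "continuous_on {0..t} (\<lambda>s. P s (K (S (t - s) x)))"
  by (intro P.continuous_on_S S.continuous_on_S bounded_linear.continuous_on[OF K_linear]
      continuous_intros) auto

text \<open>Both sides are bounded linear in \<open>x\<close> and agree on the dense domain.\<close>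

lemma Duhamel:
  assumes t: "0 \<le> t"
  shows "((\<lambda>s. P s (K (S (t - s) x))) has_integral (P t x - S t x)) {0..t}"
proof -
  obtain M where M: "M \<ge> 1" "\<And>s x. 0 \<le> s \<Longrightarrow> s \<le> t \<Longrightarrow> norm (S s x) \<le> M * norm x"
    using S.local_bound[of t] by metis
  obtain N where N: "N \<ge> 1" "\<And>s x. 0 \<le> s \<Longrightarrow> s \<le> t \<Longrightarrow> norm (P s x) \<le> N * norm x"
    using P.local_bound[of t] by metis
  obtain k where k: "k \<ge> 0" "\<And>x. norm (K x) \<le> norm x * k"
    using bounded_linear.nonneg_bounded[OF K_linear] by blast
  define J where "J x = integral {0..t} (\<lambda>s. P s (K (S (t - s) x)))" for x
  note int = integrable_continuous_real[OF Duhamel_continuous]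
  have J: "bounded_linear J"
  proof (rule bounded_linear_intro[of _ "N * k * M * t"])
    show "J (x + y) = J x + J y" for x y
    proof -
      have "J (x + y) = integral {0..t} (\<lambda>s. P s (K (S (t - s) x)) + P s (K (S (t - s) y)))"
        unfolding J_def
        by (intro integral_cong) (auto simp: S.S_plus P.S_plus linear_add[OF bounded_linear.linear[OF K_linear]])
      then show ?thesis by (simp add: J_def integral_add int)
    qed
    show "J (r *\<^sub>R x) = r *\<^sub>R J x" for r x
    proof -
      have "J (r *\<^sub>R x) = integral {0..t} (\<lambda>s. r *\<^sub>R P s (K (S (t - s) x)))"
        unfolding J_def
        by (intro integral_cong) (auto simp: S.S_scaleR P.S_scaleR linear_scale[OF bounded_linear.linear[OF K_linear]])
      then show ?thesis by (simp add: J_def)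
    qed
    show "norm (J x) \<le> norm x * (N * k * M * t)" for x
    proof -
      have "norm (J x) \<le> N * k * M * norm x * (t - 0)"
        unfolding J_def
      proof (rule integral_bound[OF t Duhamel_continuous])
        fix s assume s: "s \<in> {0..t}"
        have "norm (P s (K (S (t - s) x))) \<le> N * norm (K (S (t - s) x))" using N s by simp
        also have "\<dots> \<le> N * (norm (S (t - s) x) * k)" using N k by (intro mult_left_mono) auto
        also have "\<dots> \<le> N * ((M * norm x) * k)"
          using N k M s by (intro mult_left_mono mult_right_mono) auto
        finally show "norm (P s (K (S (t - s) x))) \<le> N * k * M * norm x" by (simp add: mult_ac)
      qed
      then show ?thesis by (simp add: mult_ac)
    qed
  qed
  have "J x = P t x - S t x"
  proof (rule closed_dense_UNIV[OF S.D_dense, where P = "\<lambda>x. J x = P t x - S t x"])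
    show "closed {x. J x = P t x - S t x}"
      by (intro closed_Collect_eq continuous_intros linear_continuous_on J P.S_linear S.S_linear t)
    show "J x = P t x - S t x" if "x \<in> D" for x
      unfolding J_def by (rule integral_unique[OF Duhamel_D[OF that t]])
  qed
  then show ?thesis using integrable_integral[OF int[of t x]] by (simp add: J_def)
qed

end

section \<open>The adjoint of a generator\<close>

context generator
begin

abbreviation Dstar :: "'h set" where "Dstar \<equiv> adj_domain ip D A"
abbreviation Astar :: "'h \<Rightarrow> 'h" where "Astar \<equiv> adj ip D A"
abbreviation Sstar :: "real \<Rightarrow> 'h \<Rightarrow> 'h" where "Sstar t \<equiv> adj ip UNIV (S t)"

lemma ip_D_eqI:
  assumes "\<And>x. x \<in> D \<Longrightarrow> ip x \<psi> = ip x \<psi>'"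
  shows "\<psi> = \<psi>'"
proof (rule ip_eqI)
  fix y
  have "ip y \<psi> = ip y \<psi>'"
  proof (rule closed_dense_UNIV[OF D_dense, where P = "\<lambda>y. ip y \<psi> = ip y \<psi>'"])
    show "closed {y. ip y \<psi> = ip y \<psi>'}"
      by (intro closed_Collect_eq linear_continuous_on bounded_linear_ip_left)
  qed (rule assms)
  then show "ip \<psi> y = ip \<psi>' y" by (metis ip_commute)
qed

lemma adjI:
  assumes "\<And>x. x \<in> D \<Longrightarrow> ip (A x) \<phi> = ip x \<psi>"
  shows "\<phi> \<in> Dstar" "Astar \<phi> = \<psi>"
proof -
  show "\<phi> \<in> Dstar" using assms by (auto simp: adj_domain_def)
  show "Astar \<phi> = \<psi>"
    unfolding adj_def
  proof (rule the_equality)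
    show "\<forall>x\<in>D. ip (A x) \<phi> = ip x \<psi>" using assms by simp
    show "\<psi>' = \<psi>" if "\<forall>x\<in>D. ip (A x) \<phi> = ip x \<psi>'" for \<psi>'
      using that assms by (intro ip_D_eqI) metis
  qed
qed

lemma ip_Astar:
  assumes "\<phi> \<in> Dstar" "x \<in> D"
  shows "ip (A x) \<phi> = ip x (Astar \<phi>)"
proof -
  obtain \<psi> where \<psi>: "\<And>x. x \<in> D \<Longrightarrow> ip (A x) \<phi> = ip x \<psi>"
    using assms(1) by (auto simp: adj_domain_def)
  then show ?thesis using adjI(2)[OF \<psi>] assms(2) by simp
qed

lemma Dstar_0: "0 \<in> Dstar"
  and Astar_0: "Astar 0 = 0"
  using adjI[of 0 0] by auto

lemma Dstar_add: "\<phi> \<in> Dstar \<Longrightarrow> \<psi> \<in> Dstar \<Longrightarrow> \<phi> + \<psi> \<in> Dstar"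
  and Astar_add: "\<phi> \<in> Dstar \<Longrightarrow> \<psi> \<in> Dstar \<Longrightarrow> Astar (\<phi> + \<psi>) = Astar \<phi> + Astar \<psi>"
  using adjI[of "\<phi> + \<psi>" "Astar \<phi> + Astar \<psi>"] by (auto simp: ip_add_right ip_Astar)

lemma Dstar_scal: "\<phi> \<in> Dstar \<Longrightarrow> scal c \<phi> \<in> Dstar"
  and Astar_scal: "\<phi> \<in> Dstar \<Longrightarrow> Astar (scal c \<phi>) = scal c (Astar \<phi>)"
  using adjI[of "scal c \<phi>" "scal c (Astar \<phi>)"] by (auto simp: ip_scale_right ip_Astar)

lemma Dstar_diff: "\<phi> \<in> Dstar \<Longrightarrow> \<psi> \<in> Dstar \<Longrightarrow> \<phi> - \<psi> \<in> Dstar"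
  and Astar_diff: "\<phi> \<in> Dstar \<Longrightarrow> \<psi> \<in> Dstar \<Longrightarrow> Astar (\<phi> - \<psi>) = Astar \<phi> - Astar \<psi>"
  using adjI[of "\<phi> - \<psi>" "Astar \<phi> - Astar \<psi>"] by (auto simp: ip_diff_right ip_Astar)

lemma ip_Sstar: "0 \<le> t \<Longrightarrow> ip (S t x) \<phi> = ip x (Sstar t \<phi>)"
  by (rule ip_adj_UNIV[OF op])

lemma Sstar_Dstar:
  assumes t: "0 \<le> t" and \<phi>: "\<phi> \<in> Dstar"
  shows "Sstar t \<phi> \<in> Dstar" "Astar (Sstar t \<phi>) = Sstar t (Astar \<phi>)"
proof -
  have "ip (A x) (Sstar t \<phi>) = ip x (Sstar t (Astar \<phi>))" if x: "x \<in> D" for x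
    using ip_Astar[OF \<phi> S_D(1)[OF t x]] S_D(2)[OF t x] by (simp flip: ip_Sstar[OF t])
  then show "Sstar t \<phi> \<in> Dstar" "Astar (Sstar t \<phi>) = Sstar t (Astar \<phi>)" using adjI by blast+
qed

text \<open>The adjoint of the mean \<open>x \<mapsto> \<epsilon>\<^sup>-\<^sup>1 \<integral>\<^sub>0\<^sup>\<epsilon> S(s) x ds\<close> regularises \<open>H\<close> into \<open>D(A\<^sup>*)\<close>.\<close>

definition mean :: "real \<Rightarrow> 'h \<Rightarrow> 'h" where "mean \<epsilon> x = (1 / \<epsilon>) *\<^sub>R Int_S \<epsilon> x"

abbreviation reg :: "real \<Rightarrow> 'h \<Rightarrow> 'h" where "reg \<epsilon> \<equiv> adj ip UNIV (mean \<epsilon>)"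

lemma mean_operator:
  assumes "0 < \<epsilon>" shows "bounded_operator scal (mean \<epsilon>)"
proof (rule bounded_operatorI)
  show "bounded_linear (mean \<epsilon>)"
    unfolding mean_def[abs_def]
    using bounded_linear_compose[OF bounded_linear_scaleR_right bounded_operatorD(1)[OF Int_S_operator]] assms
    by simp
  show "mean \<epsilon> (scal c x) = scal c (mean \<epsilon> x)" for c x
    by (simp add: mean_def Int_S_scal linear_scale[OF bounded_linear.linear[OF scal_bounded_linear]])
qed

lemma ip_mean: "0 < \<epsilon> \<Longrightarrow> ip (mean \<epsilon> x) \<phi> = ip x (reg \<epsilon> \<phi>)"
  by (rule ip_adj_UNIV[OF mean_operator])

lemma norm_mean_le:
  assumes "0 < \<epsilon>" "\<epsilon> \<le> 1" "\<And>s x. 0 \<le> s \<Longrightarrow> s \<le> 1 \<Longrightarrow> norm (S s x) \<le> M * norm x"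
  shows "norm (mean \<epsilon> x) \<le> M * norm x"
  using norm_Int_S_le[of \<epsilon> x "M * norm x"] assms by (simp add: mean_def field_simps)

lemma mean_S: "0 < \<epsilon> \<Longrightarrow> 0 \<le> t \<Longrightarrow> mean \<epsilon> (S t x) = S t (mean \<epsilon> x)"
  by (simp add: mean_def S_Int_S_eq_Int_S_S S_scaleR)

lemma reg_Sstar:
  assumes "0 < \<epsilon>" "0 \<le> t"
  shows "reg \<epsilon> (Sstar t \<phi>) = Sstar t (reg \<epsilon> \<phi>)"
proof (rule adj_UNIV_eqI)
  show "ip (mean \<epsilon> x) (Sstar t \<phi>) = ip x (Sstar t (reg \<epsilon> \<phi>))" for x
    using assms by (simp add: mean_S flip: ip_Sstar ip_mean)
qed

text \<open>Integrating \<open>A x\<close> along the orbit telescopes to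
  \<open>S \<epsilon> x - x\<close>, which no longer contains \<open>A\<close>.\<close>

lemma reg_Dstar:
  assumes \<epsilon>: "0 < \<epsilon>"
  shows "reg \<epsilon> \<phi> \<in> Dstar" "Astar (reg \<epsilon> \<phi>) = (1 / \<epsilon>) *\<^sub>R (Sstar \<epsilon> \<phi> - \<phi>)"
proof -
  have "ip (A x) (reg \<epsilon> \<phi>) = ip x ((1 / \<epsilon>) *\<^sub>R (Sstar \<epsilon> \<phi> - \<phi>))" if "x \<in> D" for x
    using Int_S_A[OF less_imp_le[OF \<epsilon>] that] \<epsilon>
    by (simp add: mean_def ip_scaleR_left ip_scaleR_right ip_diff_left ip_diff_right ip_Sstar flip: ip_mean)
  then show "reg \<epsilon> \<phi> \<in> Dstar" "Astar (reg \<epsilon> \<phi>) = (1 / \<epsilon>) *\<^sub>R (Sstar \<epsilon> \<phi> - \<phi>)"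
    using adjI by blast+
qed

text \<open>This commutation upgrades convergence of \<open>reg\<close> in H to convergence in the
  graph norm.\<close>

lemma Astar_reg:
  assumes \<epsilon>: "0 < \<epsilon>" and \<phi>: "\<phi> \<in> Dstar"
  shows "Astar (reg \<epsilon> \<phi>) = reg \<epsilon> (Astar \<phi>)"
proof (rule adjI(2))
  fix x assume x: "x \<in> D"
  have eq: "mean \<epsilon> x = Int_S \<epsilon> ((1 / \<epsilon>) *\<^sub>R x)" by (simp add: mean_def Int_S_scaleR)
  have "mean \<epsilon> (A x) = A (mean \<epsilon> x)"
    unfolding eq using Int_S_D(2)[of \<epsilon> "(1 / \<epsilon>) *\<^sub>R x"] Int_S_A[OF _ x, of \<epsilon>] \<epsilon>
    by (simp add: mean_def S_scaleR scaleR_diff_right)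
  moreover have "mean \<epsilon> x \<in> D" unfolding eq using \<epsilon> by (intro Int_S_D) simp
  ultimately show "ip (A x) (reg \<epsilon> \<phi>) = ip x (reg \<epsilon> (Astar \<phi>))"
    using ip_Astar[OF \<phi>, of "mean \<epsilon> x"] by (simp flip: ip_mean[OF \<epsilon>])
qed

text \<open>A vector orthogonal to all \<open>reg \<epsilon> \<phi>\<close> has vanishing orbit
  means, and these means converge to it.\<close>

lemma Dstar_dense: "closure Dstar = UNIV"
proof (rule dense_if_trivial_complement[OF Dstar_0 Dstar_add Dstar_scal])
  fix y assume y: "\<And>\<phi>. \<phi> \<in> Dstar \<Longrightarrow> ip y \<phi> = 0"
  have "mean \<epsilon> y = 0" if "0 < \<epsilon>" for \<epsilon>
    by (rule ip_eqI) (simp add: ip_mean[OF that] y reg_Dstar(1)[OF that])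
  then have "\<forall>\<^sub>F \<epsilon> in at_right 0. (1 / \<epsilon>) *\<^sub>R Int_S \<epsilon> y = 0"
    unfolding eventually_at_right_field mean_def by (intro exI[of _ 1]) simp
  then have "((\<lambda>\<epsilon>. 0) \<longlongrightarrow> y) (at_right (0::real))"
    by (rule Lim_transform_eventually[OF Int_S_quotient])
  then show "y = 0" by (simp add: tendsto_const_iff)
qed

text \<open>Writing \<open>S s y - y\<close> as \<open>A (Int_S s y)\<close> moves the unbounded
  operator onto \<open>\<phi>\<close> and gains a factor s \<le> \<epsilon>. Convergence of
  \<open>reg\<close> on \<open>Dstar\<close> thus comes from estimates on H, uniformly in
  \<open>y\<close>.\<close>

lemma norm_reg_diff_le:
  assumes \<epsilon>: "0 < \<epsilon>" "\<epsilon> \<le> 1" and M: "\<And>s x. 0 \<le> s \<Longrightarrow> s \<le> 1 \<Longrightarrow> norm (S s x) \<le> M * norm x"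
    and M0: "0 \<le> M" and \<phi>: "\<phi> \<in> Dstar"
  shows "norm (reg \<epsilon> \<phi> - \<phi>) \<le> \<epsilon> * M * norm (Astar \<phi>)"
proof (rule norm_le_if_rip_le)
  fix y
  have b: "norm (ip (S s y - y) \<phi>) \<le> \<epsilon> * M * norm y * norm (Astar \<phi>)" if s: "s \<in> {0..\<epsilon>}" for s
  proof -
    have "ip (S s y - y) \<phi> = ip (Int_S s y) (Astar \<phi>)"
      using ip_Astar[OF \<phi> Int_S_D(1)[of s y]] Int_S_D(2)[of s y] s by simp
    also have "norm \<dots> \<le> norm (Int_S s y) * norm (Astar \<phi>)" by (rule norm_ip_le)
    also have "\<dots> \<le> (M * norm y * s) * norm (Astar \<phi>)"
      using s \<epsilon> M by (intro mult_right_mono norm_Int_S_le) auto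
    also have "\<dots> \<le> (M * norm y * \<epsilon>) * norm (Astar \<phi>)"
      using s M0 by (intro mult_right_mono mult_left_mono) auto
    finally show ?thesis by (simp add: mult_ac)
  qed
  have c: "continuous_on {0..\<epsilon>} (\<lambda>s. S s y - y)"
    by (intro continuous_intros continuous_on_S) auto
  have c': "continuous_on {0..\<epsilon>} (\<lambda>s. ip (S s y - y) \<phi>)"
    by (intro continuous_on_ip c continuous_intros)
  have "integral {0..\<epsilon>} (\<lambda>s. S s y - y) = \<epsilon> *\<^sub>R (mean \<epsilon> y - y)"
    using \<epsilon> integral_diff[OF integrable_S[of 0 y \<epsilon>] integrable_const_ivl[of y 0 \<epsilon>]]
    by (simp add: mean_def Int_S_def scaleR_diff_right)
  then have "ip (\<epsilon> *\<^sub>R (mean \<epsilon> y - y)) \<phi> = integral {0..\<epsilon>} (\<lambda>s. ip (S s y - y) \<phi>)"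
    using integral_linear[OF integrable_continuous_real[OF c] bounded_linear_ip_left[of \<phi>]]
    by (simp add: o_def)
  then have "norm (ip (\<epsilon> *\<^sub>R (mean \<epsilon> y - y)) \<phi>) \<le> \<epsilon> * M * norm y * norm (Astar \<phi>) * (\<epsilon> - 0)"
    using integral_bound[OF _ c' b] \<epsilon> by simp
  then have "\<epsilon> * norm (ip (mean \<epsilon> y - y) \<phi>) \<le> \<epsilon> * (\<epsilon> * M * norm y * norm (Astar \<phi>))"
    using \<epsilon> by (simp add: ip_scaleR_left mult_ac)
  then have "norm (ip (mean \<epsilon> y - y) \<phi>) \<le> \<epsilon> * M * norm y * norm (Astar \<phi>)" using \<epsilon> by simp
  moreover have "ip (mean \<epsilon> y - y) \<phi> = ip y (reg \<epsilon> \<phi> - \<phi>)"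
    by (simp add: ip_diff_left ip_diff_right ip_mean[OF \<epsilon>(1)])
  ultimately have "rip y (reg \<epsilon> \<phi> - \<phi>) \<le> \<epsilon> * M * norm y * norm (Astar \<phi>)"
    using inner_1_le_norm[of "ip y (reg \<epsilon> \<phi> - \<phi>)"] by simp
  then show "rip (reg \<epsilon> \<phi> - \<phi>) y \<le> \<epsilon> * M * norm (Astar \<phi>) * norm y"
    by (simp add: rip_commute[of _ y] mult_ac)
qed (use \<epsilon> M0 in simp)

lemma norm_reg_le:
  assumes "0 < \<epsilon>" "\<epsilon> \<le> 1" "\<And>s x. 0 \<le> s \<Longrightarrow> s \<le> 1 \<Longrightarrow> norm (S s x) \<le> M * norm x"
  shows "norm (reg \<epsilon> \<phi>) \<le> M * norm \<phi>"
  using assms by (intro norm_adj_UNIV_le mean_operator norm_mean_le) auto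

lemma reg_diff: "0 < \<epsilon> \<Longrightarrow> reg \<epsilon> (\<phi> - \<psi>) = reg \<epsilon> \<phi> - reg \<epsilon> \<psi>"
  by (rule adj_UNIV_eqI) (simp add: ip_diff_right ip_mean)

lemma reg_tendsto: "(\<lambda>n. reg (1 / Suc n) \<phi>) \<longlonglongrightarrow> \<phi>"
proof -
  obtain M where M: "M \<ge> 1" "\<And>s x. 0 \<le> s \<Longrightarrow> s \<le> 1 \<Longrightarrow> norm (S s x) \<le> M * norm x"
    using local_bound[of 1] by metis
  show ?thesis
  proof (rule LIMSEQ_I)
    fix e :: real assume e: "e > 0"
    \<comment> \<open>\<open>reg\<close> minus the identity enlarges the approximation error by a
      factor of at most \<open>M + 1\<close>, which must cost no more than
      \<open>e / 2\<close>.\<close>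
    define d where "d = e / (2 * (M + 1))"
    have "d > 0" using e M by (simp add: d_def)
    then obtain \<psi> where \<psi>: "\<psi> \<in> Dstar" "dist \<psi> \<phi> < d"
      using closure_approachable[of \<phi> Dstar] Dstar_dense by auto
    obtain N :: nat where N: "2 * M * norm (Astar \<psi>) / e < N" using reals_Archimedean2 by blast
    have "norm (reg (1 / Suc n) \<phi> - \<phi>) < e" if n: "n \<ge> N" for n
    proof -
      let ?\<epsilon> = "1 / real (Suc n)"
      have \<epsilon>: "0 < ?\<epsilon>" "?\<epsilon> \<le> 1" by auto
      have "norm (reg ?\<epsilon> \<psi> - \<psi>) \<le> ?\<epsilon> * M * norm (Astar \<psi>)"
        using M by (intro norm_reg_diff_le \<epsilon> \<psi>) auto
      also have "\<dots> < e / 2"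
      proof -
        have "2 * M * norm (Astar \<psi>) / e < Suc n" using N n by linarith
        then show ?thesis using e by (simp add: field_simps)
      qed
      finally have 1: "norm (reg ?\<epsilon> \<psi> - \<psi>) < e / 2" .
      have "norm (reg ?\<epsilon> (\<phi> - \<psi>)) \<le> M * norm (\<phi> - \<psi>)" by (intro norm_reg_le \<epsilon> M)
      then have "norm (reg ?\<epsilon> (\<phi> - \<psi>) - (\<phi> - \<psi>) + (reg ?\<epsilon> \<psi> - \<psi>)) \<le>
          M * norm (\<phi> - \<psi>) + norm (\<phi> - \<psi>) + norm (reg ?\<epsilon> \<psi> - \<psi>)"
        by (intro norm_triangle_mono order_trans[OF norm_triangle_ineq4] add_right_mono order_refl)
      moreover have "reg ?\<epsilon> \<phi> - \<phi> = reg ?\<epsilon> (\<phi> - \<psi>) - (\<phi> - \<psi>) + (reg ?\<epsilon> \<psi> - \<psi>)"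
        using reg_diff[OF \<epsilon>(1), of \<phi> \<psi>] by simp
      ultimately have "norm (reg ?\<epsilon> \<phi> - \<phi>) \<le> M * norm (\<phi> - \<psi>) + norm (\<phi> - \<psi>) + norm (reg ?\<epsilon> \<psi> - \<psi>)"
        by (simp only:)
      also have "M * norm (\<phi> - \<psi>) + norm (\<phi> - \<psi>) = (M + 1) * norm (\<phi> - \<psi>)" by (simp add: distrib_right)
      also have "(M + 1) * norm (\<phi> - \<psi>) \<le> (M + 1) * d"
        using \<psi>(2) M by (intro mult_left_mono) (auto simp: dist_norm norm_minus_commute)
      also have "(M + 1) * d = e / 2" using M(1) by (simp add: d_def field_simps)
      finally show ?thesis using 1 by simp
    qed
    then show "\<exists>no. \<forall>n\<ge>no. norm (reg (1 / Suc n) \<phi> - \<phi>) < e" by blast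
  qed
qed

end

section \<open>Square integrable functions with values in a Banach space\<close>

text \<open>Without separability of the codomain, limits are diagonalised by Egorov and Borel--Cantelli.\<close>

lemma measurable_on_limit_normed:
  fixes f :: "nat \<Rightarrow> real \<Rightarrow> 'b::real_normed_vector"
  assumes f: "\<And>n. f n measurable_on UNIV" and N: "negligible N"
    and lim: "\<And>x. x \<notin> N \<Longrightarrow> (\<lambda>n. f n x) \<longlonglongrightarrow> g x"
  shows "g measurable_on UNIV"
proof -
  have "\<exists>N G. negligible N \<and> (\<forall>k. continuous_on UNIV (G k)) \<and> (\<forall>x. x \<notin> N \<longrightarrow> (\<lambda>k. G k x) \<longlonglongrightarrow> f n x)"
    for n using f[of n] by (simp add: measurable_on_def)
  then obtain N' G where N': "\<And>n. negligible (N' n)" and G: "\<And>n k. continuous_on UNIV (G n k)"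
    and G_lim: "\<And>n x. x \<notin> N' n \<Longrightarrow> (\<lambda>k. G n k x) \<longlonglongrightarrow> f n x" by metis
  define h where "h n k x = norm (G n k x - f n x)" for n k x
  have [measurable]: "h n k \<in> borel_measurable lebesgue" for n k
  proof (rule measurable_on_imp_borel_measurable_lebesgue_UNIV)
    have "(norm \<circ> (\<lambda>x. G n k x - f n x)) measurable_on UNIV"
      by (intro measurable_on_compose_continuous measurable_on_diff f continuous_imp_measurable_on G
          continuous_intros)
    then show "h n k measurable_on UNIV" by (simp add: h_def[abs_def] o_def)
  qed
  \<comment> \<open>The bad set at level n: some approximant from \<open>k\<close> on misses
    \<open>f n\<close> by more than 2^-n. Truncation to a bounded interval gives finite measure, so
    the measures tend to that of the intersection over \<open>k\<close>, which is null.\<close>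
  define E where "E n k = {x \<in> {- real n..real n}. \<exists>j\<ge>k. h n j x > (1/2) ^ n}" for n k
  have E_eq: "E n k = {- real n..real n} \<inter> {x \<in> space lebesgue. \<exists>j\<ge>k. h n j x > (1/2) ^ n}" for n k
    by (auto simp: E_def)
  have E [measurable]: "E n k \<in> sets lebesgue" for n k
    unfolding E_eq by (rule sets.Int, simp, measurable)
  have Efin: "emeasure lebesgue (E n k) < \<infinity>" for n k
  proof -
    have "emeasure lebesgue (E n k) \<le> emeasure lebesgue {- real n..real n}"
      by (intro emeasure_mono) (auto simp: E_def)
    then show ?thesis by (simp add: le_less_trans)
  qed
  have "\<exists>k. emeasure lebesgue (E n k) < ennreal ((1/2) ^ n)" for n
  proof -
    have "(\<Inter>k. E n k) \<subseteq> N' n"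
    proof
      fix x assume x: "x \<in> (\<Inter>k. E n k)"
      show "x \<in> N' n"
      proof (rule ccontr)
        assume "x \<notin> N' n"
        then have "(\<lambda>k. h n k x) \<longlonglongrightarrow> 0"
          using G_lim[of x n] by (simp add: h_def tendsto_norm_zero_iff LIM_zero_iff)
        then have "\<forall>\<^sub>F k in sequentially. h n k x < (1/2) ^ n"
          by (rule order_tendstoD) simp
        then obtain k where "\<And>j. j \<ge> k \<Longrightarrow> h n j x < (1/2) ^ n" by (auto simp: eventually_sequentially)
        then show False using x by (fastforce simp: E_def)
      qed
    qed
    then have "negligible (\<Inter>k. E n k)" using N' negligible_subset by blast
    then have "emeasure lebesgue (\<Inter>k. E n k) = 0" by (auto simp: negligible_iff_null_sets)
    moreover have "(\<lambda>k. emeasure lebesgue (E n k)) \<longlonglongrightarrow> emeasure lebesgue (\<Inter>k. E n k)"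
    proof (rule Lim_emeasure_decseq)
      show "decseq (E n)"
        unfolding decseq_def E_def using order_trans by blast
      show "emeasure lebesgue (E n i) \<noteq> \<infinity>" for i using Efin[of n i] by simp
    qed (use E in blast)
    ultimately have "\<forall>\<^sub>F k in sequentially. emeasure lebesgue (E n k) < ennreal ((1/2) ^ n)"
      by (intro order_tendstoD(2)[of _ 0]) auto
    then show ?thesis by (auto simp: eventually_sequentially)
  qed
  then obtain k where k: "\<And>n. emeasure lebesgue (E n (k n)) < ennreal ((1/2) ^ n)" by metis
  \<comment> \<open>Almost every point lies in only finitely many of the chosen bad sets, hence the
    diagonal sequence \<open>G n (k n)\<close> eventually follows \<open>f n\<close> within
    2^-n.\<close>
  have "AE x in lebesgue. \<forall>\<^sub>F n in sequentially. x \<in> space lebesgue - E n (k n)"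
  proof (rule borel_cantelli_AE1)
    show "summable (\<lambda>n. measure lebesgue (E n (k n)))"
    proof (rule summable_comparison_test'[OF summable_geometric[of "1/2::real"], of 0])
      show "norm (measure lebesgue (E n (k n))) \<le> (1/2) ^ n" for n
        using k[of n] by (simp add: measure_def enn2real_leI less_imp_le)
    qed simp
  qed (use Efin in auto)
  then obtain M where M: "M \<in> null_sets lebesgue"
    "\<And>x. x \<notin> M \<Longrightarrow> \<forall>\<^sub>F n in sequentially. x \<notin> E n (k n)"
    unfolding eventually_ae_filter by auto
  show ?thesis
    unfolding measurable_on_def
  proof (intro exI conjI allI impI)
    show "negligible (M \<union> N)" using M(1) N by (auto simp: negligible_iff_null_sets intro: null_sets.Un)
    show "continuous_on UNIV (G n (k n))" for n by (rule G)
    fix x assume x: "x \<notin> M \<union> N"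
    from x have xM: "x \<notin> M" by simp
    obtain n0 :: nat where n0: "\<bar>x\<bar> \<le> real n0" using real_arch_simple by blast
    have "\<forall>\<^sub>F n in sequentially. norm (G n (k n) x - f n x) \<le> (1/2) ^ n"
      using M(2)[OF xM] eventually_ge_at_top[of n0]
    proof eventually_elim
      case (elim n)
      moreover have "x \<in> {- real n..real n}" using n0 \<open>n0 \<le> n\<close> by auto
      ultimately have "\<not> h n (k n) x > (1/2) ^ n" by (auto simp: E_def)
      then show ?case by (simp add: h_def)
    qed
    moreover have "(\<lambda>n. (1/2::real) ^ n) \<longlonglongrightarrow> 0" by (rule LIMSEQ_power_zero) simp
    ultimately have "(\<lambda>n. G n (k n) x - f n x) \<longlonglongrightarrow> 0" by (rule Lim_null_comparison)
    from tendsto_add[OF this lim[of x]] x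
    show "(\<lambda>n. G n (k n) x) \<longlonglongrightarrow> (if x \<in> UNIV then g x else 0)" by simp
  qed
qed

section \<open>Square integrable controls on the line\<close>

text \<open>The square of the L2 norm: convexity of the square passes under the integral and makes
  the unit ball convex.\<close>

definition sq_norm :: "(real \<Rightarrow> 'u::real_normed_vector) \<Rightarrow> real" where
  "sq_norm u = (LINT s|lebesgue. (norm (u s))\<^sup>2)"

lemma L2_UNIV: "u \<in> L2_on UNIV \<longleftrightarrow> u measurable_on UNIV \<and> integrable lebesgue (\<lambda>s. (norm (u s))\<^sup>2)"
  by (simp add: L2_on_def set_integrable_def)

lemma borel_measurable_norm_measurable_on:
  fixes u :: "real \<Rightarrow> 'u::real_normed_vector"
  assumes "u measurable_on UNIV"
  shows "(\<lambda>s. norm (u s)) \<in> borel_measurable lebesgue"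
proof (rule measurable_on_imp_borel_measurable_lebesgue_UNIV)
  have "(norm \<circ> u) measurable_on UNIV"
    using assms by (intro measurable_on_compose_continuous continuous_intros)
  then show "(\<lambda>s. norm (u s)) measurable_on UNIV" by (simp add: o_def)
qed

lemma L2_bounded:
  assumes v: "v measurable_on UNIV" and g: "integrable lebesgue g"
    and le: "AE s in lebesgue. (norm (v s))\<^sup>2 \<le> g s"
  shows "v \<in> L2_on UNIV" "sq_norm v \<le> integral\<^sup>L lebesgue g"
proof -
  have [measurable]: "(\<lambda>s. norm (v s)) \<in> borel_measurable lebesgue"
    by (rule borel_measurable_norm_measurable_on[OF v])
  have i: "integrable lebesgue (\<lambda>s. (norm (v s))\<^sup>2)"
  proof (rule Bochner_Integration.integrable_bound[OF g])
    show "AE s in lebesgue. norm ((norm (v s))\<^sup>2) \<le> norm (g s)"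
      using le by eventually_elim auto
  qed measurable
  then show "v \<in> L2_on UNIV" using v by (simp add: L2_UNIV)
  show "sq_norm v \<le> integral\<^sup>L lebesgue g"
    unfolding sq_norm_def by (rule integral_mono_AE[OF i g le])
qed

lemma L2_scale:
  assumes "u \<in> L2_on UNIV"
  shows "(\<lambda>s. c *\<^sub>R u s) \<in> L2_on UNIV" "sq_norm (\<lambda>s. c *\<^sub>R u s) = c\<^sup>2 * sq_norm u"
  using assms by (auto simp: L2_UNIV sq_norm_def measurable_on_scaleR_const power_mult_distrib)

lemma norm_convex_sq:
  fixes a b :: "'a::real_normed_vector"
  assumes "0 \<le> t" "t \<le> 1"
  shows "(norm ((1 - t) *\<^sub>R a + t *\<^sub>R b))\<^sup>2 \<le> (1 - t) * (norm a)\<^sup>2 + t * (norm b)\<^sup>2"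
proof -
  have "norm ((1 - t) *\<^sub>R a + t *\<^sub>R b) \<le> (1 - t) * norm a + t * norm b"
    using norm_triangle_ineq[of "(1 - t) *\<^sub>R a" "t *\<^sub>R b"] assms by simp
  then have "(norm ((1 - t) *\<^sub>R a + t *\<^sub>R b))\<^sup>2 \<le> ((1 - t) * norm a + t * norm b)\<^sup>2"
    by (rule power_mono) simp
  also have "\<dots> = (1 - t) * (norm a)\<^sup>2 + t * (norm b)\<^sup>2 - t * (1 - t) * (norm a - norm b)\<^sup>2"
    by (simp add: power2_eq_square algebra_simps)
  also have "\<dots> \<le> (1 - t) * (norm a)\<^sup>2 + t * (norm b)\<^sup>2"
    using assms by simp
  finally show ?thesis .
qed

lemma L2_convex:
  assumes u: "u \<in> L2_on UNIV" and v: "v \<in> L2_on UNIV" and t: "0 \<le> t" "t \<le> 1"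
  shows "(\<lambda>s. (1 - t) *\<^sub>R u s + t *\<^sub>R v s) \<in> L2_on UNIV" (is "?w \<in> _")
    "sq_norm (\<lambda>s. (1 - t) *\<^sub>R u s + t *\<^sub>R v s) \<le> (1 - t) * sq_norm u + t * sq_norm v"
proof -
  let ?g = "\<lambda>s. (1 - t) * (norm (u s))\<^sup>2 + t * (norm (v s))\<^sup>2"
  have i: "integrable lebesgue ?g" using u v by (auto simp: L2_UNIV)
  have m: "?w measurable_on UNIV"
    using u v by (auto simp: L2_UNIV intro!: measurable_on_add measurable_on_scaleR_const)
  have le: "AE s in lebesgue. (norm (?w s))\<^sup>2 \<le> ?g s" using norm_convex_sq[OF t] by auto
  show "?w \<in> L2_on UNIV" "sq_norm ?w \<le> (1 - t) * sq_norm u + t * sq_norm v"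
    using L2_bounded[OF m i le] u v by (auto simp: L2_UNIV sq_norm_def)
qed

lemma L2_restrict:
  assumes u: "u \<in> L2_on UNIV" and I: "I \<in> sets lebesgue"
  shows "(\<lambda>s. if s \<in> I then u s else 0) \<in> L2_on UNIV"
    "sq_norm (\<lambda>s. if s \<in> I then u s else 0) \<le> sq_norm u"
proof -
  have "(\<lambda>s. if s \<in> I then u s else 0) measurable_on UNIV"
    using u I by (intro measurable_on_restrict) (auto simp: L2_UNIV)
  from L2_bounded[OF this, of "\<lambda>s. (norm (u s))\<^sup>2"] u
  show "(\<lambda>s. if s \<in> I then u s else 0) \<in> L2_on UNIV"
    "sq_norm (\<lambda>s. if s \<in> I then u s else 0) \<le> sq_norm u"
    by (auto simp: L2_UNIV sq_norm_def)
qed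

text \<open>Extension by zero lets every estimate be made for controls on the whole line.\<close>

lemma L2_on_extend:
  "u \<in> L2_on I \<longleftrightarrow> (\<lambda>s. if s \<in> I then u s else 0) \<in> L2_on UNIV"
proof -
  have "(\<lambda>s. indicat_real I s *\<^sub>R (norm (u s))\<^sup>2) = (\<lambda>s. (norm (if s \<in> I then u s else 0))\<^sup>2)"
    by (auto simp: fun_eq_iff)
  then show ?thesis
    by (simp add: L2_on_def set_integrable_def measurable_on_UNIV)
qed

lemma L2_on_subset:
  "u \<in> L2_on UNIV \<Longrightarrow> I \<in> sets lebesgue \<Longrightarrow> u \<in> L2_on I"
  using L2_restrict(1) L2_on_extend by blast

lemma measurable_translation_lebesgue: "(\<lambda>x. t + x) \<in> lebesgue \<rightarrow>\<^sub>M (lebesgue :: real measure)"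
  using lebesgue_affine_measurable[of "\<lambda>_::real. 1" t] by simp

lemma lebesgue_translation: "distr lebesgue lebesgue (\<lambda>x. t + x) = (lebesgue :: real measure)"
  using lebesgue_real_affine[of 1 t] by (simp add: density_1)

lemma integral_lebesgue_translation:
  fixes f :: "real \<Rightarrow> 'b::{banach, second_countable_topology}"
  assumes "f \<in> borel_measurable lebesgue"
  shows "(LINT x|lebesgue. f (t + x)) = (LINT x|lebesgue. f x)"
    "integrable lebesgue (\<lambda>x. f (t + x)) \<longleftrightarrow> integrable lebesgue f"
  using integral_distr[OF measurable_translation_lebesgue assms, of t]
    integrable_distr_eq[OF measurable_translation_lebesgue assms, of t]
  by (simp_all add: lebesgue_translation)

lemma L2_translate:
  assumes u: "u \<in> L2_on UNIV"
  shows "(\<lambda>s. u (t + s)) \<in> L2_on UNIV" "sq_norm (\<lambda>s. u (t + s)) = sq_norm u"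
proof -
  have um: "u measurable_on UNIV" using u by (simp add: L2_UNIV)
  then obtain N g where N: "negligible N" and g: "\<And>n. continuous_on UNIV (g n)"
    and lim: "\<And>x. x \<notin> N \<Longrightarrow> (\<lambda>n. g n x) \<longlonglongrightarrow> u x" by (auto simp: measurable_on_def)
  have "(\<lambda>s. u (t + s)) measurable_on UNIV"
    unfolding measurable_on_def
  proof (intro exI conjI allI impI)
    show "negligible ((+) (- t) ` N)" by (rule negligible_translation[OF N])
    show "continuous_on UNIV (\<lambda>s. g n (t + s))" for n
      by (intro continuous_on_compose2[OF g] continuous_intros) auto
    fix s assume "s \<notin> (+) (- t) ` N"
    then have "t + s \<notin> N" by (force simp: image_iff)
    then show "(\<lambda>n. g n (t + s)) \<longlonglongrightarrow> (if s \<in> UNIV then u (t + s) else 0)" using lim by simp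
  qed
  moreover have [measurable]: "(\<lambda>s. norm (u s)) \<in> borel_measurable lebesgue"
    by (rule borel_measurable_norm_measurable_on[OF um])
  have m: "(\<lambda>s. (norm (u s))\<^sup>2) \<in> borel_measurable lebesgue" by measurable
  ultimately show "(\<lambda>s. u (t + s)) \<in> L2_on UNIV" "sq_norm (\<lambda>s. u (t + s)) = sq_norm u"
    using integral_lebesgue_translation[OF m, of t] u by (simp_all add: L2_UNIV sq_norm_def)
qed

text \<open>By monotone convergence the sum has a finite integral, so its values are finite almost
  everywhere.\<close>

lemma AE_summable_if_summable_integral:
  fixes f :: "nat \<Rightarrow> 'a \<Rightarrow> real"
  assumes f: "\<And>n. integrable M (f n)" "\<And>n x. 0 \<le> f n x" and s: "summable (\<lambda>n. integral\<^sup>L M (f n))"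
  shows "AE x in M. summable (\<lambda>n. f n x)"
proof -
  have [measurable]: "f n \<in> borel_measurable M" for n using f(1) by (rule borel_measurable_integrable)
  have "(\<integral>\<^sup>+x. (\<Sum>n. ennreal (f n x)) \<partial>M) = (\<Sum>n. \<integral>\<^sup>+x. ennreal (f n x) \<partial>M)"
    by (rule nn_integral_suminf) measurable
  also have "\<dots> = (\<Sum>n. ennreal (integral\<^sup>L M (f n)))"
    using f by (intro suminf_cong nn_integral_eq_integral) auto
  also have "\<dots> \<noteq> \<infinity>"
    unfolding infinity_ennreal_def
    by (rule ennreal_suminf_neq_top[OF s]) (rule Bochner_Integration.integral_nonneg, rule f(2))
  finally have "AE x in M. (\<Sum>n. ennreal (f n x)) \<noteq> \<infinity>"
    by (intro nn_integral_PInf_AE) measurable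
  then show ?thesis
    by eventually_elim (use f(2) in \<open>auto intro: summable_suminf_not_top\<close>)
qed

text \<open>The weights \<open>2\<^sup>-\<^sup>n\<close> turn absolute convergence into convergence of \<open>\<Sum>n. 2\<^sup>-\<^sup>n \<parallel>w n s\<parallel>\<^sup>2\<close>, so that
  Minkowski's inequality is not needed.\<close>

lemma L2_series:
  fixes w :: "nat \<Rightarrow> real \<Rightarrow> 'u::banach"
  assumes w: "\<And>n. w n \<in> L2_on UNIV" "\<And>n. sq_norm (w n) \<le> 1" and e: "\<And>n. \<bar>e n\<bar> \<le> (1/2) ^ n"
  obtains u where "u \<in> L2_on UNIV" "AE s in lebesgue. (\<lambda>n. e n *\<^sub>R w n s) sums u s"
proof -
  define F where "F n s = (1/2) ^ n * (norm (w n s))\<^sup>2" for n s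
  have F0: "0 \<le> F n s" for n s by (simp add: F_def)
  have Fi: "integrable lebesgue (F n)" for n using w by (auto simp: F_def[abs_def] L2_UNIV)
  have Fint: "integral\<^sup>L lebesgue (F n) \<le> (1/2) ^ n" for n
    using w(2)[of n] by (simp add: F_def[abs_def] sq_norm_def)
  have Fint0: "0 \<le> integral\<^sup>L lebesgue (F n)" for n by (rule Bochner_Integration.integral_nonneg) (rule F0)
  have sF: "summable (\<lambda>n. integral\<^sup>L lebesgue (F n))"
    using Fint Fint0 by (intro summable_comparison_test'[OF summable_geometric[of "1/2::real"], of 0]) auto
  have AEs: "AE s in lebesgue. summable (\<lambda>n. F n s)"
    by (rule AE_summable_if_summable_integral[OF Fi F0 sF])
  define H where "H s = (\<Sum>n. F n s)" for s
  have Hi: "integrable lebesgue H"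
    unfolding H_def using AEs F0 sF by (intro integrable_suminf Fi) auto
  have bound: "\<bar>e n\<bar> * norm (w n s) \<le> (1/2) ^ n + F n s" for n s
  proof -
    have "norm (w n s) \<le> 1 + (norm (w n s))\<^sup>2"
    proof -
      have "2 * norm (w n s) \<le> 1 + (norm (w n s))\<^sup>2"
        using zero_le_power2[of "norm (w n s) - 1"] by (simp add: power2_diff)
      then show ?thesis using norm_ge_zero[of "w n s"] by linarith
    qed
    then have "\<bar>e n\<bar> * norm (w n s) \<le> (1/2) ^ n * (1 + (norm (w n s))\<^sup>2)"
      by (intro mult_mono e) auto
    then show ?thesis by (simp add: F_def distrib_left)
  qed
  define u where "u s = (\<Sum>n. e n *\<^sub>R w n s)" for s
  have conv: "summable (\<lambda>n. e n *\<^sub>R w n s)" if "summable (\<lambda>n. F n s)" for s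
  proof (rule summable_comparison_test'[of "\<lambda>n. (1/2) ^ n + F n s" 0])
    show "summable (\<lambda>n. (1/2) ^ n + F n s)" using that by (intro summable_add summable_geometric) auto
  qed (use bound in auto)
  have AEu: "AE s in lebesgue. (\<lambda>n. e n *\<^sub>R w n s) sums u s"
    using AEs by eventually_elim (unfold u_def, intro summable_sums conv)
  then obtain N where N: "N \<in> null_sets lebesgue" "\<And>s. s \<notin> N \<Longrightarrow> (\<lambda>n. e n *\<^sub>R w n s) sums u s"
    unfolding eventually_ae_filter by auto
  have um: "u measurable_on UNIV"
  proof (rule measurable_on_limit_normed)
    show "(\<lambda>s. \<Sum>k<n. e k *\<^sub>R w k s) measurable_on UNIV" for n
      using w by (intro measurable_on_sum measurable_on_scaleR_const) (auto simp: L2_UNIV)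
    show "negligible N" using N by (simp add: negligible_iff_null_sets)
    show "(\<lambda>n. \<Sum>k<n. e k *\<^sub>R w k s) \<longlonglongrightarrow> u s" if "s \<notin> N" for s
      using N(2)[OF that] by (simp add: sums_def)
  qed
  have le: "(norm (u s))\<^sup>2 \<le> 2 * H s" if s: "summable (\<lambda>n. F n s)" for s
  proof (rule LIMSEQ_le_const2)
    show "(\<lambda>n. (norm (\<Sum>k<n. e k *\<^sub>R w k s))\<^sup>2) \<longlonglongrightarrow> (norm (u s))\<^sup>2"
      using summable_sums[OF conv[OF s]] unfolding u_def sums_def by (intro tendsto_intros)
    have "(norm (\<Sum>k<n. e k *\<^sub>R w k s))\<^sup>2 \<le> 2 * H s" for n
    proof -
      \<comment> \<open>The weight 2^-k is written as \<open>r ^ k * r ^ k\<close>, one factor for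
        each side of the Cauchy-Schwarz inequality; the sum of the weights gives the factor
        2.\<close>
      define r where "r = sqrt (1/2)"
      have r: "(r ^ k)\<^sup>2 = (1/2) ^ k" for k
      proof -
        have "(r ^ k)\<^sup>2 = (r\<^sup>2) ^ k" by (simp only: power_mult[symmetric] mult.commute)
        then show ?thesis by (simp add: r_def)
      qed
      have "norm (\<Sum>k<n. e k *\<^sub>R w k s) \<le> (\<Sum>k<n. (1/2) ^ k * norm (w k s))"
        using e by (intro sum_norm_le) (auto intro: mult_right_mono)
      also have "\<dots> = (\<Sum>k<n. r ^ k * (r ^ k * norm (w k s)))"
        by (simp add: power2_eq_square mult.assoc flip: r)
      finally have "(norm (\<Sum>k<n. e k *\<^sub>R w k s))\<^sup>2 \<le> (\<Sum>k<n. r ^ k * (r ^ k * norm (w k s)))\<^sup>2"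
        by (rule power_mono) simp
      also have "\<dots> \<le> (\<Sum>k<n. (r ^ k)\<^sup>2) * (\<Sum>k<n. (r ^ k * norm (w k s))\<^sup>2)"
        by (rule Cauchy_Schwarz_ineq_sum)
      also have "\<dots> = (\<Sum>k<n. (1/2) ^ k) * (\<Sum>k<n. F k s)"
        by (simp add: power_mult_distrib r F_def)
      also have "\<dots> \<le> 2 * H s"
      proof (rule mult_mono)
        have "(\<Sum>k<n. (1/2::real) ^ k) \<le> (\<Sum>k. (1/2) ^ k)"
          by (intro sum_le_suminf summable_geometric) auto
        then show "(\<Sum>k<n. (1/2::real) ^ k) \<le> 2" by (simp add: suminf_geometric)
        show "(\<Sum>k<n. F k s) \<le> H s" unfolding H_def using F0 by (intro sum_le_suminf s) auto
      qed (auto intro!: sum_nonneg F0)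
      finally show ?thesis .
    qed
    then show "\<exists>N. \<forall>n\<ge>N. (norm (\<Sum>k<n. e k *\<^sub>R w k s))\<^sup>2 \<le> 2 * H s" by blast
  qed
  have "u \<in> L2_on UNIV"
  proof (rule L2_bounded[OF um])
    show "integrable lebesgue (\<lambda>s. 2 * H s)" using Hi by simp
    show "AE s in lebesgue. (norm (u s))\<^sup>2 \<le> 2 * H s" using AEs by eventually_elim (rule le)
  qed
  then show ?thesis using AEu that by blast
qed

section \<open>Control operators and input maps\<close>

lemma (in generator) norm_le_if_Dstar:
  assumes le: "\<And>\<phi>. \<phi> \<in> Dstar \<Longrightarrow> norm (ip h \<phi>) \<le> C * norm \<phi>" and C: "0 \<le> C"
  shows "norm h \<le> C"
proof (rule norm_le_if_rip_le)
  fix y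
  have "norm (ip h y) \<le> C * norm y"
  proof (rule closed_dense_UNIV[OF Dstar_dense, where P = "\<lambda>y. norm (ip h y) \<le> C * norm y"])
    show "closed {y. norm (ip h y) \<le> C * norm y}"
      by (intro closed_Collect_le continuous_intros continuous_on_ip)
  qed (rule le)
  then show "rip h y \<le> C * norm y" using inner_1_le_norm[of "ip h y"] by linarith
qed (rule C)

lemma (in generator) Dstar_ip_eqI:
  assumes "\<And>\<phi>. \<phi> \<in> Dstar \<Longrightarrow> ip h \<phi> = ip g \<phi>"
  shows "h = g"
  using norm_le_if_Dstar[of "h - g" 0] assms by (simp add: ip_diff_left)

locale control_system = generator scal ip S D A + U: hilbert_space scalU ipU
  for scal :: "'k::real_or_complex \<Rightarrow> 'h::banach \<Rightarrow> 'h" and ip :: "'h \<Rightarrow> 'h \<Rightarrow> 'k" and S D A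
    and scalU :: "'k \<Rightarrow> 'u::banach \<Rightarrow> 'u" and ipU :: "'u \<Rightarrow> 'u \<Rightarrow> 'k" +
  fixes B :: "'u \<Rightarrow> 'h \<Rightarrow> 'k"
  assumes control: "control_operator scal ip scalU D A B"
begin

abbreviation gn :: "'h \<Rightarrow> real" where "gn \<equiv> graph_norm ip D A"

lemma gn_nonneg: "0 \<le> gn \<phi>" by (simp add: graph_norm_def)

lemma gn_scaleR: "\<phi> \<in> Dstar \<Longrightarrow> gn (r *\<^sub>R \<phi>) = \<bar>r\<bar> * gn \<phi>"
  using Astar_scal[of \<phi> "of_real r"] by (simp add: graph_norm_def scale_of_real distrib_left)

lemma Dstar_scaleR: "\<phi> \<in> Dstar \<Longrightarrow> r *\<^sub>R \<phi> \<in> Dstar"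
  using Dstar_scal[of \<phi> "of_real r"] by (simp add: scale_of_real)

lemma B_add_left: "B (u + v) \<phi> = B u \<phi> + B v \<phi>"
  using control by (simp add: control_operator_def)

lemma B_scaleR_left: "B (r *\<^sub>R u) \<phi> = r *\<^sub>R B u \<phi>"
proof -
  have "B (scalU (of_real r) u) \<phi> = of_real r * B u \<phi>" using control by (simp add: control_operator_def)
  then show ?thesis by (simp add: U.scale_of_real scaleR_conv_of_real)
qed

lemma B_0_left [simp]: "B 0 \<phi> = 0"
  using B_scaleR_left[of 0 0 \<phi>] by simp

lemma B_dual: "B u \<in> dual_space scal ip D A"
  using control by (simp add: control_operator_def)

lemma B_add_right: "\<phi> \<in> Dstar \<Longrightarrow> \<psi> \<in> Dstar \<Longrightarrow> B u (\<phi> + \<psi>) = B u \<phi> + B u \<psi>"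
  using B_dual[of u] by (simp add: dual_space_def)

lemma B_scal_right: "\<phi> \<in> Dstar \<Longrightarrow> B u (scal c \<phi>) = kcnj c * B u \<phi>"
  using B_dual[of u] by (simp add: dual_space_def)

lemma B_scaleR_right: "\<phi> \<in> Dstar \<Longrightarrow> B u (r *\<^sub>R \<phi>) = r *\<^sub>R B u \<phi>"
  using B_scal_right[of \<phi> u "of_real r"] by (simp add: scale_of_real scaleR_conv_of_real)

lemma B_diff_right: "\<phi> \<in> Dstar \<Longrightarrow> \<psi> \<in> Dstar \<Longrightarrow> B u (\<phi> - \<psi>) = B u \<phi> - B u \<psi>"
  using B_add_right[of \<phi> "(-1) *\<^sub>R \<psi>"] B_scaleR_right[of \<psi> u "-1"] Dstar_scaleR[of \<psi> "-1"] by simp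

text \<open>\<open>dual_norm\<close> is a supremum and dominates its members only because each
  \<open>B u\<close> is a bounded functional; rescaling \<open>\<phi>\<close> to graph norm 1 then
  gives the joint bound.\<close>

lemma B_bound:
  obtains C where "0 \<le> C" "\<And>u \<phi>. \<phi> \<in> Dstar \<Longrightarrow> norm (B u \<phi>) \<le> C * norm u * gn \<phi>"
proof -
  obtain C where C: "\<And>u. dual_norm ip D A (B u) \<le> C * norm u"
    using control by (auto simp: control_operator_def)
  have "norm (B u \<phi>) \<le> max C 0 * norm u * gn \<phi>" if \<phi>: "\<phi> \<in> Dstar" for u \<phi>
  proof (cases "gn \<phi> = 0")
    case True
    then have "\<phi> = 0" by (simp add: graph_norm_def add_nonneg_eq_0_iff)
    then show ?thesis using B_scaleR_right[OF Dstar_0, of u 0] True by simp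
  next
    case False
    then have pos: "gn \<phi> > 0" using gn_nonneg[of \<phi>] by simp
    define \<psi> where "\<psi> = (1 / gn \<phi>) *\<^sub>R \<phi>"
    have \<psi>: "\<psi> \<in> Dstar" "gn \<psi> \<le> 1" using \<phi> pos by (auto simp: \<psi>_def Dstar_scaleR gn_scaleR)
    obtain K where K: "\<And>\<phi>. \<phi> \<in> Dstar \<Longrightarrow> norm (B u \<phi>) \<le> K * gn \<phi>"
      using B_dual[of u] unfolding dual_space_def by blast
    have "bdd_above ((\<lambda>\<phi>. norm (B u \<phi>)) ` {\<phi> \<in> Dstar. gn \<phi> \<le> 1})"
    proof (rule bdd_aboveI2)
      fix \<phi> assume \<phi>: "\<phi> \<in> {\<phi> \<in> Dstar. gn \<phi> \<le> 1}"
      have "K * gn \<phi> \<le> \<bar>K\<bar> * 1" using \<phi> gn_nonneg[of \<phi>] by (intro mult_mono) auto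
      then show "norm (B u \<phi>) \<le> \<bar>K\<bar>" using K[of \<phi>] \<phi> by simp
    qed
    then have "norm (B u \<psi>) \<le> dual_norm ip D A (B u)"
      unfolding dual_norm_def using \<psi> by (intro cSUP_upper) auto
    also have "\<dots> \<le> max C 0 * norm u" by (rule order_trans[OF C mult_right_mono]) auto
    finally have "norm (B u \<psi>) \<le> max C 0 * norm u" .
    moreover have "B u \<psi> = (1 / gn \<phi>) *\<^sub>R B u \<phi>" using \<phi> by (simp add: \<psi>_def B_scaleR_right)
    ultimately show ?thesis using pos by (simp add: field_simps)
  qed
  then show ?thesis using that[of "max C 0"] by simp
qed

text \<open>For fixed \<open>\<epsilon>\<close> the regularisation maps H boundedly into
  \<open>Dstar\<close> with the graph norm, at a cost of order 1/\<epsilon>; composing it with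
  \<open>B\<close> yields a bounded operator.\<close>

lemma gn_reg_le:
  assumes \<epsilon>: "0 < \<epsilon>" "\<epsilon> \<le> 1"
  obtains c where "0 \<le> c" "\<And>\<psi>. gn (reg \<epsilon> \<psi>) \<le> c * norm \<psi>"
proof -
  obtain M where M: "M \<ge> 1" "\<And>s x. 0 \<le> s \<Longrightarrow> s \<le> 1 \<Longrightarrow> norm (S s x) \<le> M * norm x"
    using local_bound[of 1] by metis
  have "gn (reg \<epsilon> \<psi>) \<le> (M + 1 / \<epsilon> * (M + 1)) * norm \<psi>" for \<psi>
  proof -
    have "norm (Sstar \<epsilon> \<psi> - \<psi>) \<le> (M + 1) * norm \<psi>"
      using norm_adj_UNIV_le[OF op[OF less_imp_le[OF \<epsilon>(1)]] M(2)[OF less_imp_le[OF \<epsilon>(1)] \<epsilon>(2)], of \<psi>]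
        norm_triangle_ineq4[of "Sstar \<epsilon> \<psi>" \<psi>] by (simp add: distrib_right)
    then have "norm (Astar (reg \<epsilon> \<psi>)) \<le> 1 / \<epsilon> * ((M + 1) * norm \<psi>)"
      using \<epsilon>(1) by (simp add: reg_Dstar(2)[OF \<epsilon>(1)] divide_right_mono)
    then show ?thesis
      unfolding graph_norm_def using norm_reg_le[OF \<epsilon> M(2), of \<psi>] by (simp add: distrib_right)
  qed
  then show ?thesis using that[of "M + 1 / \<epsilon> * (M + 1)"] M(1) \<epsilon> by simp
qed

lemma B_reg_le:
  obtains c where "0 \<le> c" "\<And>u \<psi>. norm (B u (reg (1 / Suc n) \<psi>)) \<le> c * norm u * norm \<psi>"
proof -
  have \<epsilon>: "0 < 1 / real (Suc n)" "1 / real (Suc n) \<le> 1" by auto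
  obtain C where C: "0 \<le> C" "\<And>u \<phi>. \<phi> \<in> Dstar \<Longrightarrow> norm (B u \<phi>) \<le> C * norm u * gn \<phi>"
    using B_bound by metis
  obtain c where c: "0 \<le> c" "\<And>\<psi>. gn (reg (1 / Suc n) \<psi>) \<le> c * norm \<psi>"
    using gn_reg_le[OF \<epsilon>] by metis
  have "norm (B u (reg (1 / Suc n) \<psi>)) \<le> (C * c) * norm u * norm \<psi>" for u \<psi>
  proof -
    have "norm (B u (reg (1 / Suc n) \<psi>)) \<le> C * norm u * gn (reg (1 / Suc n) \<psi>)"
      by (rule C(2)[OF reg_Dstar(1)[OF \<epsilon>(1)]])
    also have "\<dots> \<le> C * norm u * (c * norm \<psi>)"
      using C(1) by (intro mult_left_mono c) auto
    finally show ?thesis by (simp add: mult_ac)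
  qed
  then show ?thesis using that[of "C * c"] C(1) c(1) by simp
qed

lemma Bn_exists: "\<exists>h. \<forall>\<psi>. ip h \<psi> = B u (reg (1 / Suc n) \<psi>)"
proof -
  let ?\<epsilon> = "1 / real (Suc n)"
  have \<epsilon>: "0 < ?\<epsilon>" by simp
  obtain c where c: "\<And>u \<psi>. norm (B u (reg (1 / Suc n) \<psi>)) \<le> c * norm u * norm \<psi>"
    using B_reg_le[of n] by metis
  obtain h where "\<And>\<psi>. \<psi> \<in> UNIV \<Longrightarrow> B u (reg ?\<epsilon> \<psi>) = ip h \<psi>"
  proof (rule Riesz_on_subspace[of UNIV "\<lambda>\<psi>. B u (reg ?\<epsilon> \<psi>)" "c * norm u"])
    show "B u (reg ?\<epsilon> (x + y)) = B u (reg ?\<epsilon> x) + B u (reg ?\<epsilon> y)" for x y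
      by (simp only: adj_UNIV_add[OF mean_operator[OF \<epsilon>]] B_add_right reg_Dstar(1)[OF \<epsilon>])
    show "B u (reg ?\<epsilon> (scal a x)) = kcnj a * B u (reg ?\<epsilon> x)" for a x
      by (simp only: adj_UNIV_scal[OF mean_operator[OF \<epsilon>]] B_scal_right reg_Dstar(1)[OF \<epsilon>])
  qed (use c in auto)
  then show ?thesis by (intro exI[of _ h]) simp
qed

text \<open>A bounded approximation of \<open>B\<close> with values in H. On such vectors strong
  continuity and Duhamel's formula are available.\<close>

definition Bn :: "nat \<Rightarrow> 'u \<Rightarrow> 'h" where
  "Bn n u = (SOME h. \<forall>\<psi>. ip h \<psi> = B u (reg (1 / Suc n) \<psi>))"

lemma ip_Bn: "ip (Bn n u) \<psi> = B u (reg (1 / Suc n) \<psi>)"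
  using someI_ex[OF Bn_exists[of u n]] by (auto simp: Bn_def)

lemma Bn_linear: "bounded_linear (Bn n)"
proof -
  obtain c where c: "0 \<le> c" "\<And>u \<psi>. norm (B u (reg (1 / Suc n) \<psi>)) \<le> c * norm u * norm \<psi>"
    using B_reg_le[of n] by metis
  show ?thesis
  proof (rule bounded_linear_intro)
    show "Bn n (u + v) = Bn n u + Bn n v" for u v
      by (rule ip_eqI) (simp only: ip_Bn ip_add_left B_add_left)
    show "Bn n (r *\<^sub>R u) = r *\<^sub>R Bn n u" for r u
      by (rule ip_eqI) (simp only: ip_Bn ip_scaleR_left B_scaleR_left)
    show "norm (Bn n u) \<le> norm u * c" for u
    proof (rule norm_le_if_rip_le)
      show "rip (Bn n u) y \<le> norm u * c * norm y" for y
        using c(2)[of u y] inner_1_le_norm[of "ip (Bn n u) y"] by (simp only: ip_Bn mult_ac)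
    qed (use c in simp)
  qed
qed

text \<open>The regularised vectors converge to \<open>\<phi>\<close> in the graph norm, in which
  \<open>B u\<close> is continuous.\<close>

lemma Bn_limit:
  assumes \<phi>: "\<phi> \<in> Dstar"
  shows "(\<lambda>n. ip (Bn n u) \<phi>) \<longlonglongrightarrow> B u \<phi>"
proof -
  obtain C where C: "0 \<le> C" "\<And>u \<phi>. \<phi> \<in> Dstar \<Longrightarrow> norm (B u \<phi>) \<le> C * norm u * gn \<phi>"
    using B_bound by metis
  let ?r = "\<lambda>n. reg (1 / Suc n)"
  have r: "?r n \<psi> \<in> Dstar" for n \<psi> by (rule reg_Dstar) simp
  have "(\<lambda>n. ip (Bn n u) \<phi> - B u \<phi>) \<longlonglongrightarrow> 0"
  proof (rule Lim_null_comparison)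
    have "norm (ip (Bn n u) \<phi> - B u \<phi>) \<le> C * norm u * (norm (?r n \<phi> - \<phi>) + norm (?r n (Astar \<phi>) - Astar \<phi>))"
      for n
    proof -
      have "ip (Bn n u) \<phi> - B u \<phi> = B u (?r n \<phi> - \<phi>)"
        unfolding ip_Bn by (simp only: B_diff_right[OF r \<phi>])
      moreover have "Astar (?r n \<phi> - \<phi>) = ?r n (Astar \<phi>) - Astar \<phi>"
        using Astar_diff[OF r[of n \<phi>] \<phi>] Astar_reg[OF _ \<phi>, of "1 / Suc n"] by simp
      ultimately show ?thesis
        using C(2)[OF Dstar_diff[OF r[of n \<phi>] \<phi>], of u] by (simp only: graph_norm_def)
    qed
    then show "\<forall>\<^sub>F n in sequentially. norm (ip (Bn n u) \<phi> - B u \<phi>) \<le>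
        C * norm u * (norm (?r n \<phi> - \<phi>) + norm (?r n (Astar \<phi>) - Astar \<phi>))" by simp
    have "(\<lambda>n. C * norm u * (norm (?r n \<phi> - \<phi>) + norm (?r n (Astar \<phi>) - Astar \<phi>))) \<longlonglongrightarrow>
        C * norm u * (norm (\<phi> - \<phi>) + norm (Astar \<phi> - Astar \<phi>))"
      by (intro tendsto_intros reg_tendsto)
    then show "(\<lambda>n. C * norm u * (norm (?r n \<phi> - \<phi>) + norm (?r n (Astar \<phi>) - Astar \<phi>))) \<longlonglongrightarrow> 0" by simp
  qed
  then show ?thesis by (rule LIM_zero_cancel)
qed

end

section \<open>Input maps driven by a second semigroup\<close>

text \<open>\<open>R\<close> will be either the original or the perturbed semigroup, while
  \<open>Dstar\<close>, its graph norm and the regularisation remain those of \<open>S\<close>. The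
  adjoint of \<open>R\<close> has to preserve \<open>Dstar\<close> with bounds locally uniform in
  time.\<close>

locale input_semigroup = control_system scal ip S D A scalU ipU B + R: semigroup scal ip R
  for scal :: "'k::real_or_complex \<Rightarrow> 'h::banach \<Rightarrow> 'h" and ip :: "'h \<Rightarrow> 'h \<Rightarrow> 'k" and S D A
    and scalU :: "'k \<Rightarrow> 'u::banach \<Rightarrow> 'u" and ipU :: "'u \<Rightarrow> 'u \<Rightarrow> 'k" and B and R +
  assumes R_Dstar: "\<And>t \<phi>. 0 \<le> t \<Longrightarrow> \<phi> \<in> Dstar \<Longrightarrow> adj ip UNIV (R t) \<phi> \<in> Dstar"
    and R_graph: "\<And>T. \<exists>C\<ge>0. \<forall>t. 0 \<le> t \<longrightarrow> t \<le> T \<longrightarrow> (\<forall>\<phi>\<in>Dstar. gn (adj ip UNIV (R t) \<phi>) \<le> C * gn \<phi>)"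
begin

abbreviation Rstar :: "real \<Rightarrow> 'h \<Rightarrow> 'h" where "Rstar t \<equiv> adj ip UNIV (R t)"

definition integrand :: "real \<Rightarrow> (real \<Rightarrow> 'u) \<Rightarrow> 'h \<Rightarrow> real \<Rightarrow> 'k" where
  "integrand T u \<phi> s = indicat_real {0<..<T} s *\<^sub>R B (u s) (Rstar (T - s) \<phi>)"

definition inp :: "real \<Rightarrow> (real \<Rightarrow> 'u) \<Rightarrow> 'h \<Rightarrow> 'k" where
  "inp T u \<phi> = integral\<^sup>L lebesgue (integrand T u \<phi>)"

lemma integrand_bound:
  obtains c where "0 \<le> c"
    "\<And>t u \<phi> s. t \<le> T \<Longrightarrow> \<phi> \<in> Dstar \<Longrightarrow>
      norm (integrand t u \<phi> s) \<le> c * gn \<phi> * (indicat_real {0<..<t} s * norm (u s))"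
proof -
  obtain C where C: "0 \<le> C" "\<And>u \<phi>. \<phi> \<in> Dstar \<Longrightarrow> norm (B u \<phi>) \<le> C * norm u * gn \<phi>"
    using B_bound by metis
  obtain c where c: "0 \<le> c" "\<And>t \<phi>. 0 \<le> t \<Longrightarrow> t \<le> T \<Longrightarrow> \<phi> \<in> Dstar \<Longrightarrow> gn (Rstar t \<phi>) \<le> c * gn \<phi>"
    using R_graph[of T] by metis
  have "norm (integrand t u \<phi> s) \<le> (C * c) * gn \<phi> * (indicat_real {0<..<t} s * norm (u s))"
    if "t \<le> T" "\<phi> \<in> Dstar" for t u \<phi> s
  proof (cases "s \<in> {0<..<t}")
    case True
    have "norm (B (u s) (Rstar (t - s) \<phi>)) \<le> C * norm (u s) * gn (Rstar (t - s) \<phi>)"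
      using True that by (intro C R_Dstar) auto
    also have "\<dots> \<le> C * norm (u s) * (c * gn \<phi>)"
      using True that C(1) by (intro mult_left_mono c) auto
    finally show ?thesis using True by (simp add: integrand_def mult_ac)
  qed (simp add: integrand_def)
  then show ?thesis using that[of "C * c"] C(1) c(1) by simp
qed

lemma integrand_Bn_measurable:
  assumes u: "u measurable_on UNIV"
  shows "(\<lambda>s. indicat_real {0<..<T} s *\<^sub>R ip (R (T - s) (Bn n (u s))) \<phi>) \<in> borel_measurable lebesgue"
proof -
  obtain N g where N: "negligible N" and g: "\<And>k. continuous_on UNIV (g k)"
    and lim: "\<And>x. x \<notin> N \<Longrightarrow> (\<lambda>k. g k x) \<longlonglongrightarrow> u x" using u by (auto simp: measurable_on_def)
  \<comment> \<open>Clipping the time at 0 makes the approximants continuous on the whole line; the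
    indicator later removes the points where the clipping acts.\<close>
  have "(\<lambda>s. ip (R (max 0 (T - s)) (Bn n (u s))) \<phi>) measurable_on UNIV"
    unfolding measurable_on_def
  proof (intro exI conjI allI impI)
    show "negligible N" by (rule N)
    show "continuous_on UNIV (\<lambda>s. ip (R (max 0 (T - s)) (Bn n (g k s))) \<phi>)" for k
      by (intro continuous_on_ip R.continuous_on_S bounded_linear.continuous_on[OF Bn_linear] g
          continuous_intros) auto
    fix s assume "s \<notin> N"
    then have "(\<lambda>k. ip (R (max 0 (T - s)) (Bn n (g k s))) \<phi>) \<longlonglongrightarrow> ip (R (max 0 (T - s)) (Bn n (u s))) \<phi>"
      by (intro tendsto_ip tendsto_const bounded_linear.tendsto[OF R.S_linear]
          bounded_linear.tendsto[OF Bn_linear] lim) auto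
    then show "(\<lambda>k. ip (R (max 0 (T - s)) (Bn n (g k s))) \<phi>) \<longlonglongrightarrow>
        (if s \<in> UNIV then ip (R (max 0 (T - s)) (Bn n (u s))) \<phi> else 0)" by simp
  qed
  then have [measurable]: "(\<lambda>s. ip (R (max 0 (T - s)) (Bn n (u s))) \<phi>) \<in> borel_measurable lebesgue"
    by (rule measurable_on_imp_borel_measurable_lebesgue_UNIV)
  have "(\<lambda>s. indicat_real {0<..<T} s *\<^sub>R ip (R (max 0 (T - s)) (Bn n (u s))) \<phi>) \<in> borel_measurable lebesgue"
    by (intro borel_measurable_scaleR borel_measurable_indicator) auto
  moreover have "(\<lambda>s. indicat_real {0<..<T} s *\<^sub>R ip (R (max 0 (T - s)) (Bn n (u s))) \<phi>) =
      (\<lambda>s. indicat_real {0<..<T} s *\<^sub>R ip (R (T - s) (Bn n (u s))) \<phi>)"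
    by (auto simp: fun_eq_iff indicator_def)
  ultimately show ?thesis by simp
qed

lemma integrand_Bn_limit:
  assumes "\<phi> \<in> Dstar"
  shows "(\<lambda>n. indicat_real {0<..<T} s *\<^sub>R ip (R (T - s) (Bn n (u s))) \<phi>) \<longlonglongrightarrow> integrand T u \<phi> s"
proof (cases "s \<in> {0<..<T}")
  case True
  then have "ip (R (T - s) (Bn n (u s))) \<phi> = ip (Bn n (u s)) (Rstar (T - s) \<phi>)" for n
    by (intro ip_adj_UNIV R.op) simp
  moreover have "(\<lambda>n. ip (Bn n (u s)) (Rstar (T - s) \<phi>)) \<longlonglongrightarrow> B (u s) (Rstar (T - s) \<phi>)"
    using True assms by (intro Bn_limit R_Dstar) auto
  ultimately show ?thesis using True by (simp add: integrand_def)
qed (simp add: integrand_def)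

text \<open>As a limit of integrands with \<open>Bn n\<close>, the adjoint semigroup can be moved
  back to H, where strong continuity gives measurability.\<close>

lemma integrand_measurable:
  assumes "u measurable_on UNIV" "\<phi> \<in> Dstar"
  shows "integrand T u \<phi> \<in> borel_measurable lebesgue"
  by (rule borel_measurable_LIMSEQ_metric[OF integrand_Bn_measurable[OF assms(1)]])
    (rule integrand_Bn_limit[OF assms(2)])

lemma indicator_norm_le: "indicat_real I s * norm (u s) \<le> indicat_real I s + (norm (u s))\<^sup>2"
proof -
  have "2 * norm (u s) \<le> 1 + (norm (u s))\<^sup>2"
    using zero_le_power2[of "norm (u s) - 1"] by (simp add: power2_diff)
  then have "norm (u s) \<le> 1 + (norm (u s))\<^sup>2" using norm_ge_zero[of "u s"] by linarith
  then show ?thesis by (simp add: indicator_def)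
qed

lemma integrable_indicator_norm:
  assumes u: "u \<in> L2_on UNIV"
  shows "integrable lebesgue (\<lambda>s. indicat_real {0<..<t} s * norm (u s))"
    "(LINT s|lebesgue. indicat_real {0<..<t} s * norm (u s)) \<le> \<bar>t\<bar> + sq_norm u"
proof -
  have ind: "integrable lebesgue (indicat_real {0<..<t})"
  proof (rule integrable_real_indicator)
    show "emeasure lebesgue {0<..<t} < \<infinity>" by (cases "0 \<le> t") auto
  qed simp
  have u2: "integrable lebesgue (\<lambda>s. (norm (u s))\<^sup>2)" using u by (simp add: L2_UNIV)
  have i: "integrable lebesgue (\<lambda>s. indicat_real {0<..<t} s + (norm (u s))\<^sup>2)"
    by (rule Bochner_Integration.integrable_add[OF ind u2])
  show i': "integrable lebesgue (\<lambda>s. indicat_real {0<..<t} s * norm (u s))"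
  proof (rule Bochner_Integration.integrable_bound[OF i])
    show "(\<lambda>s. indicat_real {0<..<t} s * norm (u s)) \<in> borel_measurable lebesgue"
      using u by (intro borel_measurable_times borel_measurable_norm_measurable_on borel_measurable_indicator)
        (auto simp: L2_UNIV)
    show "AE s in lebesgue. norm (indicat_real {0<..<t} s * norm (u s)) \<le>
        norm (indicat_real {0<..<t} s + (norm (u s))\<^sup>2)"
      using indicator_norm_le[of "{0<..<t}" _ u] by auto
  qed
  have "(LINT s|lebesgue. indicat_real {0<..<t} s * norm (u s)) \<le>
      (LINT s|lebesgue. indicat_real {0<..<t} s + (norm (u s))\<^sup>2)"
    using indicator_norm_le by (intro integral_mono i i')
  also have "\<dots> \<le> \<bar>t\<bar> + sq_norm u"
    unfolding Bochner_Integration.integral_add[OF ind u2] sq_norm_def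
    by (cases "0 \<le> t") auto
  finally show "(LINT s|lebesgue. indicat_real {0<..<t} s * norm (u s)) \<le> \<bar>t\<bar> + sq_norm u" .
qed

lemma integrand_integrable:
  assumes u: "u \<in> L2_on UNIV" and \<phi>: "\<phi> \<in> Dstar"
  shows "integrable lebesgue (integrand T u \<phi>)"
proof -
  obtain c where c: "0 \<le> c" "\<And>u s. norm (integrand T u \<phi> s) \<le> c * gn \<phi> * (indicat_real {0<..<T} s * norm (u s))"
    using integrand_bound[of T] \<phi> by (metis order_refl)
  show ?thesis
  proof (rule Bochner_Integration.integrable_bound)
    show "integrable lebesgue (\<lambda>s. c * gn \<phi> * (indicat_real {0<..<T} s * norm (u s)))"
      using integrable_indicator_norm[OF u] by (intro integrable_mult_right)
    show "integrand T u \<phi> \<in> borel_measurable lebesgue"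
      using u by (intro integrand_measurable \<phi>) (simp add: L2_UNIV)
    show "AE s in lebesgue. norm (integrand T u \<phi> s) \<le> norm (c * gn \<phi> * (indicat_real {0<..<T} s * norm (u s)))"
      using c(2)[of u] by (auto intro: order_trans[OF _ abs_ge_self])
  qed
qed

lemma inp_bound:
  obtains c where "0 \<le> c"
    "\<And>u \<phi>. u \<in> L2_on UNIV \<Longrightarrow> sq_norm u \<le> 1 \<Longrightarrow> \<phi> \<in> Dstar \<Longrightarrow> (LINT s|lebesgue. norm (integrand T u \<phi> s)) \<le> c * gn \<phi>"
proof -
  obtain c where c: "0 \<le> c" "\<And>u \<phi> s. \<phi> \<in> Dstar \<Longrightarrow>
      norm (integrand T u \<phi> s) \<le> c * gn \<phi> * (indicat_real {0<..<T} s * norm (u s))"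
    using integrand_bound[of T] by (metis order_refl)
  have "(LINT s|lebesgue. norm (integrand T u \<phi> s)) \<le> (c * (\<bar>T\<bar> + 1)) * gn \<phi>"
    if u: "u \<in> L2_on UNIV" "sq_norm u \<le> 1" and \<phi>: "\<phi> \<in> Dstar" for u \<phi>
  proof -
    have "(LINT s|lebesgue. norm (integrand T u \<phi> s)) \<le>
        (LINT s|lebesgue. c * gn \<phi> * (indicat_real {0<..<T} s * norm (u s)))"
      by (intro integral_mono integrable_norm integrand_integrable u \<phi> integrable_mult_right
          integrable_indicator_norm c)
    also have "\<dots> = c * gn \<phi> * (LINT s|lebesgue. indicat_real {0<..<T} s * norm (u s))" by simp
    also have "\<dots> \<le> c * gn \<phi> * (\<bar>T\<bar> + 1)"
      using integrable_indicator_norm(2)[OF u(1), of T] u(2) c(1) gn_nonneg[of \<phi>]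
      by (intro mult_left_mono) auto
    finally show ?thesis by (simp add: mult_ac)
  qed
  then show ?thesis using that[of "c * (\<bar>T\<bar> + 1)"] c(1) by simp
qed

lemma inp_combination:
  assumes "u \<in> L2_on UNIV" "v \<in> L2_on UNIV" "\<phi> \<in> Dstar"
  shows "inp T (\<lambda>s. a *\<^sub>R u s + b *\<^sub>R v s) \<phi> = a *\<^sub>R inp T u \<phi> + b *\<^sub>R inp T v \<phi>"
proof -
  have "integrand T (\<lambda>s. a *\<^sub>R u s + b *\<^sub>R v s) \<phi> = (\<lambda>s. a *\<^sub>R integrand T u \<phi> s + b *\<^sub>R integrand T v \<phi> s)"
    by (auto simp: fun_eq_iff integrand_def B_add_left B_scaleR_left indicator_def)
  then show ?thesis using assms by (simp add: inp_def integrand_integrable)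
qed

lemma inp_add:
  assumes u: "u \<in> L2_on UNIV" and "\<phi> \<in> Dstar" "\<psi> \<in> Dstar"
  shows "inp T u (\<phi> + \<psi>) = inp T u \<phi> + inp T u \<psi>"
proof -
  have "integrand T u (\<phi> + \<psi>) = (\<lambda>s. integrand T u \<phi> s + integrand T u \<psi> s)"
    using assms by (auto simp: fun_eq_iff integrand_def adj_UNIV_add[OF R.op] B_add_right R_Dstar indicator_def)
  then show ?thesis using assms by (simp add: inp_def integrand_integrable)
qed

lemma inp_scal:
  assumes u: "u \<in> L2_on UNIV" and "\<phi> \<in> Dstar"
  shows "inp T u (scal c \<phi>) = kcnj c * inp T u \<phi>"
proof -
  have "integrand T u (scal c \<phi>) = (\<lambda>s. kcnj c * integrand T u \<phi> s)"
    using assms by (auto simp: fun_eq_iff integrand_def adj_UNIV_scal[OF R.op] B_scal_right R_Dstar indicator_def)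
  then show ?thesis using assms by (simp add: inp_def)
qed

lemma inp_cong:
  assumes "\<And>s. 0 < s \<Longrightarrow> s < T \<Longrightarrow> u s = v s"
  shows "inp T u \<phi> = inp T v \<phi>"
proof -
  have "integrand T u \<phi> = integrand T v \<phi>"
    using assms by (auto simp: fun_eq_iff integrand_def indicator_def)
  then show ?thesis by (simp add: inp_def)
qed

text \<open>Provides the hypothesis \<open>combine\<close> of \<open>uniform_boundedness\<close> for
  controls, where completeness of L2 enters.\<close>

lemma inp_series:
  assumes w: "\<And>n. w n \<in> L2_on UNIV" "\<And>n. sq_norm (w n) \<le> 1" and e: "\<And>n. \<bar>e n\<bar> \<le> (1/2) ^ n"
  shows "\<exists>u\<in>L2_on UNIV. \<forall>\<phi>\<in>Dstar. (\<lambda>n. e n *\<^sub>R inp T (w n) \<phi>) sums inp T u \<phi>"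
proof -
  obtain u where u: "u \<in> L2_on UNIV" "AE s in lebesgue. (\<lambda>n. e n *\<^sub>R w n s) sums u s"
    using L2_series[of w e] w e by metis
  have "(\<lambda>n. e n *\<^sub>R inp T (w n) \<phi>) sums inp T u \<phi>" if \<phi>: "\<phi> \<in> Dstar" for \<phi>
  proof -
    obtain c where c: "0 \<le> c" "\<And>u. u \<in> L2_on UNIV \<Longrightarrow> sq_norm u \<le> 1 \<Longrightarrow>
        (LINT s|lebesgue. norm (integrand T u \<phi> s)) \<le> c * gn \<phi>"
      using inp_bound[of T] \<phi> by metis
    obtain C where C: "\<And>u \<phi>. \<phi> \<in> Dstar \<Longrightarrow> norm (B u \<phi>) \<le> C * norm u * gn \<phi>"
      using B_bound by metis
    let ?f = "\<lambda>n s. e n *\<^sub>R integrand T (w n) \<phi> s"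
    have fi: "integrable lebesgue (?f n)" for n using w \<phi> by (simp add: integrand_integrable)
    have fs: "(\<lambda>n. ?f n s) sums integrand T u \<phi> s" if s: "(\<lambda>n. e n *\<^sub>R w n s) sums u s" for s
    proof (cases "s \<in> {0<..<T}")
      case True
      let ?\<psi> = "Rstar (T - s) \<phi>"
      have "bounded_linear (\<lambda>v. B v ?\<psi>)"
      proof (rule bounded_linear_intro[of _ "C * gn ?\<psi>"])
        show "norm (B v ?\<psi>) \<le> norm v * (C * gn ?\<psi>)" for v
          using C[OF R_Dstar[OF _ \<phi>], of "T - s" v] True by (simp add: mult_ac)
      qed (auto simp: B_add_left B_scaleR_left)
      from bounded_linear.sums[OF this s] show ?thesis
        using True by (simp add: integrand_def B_scaleR_left)
    qed (simp add: integrand_def)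
    have nb: "(LINT s|lebesgue. norm (?f n s)) \<le> (1/2) ^ n * (c * gn \<phi>)" for n
    proof -
      have "(LINT s|lebesgue. norm (?f n s)) = \<bar>e n\<bar> * (LINT s|lebesgue. norm (integrand T (w n) \<phi> s))" by simp
      also have "\<dots> \<le> (1/2) ^ n * (c * gn \<phi>)"
        using e w c(2) by (intro mult_mono) auto
      finally show ?thesis .
    qed
    have sm: "summable (\<lambda>n. LINT s|lebesgue. norm (?f n s))"
      using nb by (intro summable_comparison_test'[OF summable_mult2[OF summable_geometric[of "1/2::real"]], of 0 _ "c * gn \<phi>"]) auto
    have AEsm: "AE s in lebesgue. summable (\<lambda>n. norm (?f n s))"
      by (rule AE_summable_if_summable_integral[OF integrable_norm[OF fi] norm_ge_zero sm])
    have "(\<lambda>n. integral\<^sup>L lebesgue (?f n)) sums (LINT s|lebesgue. (\<Sum>n. ?f n s))"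
      by (rule sums_integral[OF fi AEsm sm])
    also have "(LINT s|lebesgue. (\<Sum>n. ?f n s)) = inp T u \<phi>"
      unfolding inp_def
    proof (rule integral_cong_AE)
      show "AE s in lebesgue. (\<Sum>n. ?f n s) = integrand T u \<phi> s"
        using u(2) by eventually_elim (rule sums_unique[OF fs, symmetric])
      show "(\<lambda>s. \<Sum>n. ?f n s) \<in> borel_measurable lebesgue"
        using borel_measurable_integrable[OF fi] by (rule borel_measurable_suminf)
      show "integrand T u \<phi> \<in> borel_measurable lebesgue"
        using u(1) \<phi> by (intro borel_measurable_integrable integrand_integrable)
    qed
    finally show ?thesis by (simp add: inp_def)
  qed
  then show ?thesis using u(1) by blast
qed

end

section \<open>Boundedness of input maps in the norm of H\<close>

context input_semigroup
begin

text \<open>Boundedness of \<Phi> into H in weak form: the bound is by the norm of the test vector,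
  not by its graph norm.\<close>

definition bounded_inp :: "real \<Rightarrow> real \<Rightarrow> bool" where
  "bounded_inp T C \<longleftrightarrow> 0 \<le> C \<and>
    (\<forall>u\<in>L2_on UNIV. sq_norm u \<le> 1 \<longrightarrow> (\<forall>\<phi>\<in>Dstar. norm (inp T u \<phi>) \<le> C * norm \<phi>))"

lemma norm_inp_le_gn:
  obtains c where "0 \<le> c"
    "\<And>u \<phi>. u \<in> L2_on UNIV \<Longrightarrow> sq_norm u \<le> 1 \<Longrightarrow> \<phi> \<in> Dstar \<Longrightarrow> norm (inp T u \<phi>) \<le> c * gn \<phi>"
proof -
  obtain c where c: "0 \<le> c"
    "\<And>u \<phi>. u \<in> L2_on UNIV \<Longrightarrow> sq_norm u \<le> 1 \<Longrightarrow> \<phi> \<in> Dstar \<Longrightarrow> (LINT s|lebesgue. norm (integrand T u \<phi> s)) \<le> c * gn \<phi>"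
    using inp_bound[of T] by metis
  have "norm (inp T u \<phi>) \<le> c * gn \<phi>"
    if "u \<in> L2_on UNIV" "sq_norm u \<le> 1" "\<phi> \<in> Dstar" for u \<phi>
    unfolding inp_def using integral_norm_bound[of lebesgue "integrand T u \<phi>"] c(2)[OF that] by linarith
  then show ?thesis using that c(1) by blast
qed

text \<open>The functionals are indexed by the test vectors \<open>\<phi>\<close> in the unit ball
  of H: each is bounded on unit controls through the graph norm of \<open>\<phi>\<close>, and at a
  fixed control all are bounded by the norm of the representing vector.\<close>

lemma bounded_inp_if_representable:
  assumes "\<And>u. u \<in> L2_on UNIV \<Longrightarrow> \<exists>h. \<forall>\<phi>\<in>Dstar. inp T u \<phi> = ip h \<phi>"
  shows "\<exists>C. bounded_inp T C"
proof -
  have "\<exists>C. \<forall>\<phi>\<in>{\<phi>\<in>Dstar. norm \<phi> \<le> 1}. \<forall>u\<in>{u\<in>L2_on UNIV. sq_norm u \<le> 1}. norm (inp T u \<phi>) \<le> C"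
  proof (rule uniform_boundedness[where Y = "L2_on UNIV"])
    fix w :: "nat \<Rightarrow> real \<Rightarrow> 'u" and e :: "nat \<Rightarrow> real"
    assume "\<And>n. w n \<in> {u\<in>L2_on UNIV. sq_norm u \<le> 1}" "\<And>n. \<bar>e n\<bar> \<le> (1/2) ^ n"
    then show "\<exists>x\<in>L2_on UNIV. \<forall>\<phi>\<in>{\<phi>\<in>Dstar. norm \<phi> \<le> 1}. (\<lambda>n. e n *\<^sub>R inp T (w n) \<phi>) sums inp T x \<phi>"
      using inp_series[of w e T] by auto
  next
    fix u :: "real \<Rightarrow> 'u" assume "u \<in> L2_on UNIV"
    then obtain h where h: "\<And>\<phi>. \<phi> \<in> Dstar \<Longrightarrow> inp T u \<phi> = ip h \<phi>" using assms by blast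
    have "norm (inp T u \<phi>) \<le> norm h" if "\<phi> \<in> {\<phi>\<in>Dstar. norm \<phi> \<le> 1}" for \<phi>
      using that h[of \<phi>] norm_ip_le[of h \<phi>] mult_left_mono[of "norm \<phi>" 1 "norm h"] by simp
    then show "\<exists>K. \<forall>\<phi>\<in>{\<phi>\<in>Dstar. norm \<phi> \<le> 1}. norm (inp T u \<phi>) \<le> K" by blast
  next
    fix \<phi> assume "\<phi> \<in> {\<phi>\<in>Dstar. norm \<phi> \<le> 1}"
    then show "\<exists>c. \<forall>u\<in>{u\<in>L2_on UNIV. sq_norm u \<le> 1}. norm (inp T u \<phi>) \<le> c"
      using norm_inp_le_gn[of T] by (metis (no_types, lifting) mem_Collect_eq)
  qed
  then obtain C where C: "\<And>u \<phi>. u \<in> L2_on UNIV \<Longrightarrow> sq_norm u \<le> 1 \<Longrightarrow> \<phi> \<in> Dstar \<Longrightarrow> norm \<phi> \<le> 1 \<Longrightarrow>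
      norm (inp T u \<phi>) \<le> C" by blast
  have "norm (inp T u \<phi>) \<le> \<bar>C\<bar> * norm \<phi>" if u: "u \<in> L2_on UNIV" "sq_norm u \<le> 1" and \<phi>: "\<phi> \<in> Dstar" for u \<phi>
  proof (cases "\<phi> = 0")
    case True
    then show ?thesis using inp_scal[OF u(1) \<phi>, of T 0] by simp
  next
    case False
    have "norm (inp T u (scal (of_real (1 / norm \<phi>)) \<phi>)) \<le> C"
      using False by (intro C u Dstar_scal \<phi>) (simp add: norm_divide)
    then have "norm (inp T u \<phi>) \<le> C * norm \<phi>"
      using False by (simp only: inp_scal[OF u(1) \<phi>] kcnj_of_real) (simp add: norm_mult norm_divide field_simps)
    also have "\<dots> \<le> \<bar>C\<bar> * norm \<phi>" by (intro mult_right_mono) auto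
    finally show ?thesis .
  qed
  then have "bounded_inp T \<bar>C\<bar>" by (simp add: bounded_inp_def)
  then show ?thesis ..
qed

lemma inp_representable:
  assumes C: "bounded_inp T C" and u: "u \<in> L2_on UNIV"
  shows "\<exists>h. \<forall>\<phi>\<in>Dstar. inp T u \<phi> = ip h \<phi>"
proof -
  \<comment> \<open>Positive even for \<open>u = 0\<close>, with square at least
    \<open>sq_norm u\<close>; dividing by \<open>c\<close> moves \<open>u\<close> into the unit
    ball.\<close>
  define c where "c = 1 + sq_norm u"
  have s0: "0 \<le> sq_norm u" unfolding sq_norm_def by (rule Bochner_Integration.integral_nonneg) simp
  then have c: "c > 0" "sq_norm u \<le> c\<^sup>2" by (auto simp: c_def power2_eq_square algebra_simps)
  let ?v = "\<lambda>s. (1 / c) *\<^sub>R u s"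
  have v: "?v \<in> L2_on UNIV" "sq_norm ?v \<le> 1"
    using L2_scale[OF u, of "1 / c"] c by (auto simp: power_divide)
  have eq: "inp T u \<phi> = c *\<^sub>R inp T ?v \<phi>" if "\<phi> \<in> Dstar" for \<phi>
    using inp_combination[OF u u that, of T "1 / c" 0] c by simp
  obtain h where "\<And>\<phi>. \<phi> \<in> Dstar \<Longrightarrow> inp T u \<phi> = ip h \<phi>"
  proof (rule Riesz_on_subspace[of Dstar "inp T u" "c * C"])
    show "norm (inp T u \<phi>) \<le> c * C * norm \<phi>" if "\<phi> \<in> Dstar" for \<phi>
      using C v that c(1) unfolding eq[OF that] bounded_inp_def by (simp add: mult.assoc mult_left_mono)
  qed (use Dstar_0 Dstar_add Dstar_scal inp_add[OF u] inp_scal[OF u] in auto)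
  then show ?thesis by blast
qed

lemma Rstar_add:
  assumes "0 \<le> s" "0 \<le> t"
  shows "Rstar (s + t) \<phi> = Rstar s (Rstar t \<phi>)"
proof (rule adj_UNIV_eqI)
  show "ip (R (s + t) x) \<phi> = ip x (Rstar s (Rstar t \<phi>))" for x
    using assms
    by (simp add: ip_adj_UNIV[OF R.op, symmetric] R.S_add[of t s] add.commute[of s t])
qed

text \<open>A control delayed by \<open>T - t\<close>, with zero before, has the same effect at the
  later time, so bounds for a horizon hold for all shorter ones.\<close>

lemma inp_shift:
  assumes u: "u \<in> L2_on UNIV" and t: "t \<le> T" and \<phi>: "\<phi> \<in> Dstar"
  defines "v \<equiv> \<lambda>s. if s \<in> {T - t<..} then u (- (T - t) + s) else 0"
  shows "inp t u \<phi> = inp T v \<phi>" "v \<in> L2_on UNIV" "sq_norm v \<le> sq_norm u"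
proof -
  show v: "v \<in> L2_on UNIV" "sq_norm v \<le> sq_norm u"
    using L2_restrict[OF L2_translate(1)[OF u], of "{T - t<..}" "- (T - t)"] L2_translate(2)[OF u]
    by (auto simp: v_def)
  have "integrand T v \<phi> (T - t + s) = integrand t u \<phi> s" for s
    using t by (auto simp: integrand_def v_def indicator_def)
  moreover have "(LINT s|lebesgue. integrand T v \<phi> (T - t + s)) = inp T v \<phi>"
    unfolding inp_def
    by (intro integral_lebesgue_translation borel_measurable_integrable integrand_integrable v \<phi>)
  ultimately show "inp t u \<phi> = inp T v \<phi>" by (simp add: inp_def)
qed

lemma bounded_inp_mono:
  assumes "bounded_inp T C" "t \<le> T"
  shows "bounded_inp t C"
  unfolding bounded_inp_def
proof (intro conjI ballI impI)
  show "0 \<le> C" using assms(1) by (simp add: bounded_inp_def)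
  fix u :: "real \<Rightarrow> 'u" and \<phi> assume "u \<in> L2_on UNIV" "sq_norm u \<le> 1" "\<phi> \<in> Dstar"
  then show "norm (inp t u \<phi>) \<le> C * norm \<phi>"
    using inp_shift[of u t T \<phi>] assms unfolding bounded_inp_def by (metis (no_types, lifting) order_trans)
qed

text \<open>The input up to \<open>T\<close>, transported by \<open>R r\<close>, plus the input of
  the remaining control; here the transport acts on the test vector.\<close>

lemma inp_split:
  assumes u: "u \<in> L2_on UNIV" and T: "0 \<le> T" and r: "0 \<le> r" and \<phi>: "\<phi> \<in> Dstar"
  shows "inp (T + r) u \<phi> = inp T u (Rstar r \<phi>) + inp r (\<lambda>s. u (T + s)) \<phi>"
proof -
  let ?v = "\<lambda>s. u (T + s)"
  have v: "?v \<in> L2_on UNIV" by (rule L2_translate[OF u])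
  have r\<phi>: "Rstar r \<phi> \<in> Dstar" by (rule R_Dstar[OF r \<phi>])
  have m: "integrand r ?v \<phi> \<in> borel_measurable lebesgue"
    by (intro borel_measurable_integrable integrand_integrable v \<phi>)
  \<comment> \<open>The point \<open>T\<close> belongs to neither open interval and is discarded as
    a null set.\<close>
  have eq: "integrand (T + r) u \<phi> s = integrand T u (Rstar r \<phi>) s + integrand r ?v \<phi> (- T + s)" if sT: "s \<noteq> T" for s
  proof -
    consider "s \<in> {0<..<T}" | "s \<in> {T<..<T + r}" | "s \<notin> {0<..<T + r}" using sT by (cases s T rule: linorder_cases) auto
    then show ?thesis
    proof cases
      case 1
      then have "Rstar (T + r - s) \<phi> = Rstar (T - s) (Rstar r \<phi>)"
        using Rstar_add[of "T - s" r \<phi>] r by (simp add: algebra_simps)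
      then show ?thesis using 1 r by (simp add: integrand_def)
    next
      case 2
      then show ?thesis using T by (simp add: integrand_def algebra_simps)
    next
      case 3
      then show ?thesis using T r sT by (auto simp: integrand_def indicator_def)
    qed
  qed
  have "inp (T + r) u \<phi> = (LINT s|lebesgue. integrand T u (Rstar r \<phi>) s + integrand r ?v \<phi> (- T + s))"
    unfolding inp_def
  proof (rule integral_cong_AE)
    show "AE s in lebesgue. integrand (T + r) u \<phi> s = integrand T u (Rstar r \<phi>) s + integrand r ?v \<phi> (- T + s)"
    proof (rule AE_I')
      show "{T} \<in> null_sets lebesgue" using negligible_sing[of T] by (simp only: negligible_iff_null_sets)
    qed (use eq in auto)
    show "integrand (T + r) u \<phi> \<in> borel_measurable lebesgue"
      by (intro borel_measurable_integrable integrand_integrable u \<phi>)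
    show "(\<lambda>s. integrand T u (Rstar r \<phi>) s + integrand r ?v \<phi> (- T + s)) \<in> borel_measurable lebesgue"
      using integral_lebesgue_translation(2)[OF m, of "- T"] integrand_integrable[OF v \<phi>]
      by (intro borel_measurable_add borel_measurable_integrable integrand_integrable u r\<phi>) auto
  qed
  also have "\<dots> = inp T u (Rstar r \<phi>) + inp r ?v \<phi>"
    using integral_lebesgue_translation[OF m, of "- T"] integrand_integrable[OF v \<phi>]
      integrand_integrable[OF u r\<phi>]
    by (simp add: inp_def)
  finally show ?thesis .
qed

lemma bounded_inp_add:
  assumes C: "bounded_inp T C" and C': "bounded_inp r C'" and T: "0 \<le> T" and r: "0 \<le> r"
  shows "\<exists>C. bounded_inp (T + r) C"
proof -
  obtain M where M: "M \<ge> 1" "\<And>s x. 0 \<le> s \<Longrightarrow> s \<le> r \<Longrightarrow> norm (R s x) \<le> M * norm x"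
    using R.local_bound[of r] by metis
  have "norm (inp (T + r) u \<phi>) \<le> (C * M + C') * norm \<phi>"
    if u: "u \<in> L2_on UNIV" "sq_norm u \<le> 1" and \<phi>: "\<phi> \<in> Dstar" for u \<phi>
  proof -
    have "norm (inp T u (Rstar r \<phi>)) \<le> C * norm (Rstar r \<phi>)"
      using C u R_Dstar[OF r \<phi>] by (simp add: bounded_inp_def)
    also have "\<dots> \<le> C * (M * norm \<phi>)"
      using C r by (intro mult_left_mono norm_adj_UNIV_le R.op M) (auto simp: bounded_inp_def)
    finally have 1: "norm (inp T u (Rstar r \<phi>)) \<le> C * M * norm \<phi>" by simp
    have 2: "norm (inp r (\<lambda>s. u (T + s)) \<phi>) \<le> C' * norm \<phi>"
      using C' L2_translate[OF u(1), of T] u(2) \<phi> by (simp add: bounded_inp_def)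
    show ?thesis
      unfolding inp_split[OF u(1) T r \<phi>] using norm_triangle_mono[OF 1 2] by (simp add: distrib_right)
  qed
  moreover have "0 \<le> C * M + C'" using C C' M(1) by (simp add: bounded_inp_def)
  ultimately have "bounded_inp (T + r) (C * M + C')" by (simp add: bounded_inp_def)
  then show ?thesis ..
qed

text \<open>The splitting extends the bound to multiples of \<open>T\<close>, monotonicity brings it
  down to any horizon; so admissibility at one time serves at all times.\<close>

lemma bounded_inp_all:
  assumes T: "0 < T" and C: "bounded_inp T C"
  shows "\<exists>C. bounded_inp T' C"
proof -
  have n: "\<exists>C. bounded_inp (real (Suc n) * T) C" for n
  proof (induction n)
    case 0 then show ?case using C by auto
  next
    case (Suc n)
    then obtain C' where C': "bounded_inp (real (Suc n) * T) C'" by blast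
    have "\<exists>C. bounded_inp (real (Suc n) * T + T) C"
      using T by (intro bounded_inp_add[OF C' C]) auto
    then show ?case by (simp add: algebra_simps)
  qed
  obtain m :: nat where "T' / T \<le> real m" using real_arch_simple by blast
  then have "T' \<le> real (Suc m) * T" using T by (simp add: field_simps)
  then show ?thesis using n[of m] bounded_inp_mono by blast
qed

end

section \<open>The perturbed system\<close>

locale perturbed_control = control_system scal ip S D A scalU ipU B +
    P: generator scal ip P D "\<lambda>x. A x + K x"
  for scal :: "'k::real_or_complex \<Rightarrow> 'h::banach \<Rightarrow> 'h" and ip :: "'h \<Rightarrow> 'h \<Rightarrow> 'k" and S D A
    and scalU :: "'k \<Rightarrow> 'u::banach \<Rightarrow> 'u" and ipU :: "'u \<Rightarrow> 'u \<Rightarrow> 'k" and B and P and K +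
  assumes K_op: "bounded_operator scal K"
begin

sublocale pg: perturbed_generator scal ip S P D A K
  by unfold_locales (rule K_op)

abbreviation Kstar :: "'h \<Rightarrow> 'h" where "Kstar \<equiv> adj ip UNIV K"

lemma Kstar_bound:
  obtains k where "0 \<le> k" "\<And>x. norm (K x) \<le> k * norm x" "\<And>x. norm (Kstar x) \<le> k * norm x"
proof -
  obtain k where k: "k \<ge> 0" "\<And>x. norm (K x) \<le> norm x * k"
    using bounded_linear.nonneg_bounded[OF bounded_operatorD(1)[OF K_op]] by blast
  then have k': "\<And>x. norm (K x) \<le> k * norm x" by (simp add: mult.commute)
  show ?thesis using that[OF k(1) k' norm_adj_UNIV_le[OF K_op k']] .
qed

lemma perturbed_adjoint:
  shows "adj_domain ip D (\<lambda>x. A x + K x) = Dstar"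
    and "\<phi> \<in> Dstar \<Longrightarrow> adj ip D (\<lambda>x. A x + K x) \<phi> = Astar \<phi> + Kstar \<phi>"
proof -
  have 1: "\<phi> \<in> P.Dstar \<and> P.Astar \<phi> = Astar \<phi> + Kstar \<phi>" if "\<phi> \<in> Dstar" for \<phi>
    using P.adjI[of \<phi> "Astar \<phi> + Kstar \<phi>"] ip_Astar[OF that]
    by (simp add: ip_add_left ip_add_right ip_adj_UNIV[OF K_op])
  moreover have "\<phi> \<in> Dstar" if "\<phi> \<in> P.Dstar" for \<phi>
  proof (rule adjI(1))
    show "ip (A x) \<phi> = ip x (P.Astar \<phi> - Kstar \<phi>)" if "x \<in> D" for x
      using P.ip_Astar[OF \<open>\<phi> \<in> P.Dstar\<close> that]
      by (simp add: ip_add_left ip_diff_right ip_adj_UNIV[OF K_op] eq_diff_eq)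
  qed
  ultimately show "P.Dstar = Dstar" "\<phi> \<in> Dstar \<Longrightarrow> P.Astar \<phi> = Astar \<phi> + Kstar \<phi>" by auto
qed

lemma graph_norms_equivalent:
  obtains c where "1 \<le> c"
    "\<And>\<phi>. \<phi> \<in> Dstar \<Longrightarrow> graph_norm ip D (\<lambda>x. A x + K x) \<phi> \<le> c * gn \<phi>"
    "\<And>\<phi>. \<phi> \<in> Dstar \<Longrightarrow> gn \<phi> \<le> c * graph_norm ip D (\<lambda>x. A x + K x) \<phi>"
proof -
  obtain k where k: "0 \<le> k" "\<And>x. norm (Kstar x) \<le> k * norm x" using Kstar_bound by metis
  have "graph_norm ip D (\<lambda>x. A x + K x) \<phi> \<le> (1 + k) * gn \<phi>" if "\<phi> \<in> Dstar" for \<phi>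
    using norm_triangle_ineq[of "Astar \<phi>" "Kstar \<phi>"] k(2)[of \<phi>] mult_nonneg_nonneg[OF k(1) norm_ge_zero[of "Astar \<phi>"]]
    unfolding graph_norm_def perturbed_adjoint(2)[OF that] by (simp add: algebra_simps)
  moreover have "gn \<phi> \<le> (1 + k) * graph_norm ip D (\<lambda>x. A x + K x) \<phi>" if "\<phi> \<in> Dstar" for \<phi>
    using norm_triangle_ineq4[of "Astar \<phi> + Kstar \<phi>" "Kstar \<phi>"] k(2)[of \<phi>]
      mult_nonneg_nonneg[OF k(1) norm_ge_zero[of "Astar \<phi> + Kstar \<phi>"]]
    unfolding graph_norm_def perturbed_adjoint(2)[OF that] by (simp add: algebra_simps)
  ultimately show ?thesis using that[of "1 + k"] k(1) by auto
qed

text \<open>The dual of \<open>Dstar\<close> sees the generator only through \<open>Dstar\<close>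
  and the graph norm up to equivalence, and a bounded perturbation changes neither.\<close>

lemma perturbed_control_operator: "control_operator scal ip scalU D (\<lambda>x. A x + K x) B"
proof -
  let ?gK = "graph_norm ip D (\<lambda>x. A x + K x)"
  obtain c where c: "1 \<le> c" "\<And>\<phi>. \<phi> \<in> Dstar \<Longrightarrow> gn \<phi> \<le> c * ?gK \<phi>"
    using graph_norms_equivalent by metis
  obtain C where C: "0 \<le> C" "\<And>u \<phi>. \<phi> \<in> Dstar \<Longrightarrow> norm (B u \<phi>) \<le> C * norm u * gn \<phi>"
    using B_bound by metis
  have b: "norm (B u \<phi>) \<le> C * norm u * c * ?gK \<phi>" if "\<phi> \<in> Dstar" for u \<phi>
    using C(2)[OF that, of u] mult_left_mono[OF c(2)[OF that], of "C * norm u"] C(1) by (simp add: mult.assoc)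
  have "B u \<in> dual_space scal ip D (\<lambda>x. A x + K x)" for u
    unfolding dual_space_def perturbed_adjoint(1)
    using b[of _ u] B_add_right B_scal_right B_dual[of u] by (auto simp: dual_space_def)
  moreover have "dual_norm ip D (\<lambda>x. A x + K x) (B u) \<le> (C * c) * norm u" for u
    unfolding dual_norm_def perturbed_adjoint(1)
  proof (rule cSUP_least)
    have "0 \<in> {\<phi> \<in> Dstar. ?gK \<phi> \<le> 1}"
      using Dstar_0 perturbed_adjoint(2)[OF Dstar_0] Astar_0 adj_UNIV_eqI[of K 0 0] by (simp add: graph_norm_def)
    then show "{\<phi> \<in> Dstar. ?gK \<phi> \<le> 1} \<noteq> {}" by blast
    fix \<phi> assume \<phi>: "\<phi> \<in> {\<phi> \<in> Dstar. ?gK \<phi> \<le> 1}"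
    have "C * norm u * c * ?gK \<phi> \<le> C * norm u * c * 1"
      using \<phi> C(1) c(1) by (intro mult_left_mono) auto
    then show "norm (B u \<phi>) \<le> (C * c) * norm u" using b[of \<phi> u] \<phi> by (simp add: mult_ac)
  qed
  ultimately show ?thesis
    using control by (auto simp: control_operator_def)
qed

sublocale X0: input_semigroup scal ip S D A scalU ipU B S
proof unfold_locales
  fix T
  obtain M where M: "M \<ge> 1" "\<And>s x. 0 \<le> s \<Longrightarrow> s \<le> T \<Longrightarrow> norm (S s x) \<le> M * norm x"
    using local_bound[of T] by metis
  have "gn (Sstar t \<phi>) \<le> M * gn \<phi>" if "0 \<le> t" "t \<le> T" "\<phi> \<in> Dstar" for t \<phi>
    using norm_adj_UNIV_le[OF op[OF that(1)] M(2)[OF that(1,2)], of \<phi>]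
      norm_adj_UNIV_le[OF op[OF that(1)] M(2)[OF that(1,2)], of "Astar \<phi>"]
    unfolding graph_norm_def Sstar_Dstar(2)[OF that(1,3)] by (simp add: distrib_left)
  then show "\<exists>C\<ge>0. \<forall>t. 0 \<le> t \<longrightarrow> t \<le> T \<longrightarrow> (\<forall>\<phi>\<in>Dstar. gn (Sstar t \<phi>) \<le> C * gn \<phi>)"
    using M(1) by (intro exI[of _ M]) auto
qed (rule Sstar_Dstar)

text \<open>The adjoint of \<open>P\<close> commutes with the adjoint of \<open>A + K\<close>, so
  its bound is natural in the graph norm of \<open>A + K\<close>; changing norms forth and back
  costs one factor \<open>c\<close> each.\<close>

sublocale XK: input_semigroup scal ip S D A scalU ipU B P
proof unfold_locales
  show "P.Sstar t \<phi> \<in> Dstar" if "0 \<le> t" "\<phi> \<in> Dstar" for t \<phi>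
    using P.Sstar_Dstar(1)[of t \<phi>] that unfolding perturbed_adjoint(1) by blast
  fix T
  let ?gK = "graph_norm ip D (\<lambda>x. A x + K x)"
  obtain c where c: "1 \<le> c" "\<And>\<phi>. \<phi> \<in> Dstar \<Longrightarrow> ?gK \<phi> \<le> c * gn \<phi>" "\<And>\<phi>. \<phi> \<in> Dstar \<Longrightarrow> gn \<phi> \<le> c * ?gK \<phi>"
    using graph_norms_equivalent by metis
  obtain M where M: "M \<ge> 1" "\<And>s x. 0 \<le> s \<Longrightarrow> s \<le> T \<Longrightarrow> norm (P s x) \<le> M * norm x"
    using P.local_bound[of T] by metis
  have "gn (P.Sstar t \<phi>) \<le> (c * M * c) * gn \<phi>" if t: "0 \<le> t" "t \<le> T" and \<phi>: "\<phi> \<in> Dstar" for t \<phi>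
  proof -
    have P\<phi>: "\<phi> \<in> P.Dstar" using \<phi> by (simp add: perturbed_adjoint(1))
    have "?gK (P.Sstar t \<phi>) \<le> M * ?gK \<phi>"
      using norm_adj_UNIV_le[OF P.op[OF t(1)] M(2)[OF t], of \<phi>]
        norm_adj_UNIV_le[OF P.op[OF t(1)] M(2)[OF t], of "P.Astar \<phi>"]
      unfolding graph_norm_def P.Sstar_Dstar(2)[OF t(1) P\<phi>] by (simp add: distrib_left)
    also have "\<dots> \<le> M * (c * gn \<phi>)" using M(1) c(2)[OF \<phi>] by (intro mult_left_mono) auto
    finally have "c * ?gK (P.Sstar t \<phi>) \<le> c * (M * (c * gn \<phi>))" using c(1) by (intro mult_left_mono) auto
    moreover have "P.Sstar t \<phi> \<in> Dstar"
      using P.Sstar_Dstar(1)[OF t(1) P\<phi>] unfolding perturbed_adjoint(1) .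
    ultimately show ?thesis using c(3) by (fastforce simp: mult.assoc)
  qed
  then show "\<exists>C\<ge>0. \<forall>t. 0 \<le> t \<longrightarrow> t \<le> T \<longrightarrow> (\<forall>\<phi>\<in>Dstar. gn (P.Sstar t \<phi>) \<le> C * gn \<phi>)"
    using M(1) c(1) by (intro exI[of _ "c * M * c"]) auto
qed

end

text \<open>Unlike in \<open>gn_reg_le\<close> the constant does not depend on
  \<open>\<epsilon>\<close>, which gives an integrable majorant for all n at once.\<close>

lemma (in control_system) gn_reg_Dstar_le:
  assumes "0 < \<epsilon>" "\<epsilon> \<le> 1" "\<And>s x. 0 \<le> s \<Longrightarrow> s \<le> 1 \<Longrightarrow> norm (S s x) \<le> M * norm x" "\<phi> \<in> Dstar"
  shows "gn (reg \<epsilon> \<phi>) \<le> M * gn \<phi>"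
  using norm_reg_le[OF assms(1-3), of \<phi>] norm_reg_le[OF assms(1-3), of "Astar \<phi>"]
  unfolding graph_norm_def Astar_reg[OF assms(1,4)] by (simp add: distrib_left)

section \<open>Convergence of the regularised input maps\<close>

context input_semigroup
begin

definition integrand_n :: "nat \<Rightarrow> real \<Rightarrow> (real \<Rightarrow> 'u) \<Rightarrow> 'h \<Rightarrow> real \<Rightarrow> 'k" where
  "integrand_n n T u \<phi> s = indicat_real {0<..<T} s *\<^sub>R ip (R (T - s) (Bn n (u s))) \<phi>"

lemma integrand_n_bound:
  assumes \<phi>: "\<phi> \<in> Dstar"
  obtains c where "\<And>n s u. norm (integrand_n n T u \<phi> s) \<le> c * (indicat_real {0<..<T} s * norm (u s))"
proof -
  obtain M where M: "M \<ge> 1" "\<And>s x. 0 \<le> s \<Longrightarrow> s \<le> 1 \<Longrightarrow> norm (S s x) \<le> M * norm x"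
    using local_bound[of 1] by metis
  obtain C where C: "0 \<le> C" "\<And>u \<phi>. \<phi> \<in> Dstar \<Longrightarrow> norm (B u \<phi>) \<le> C * norm u * gn \<phi>"
    using B_bound by metis
  obtain c where c: "0 \<le> c" "\<And>t \<phi>. 0 \<le> t \<Longrightarrow> t \<le> T \<Longrightarrow> \<phi> \<in> Dstar \<Longrightarrow> gn (Rstar t \<phi>) \<le> c * gn \<phi>"
    using R_graph[of T] by metis
  have "norm (integrand_n n T u \<phi> s) \<le> (C * M * c * gn \<phi>) * (indicat_real {0<..<T} s * norm (u s))" for n u s
  proof (cases "s \<in> {0<..<T}")
    case True
    let ?\<epsilon> = "1 / real (Suc n)" and ?\<psi> = "Rstar (T - s) \<phi>"
    have \<epsilon>: "0 < ?\<epsilon>" "?\<epsilon> \<le> 1" by auto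
    have \<psi>: "?\<psi> \<in> Dstar" using True \<phi> by (intro R_Dstar) auto
    have "ip (R (T - s) (Bn n (u s))) \<phi> = B (u s) (reg ?\<epsilon> ?\<psi>)"
      using ip_adj_UNIV[OF R.op, of "T - s" "Bn n (u s)" \<phi>] True by (simp only: ip_Bn) simp
    also have "norm \<dots> \<le> C * norm (u s) * gn (reg ?\<epsilon> ?\<psi>)" by (rule C(2)[OF reg_Dstar(1)[OF \<epsilon>(1)]])
    also have "\<dots> \<le> C * norm (u s) * (M * (c * gn \<phi>))"
    proof (intro mult_left_mono)
      have "gn (reg ?\<epsilon> ?\<psi>) \<le> M * gn ?\<psi>" by (rule gn_reg_Dstar_le[OF \<epsilon> M(2) \<psi>])
      also have "\<dots> \<le> M * (c * gn \<phi>)" using M(1) True \<phi> by (intro mult_left_mono c) auto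
      finally show "gn (reg ?\<epsilon> ?\<psi>) \<le> M * (c * gn \<phi>)" .
    qed (use C(1) in simp)
    finally show ?thesis using True by (simp add: integrand_n_def mult_ac)
  qed (simp add: integrand_n_def)
  then show ?thesis using that by blast
qed

lemma integrand_n_measurable: "u \<in> L2_on UNIV \<Longrightarrow> integrand_n n T u \<phi> \<in> borel_measurable lebesgue"
  unfolding integrand_n_def[abs_def] by (rule integrand_Bn_measurable) (simp add: L2_UNIV)

lemma integrand_n_integrable:
  assumes u: "u \<in> L2_on UNIV" and \<phi>: "\<phi> \<in> Dstar"
  shows "integrable lebesgue (integrand_n n T u \<phi>)"
proof -
  obtain c where c: "\<And>n s u. norm (integrand_n n T u \<phi> s) \<le> c * (indicat_real {0<..<T} s * norm (u s))"
    using integrand_n_bound[OF \<phi>] by metis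
  show ?thesis
  proof (rule Bochner_Integration.integrable_bound)
    show "integrable lebesgue (\<lambda>s. c * (indicat_real {0<..<T} s * norm (u s)))"
      by (intro integrable_mult_right integrable_indicator_norm u)
    have "norm (integrand_n n T u \<phi> s) \<le> norm (c * (indicat_real {0<..<T} s * norm (u s)))" for s
      unfolding real_norm_def by (rule order_trans[OF c abs_ge_self])
    then show "AE s in lebesgue. norm (integrand_n n T u \<phi> s) \<le>
        norm (c * (indicat_real {0<..<T} s * norm (u s)))" by (intro AE_I2)
  qed (rule integrand_n_measurable[OF u])
qed

lemma inp_limit:
  assumes u: "u \<in> L2_on UNIV" and \<phi>: "\<phi> \<in> Dstar"
  shows "(\<lambda>n. integral\<^sup>L lebesgue (integrand_n n T u \<phi>)) \<longlonglongrightarrow> inp T u \<phi>"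
proof -
  obtain c where c: "\<And>n s u. norm (integrand_n n T u \<phi> s) \<le> c * (indicat_real {0<..<T} s * norm (u s))"
    using integrand_n_bound[OF \<phi>] by metis
  show ?thesis
    unfolding inp_def
  proof (rule integral_dominated_convergence[where w = "\<lambda>s. c * (indicat_real {0<..<T} s * norm (u s))"])
    show "integrable lebesgue (\<lambda>s. c * (indicat_real {0<..<T} s * norm (u s)))"
      by (intro integrable_mult_right integrable_indicator_norm u)
    show "integrand T u \<phi> \<in> borel_measurable lebesgue"
      using u by (intro integrand_measurable \<phi>) (simp add: L2_UNIV)
    show "AE s in lebesgue. (\<lambda>n. integrand_n n T u \<phi> s) \<longlonglongrightarrow> integrand T u \<phi> s"
      using integrand_Bn_limit[OF \<phi>] by (simp add: integrand_n_def)
  qed (use c integrand_n_measurable[OF u] in auto)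
qed

end

section \<open>Comparison of the two input maps\<close>

context perturbed_control
begin

lemma Duhamel_ip:
  assumes "0 \<le> t"
  shows "((\<lambda>\<sigma>. ip (P \<sigma> (K (S (t - \<sigma>) x))) \<phi>) has_integral (ip (P t x) \<phi> - ip (S t x) \<phi>)) {0..t}"
  using has_integral_linear[OF pg.Duhamel[OF assms] bounded_linear_ip_left[of \<phi>]]
  by (simp add: o_def ip_diff_left)

text \<open>This estimates the integral over s for fixed \<open>\<sigma>\<close>. The unperturbed
  state has norm at most \<open>C\<close>; moving \<open>reg\<close>, \<open>Kstar\<close> and the
  adjoint of \<open>P\<close> back onto it leaves \<open>P \<sigma> (K x)\<close>, where
  \<open>x\<close> is its mean, of norm at most \<open>M * C\<close>.\<close>

lemma inner_input_bound:
  assumes u: "u \<in> L2_on UNIV" "sq_norm u \<le> 1" and C: "X0.bounded_inp \<tau> C" and \<epsilon>: "0 < \<epsilon>"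
    and \<sigma>: "0 \<le> \<sigma>" and mean: "\<And>x. norm (mean \<epsilon> x) \<le> M * norm x" and M: "0 \<le> M"
    and m: "\<And>x. norm x \<le> M * C \<Longrightarrow> rip (P \<sigma> (K x)) \<phi> \<le> m"
  shows "X0.inp \<tau> u (reg \<epsilon> (Kstar (P.Sstar \<sigma> \<phi>))) \<bullet> 1 \<le> m"
proof -
  obtain h where h: "\<And>\<psi>. \<psi> \<in> Dstar \<Longrightarrow> X0.inp \<tau> u \<psi> = ip h \<psi>"
    using X0.inp_representable[OF C u(1)] by blast
  have C0: "0 \<le> C" using C by (simp add: X0.bounded_inp_def)
  have "norm h \<le> C"
  proof (rule norm_le_if_Dstar[OF _ C0])
    show "norm (ip h \<psi>) \<le> C * norm \<psi>" if "\<psi> \<in> Dstar" for \<psi>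
      using C u that by (simp add: X0.bounded_inp_def flip: h)
  qed
  then have "norm (mean \<epsilon> h) \<le> M * C"
    by (intro order_trans[OF mean] mult_left_mono M)
  moreover have "X0.inp \<tau> u (reg \<epsilon> (Kstar (P.Sstar \<sigma> \<phi>))) = ip (P \<sigma> (K (mean \<epsilon> h))) \<phi>"
    by (simp add: h reg_Dstar(1)[OF \<epsilon>] ip_mean[OF \<epsilon>] P.ip_Sstar[OF \<sigma>] ip_adj_UNIV[OF K_op])
  ultimately show ?thesis using m by simp
qed

text \<open>Duhamel's formula for \<open>P(T - s) - S(T - s)\<close> and Fubini's theorem on the triangle
  \<open>0 \<le> s, \<sigma>\<close>, \<open>s + \<sigma> \<le> T\<close> turn the difference of the input maps into an average over \<open>\<sigma>\<close> of
  \<open>P(\<sigma>) K\<close> applied to input maps of the unperturbed system.\<close>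

lemma comparison_regularized:
  assumes u: "u \<in> L2_on UNIV" "sq_norm u \<le> 1" and T: "0 \<le> T" and C: "X0.bounded_inp T C"
    and mean: "\<And>x. norm (mean (1 / Suc n) x) \<le> M * norm x" and M: "0 \<le> M" and \<phi>: "\<phi> \<in> Dstar"
    and m: "\<And>\<sigma> x. 0 \<le> \<sigma> \<Longrightarrow> \<sigma> \<le> T \<Longrightarrow> norm x \<le> M * C \<Longrightarrow> rip (P \<sigma> (K x)) \<phi> \<le> m"
  shows "(integral\<^sup>L lebesgue (XK.integrand_n n T u \<phi>) - integral\<^sup>L lebesgue (X0.integrand_n n T u \<phi>)) \<bullet> 1 \<le> T * m"
proof -
  have \<epsilon>: "0 < 1 / real (Suc n)" by simp
  obtain N0 g where N0: "negligible N0" and g: "\<And>k. continuous_on UNIV (g k)"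
    and lim0: "\<And>x. x \<notin> N0 \<Longrightarrow> (\<lambda>k. g k x) \<longlonglongrightarrow> u x"
    using u(1) by (auto simp: L2_UNIV measurable_on_def)
  \<comment> \<open>Fubini's theorem is used for \<open>lborel\<close>, so the exceptional set is
    enlarged to a Borel null set.\<close>
  obtain N where N: "N \<in> null_sets lborel" "N0 \<subseteq> N"
    using N0 unfolding negligible_iff_null_sets null_sets_completion_iff2 by blast
  have lim: "\<And>x. x \<notin> N \<Longrightarrow> (\<lambda>k. g k x) \<longlonglongrightarrow> u x" using lim0 N(2) by blast
  have Nl: "N \<in> null_sets lebesgue" using N(1) by (rule null_sets_completionI)
  have AEN: "AE s in lebesgue. s \<notin> N" by (rule AE_not_in[OF Nl])
  have [measurable]: "N \<in> sets borel" using N(1) by auto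
  \<comment> \<open>Clipped times keep the approximants of \<open>V\<close> continuous on the whole
    plane. On the triangle \<open>E\<close> the clipping is inactive, and the points over
    \<open>N\<close> are cut out of \<open>E\<close>.\<close>
  define V where "V x s \<sigma> = ip (P (max 0 \<sigma>) (K (S (max 0 (T - s - \<sigma>)) (Bn n x)))) \<phi>" for x s \<sigma>
  define E where "E = {p :: real \<times> real. 0 < fst p \<and> fst p < T \<and> 0 \<le> snd p \<and> snd p \<le> T - fst p \<and> fst p \<notin> N}"
  define G where "G p = indicat_real E p *\<^sub>R V (u (fst p)) (fst p) (snd p)" for p
  have sets_eq: "sets (lborel \<Otimes>\<^sub>M lborel) = sets (borel \<Otimes>\<^sub>M (borel :: real measure) :: (real \<times> real) measure)"
    by (intro sets_pair_measure_cong) auto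
  have [measurable]: "E \<in> sets (borel \<Otimes>\<^sub>M borel)"
  proof -
    have "E = {p \<in> space (borel \<Otimes>\<^sub>M borel). 0 < fst p \<and> fst p < T \<and> 0 \<le> snd p \<and> snd p \<le> T - fst p \<and> fst p \<notin> N}"
      by (auto simp: E_def space_pair_measure)
    also have "\<dots> \<in> sets (borel \<Otimes>\<^sub>M borel)" by measurable
    finally show ?thesis .
  qed
  have Gm: "G \<in> borel_measurable (borel \<Otimes>\<^sub>M borel)"
  proof (rule borel_measurable_LIMSEQ_metric)
    fix k
    have "continuous_on UNIV (\<lambda>p. V (g k (fst p)) (fst p) (snd p))"
      unfolding V_def
      by (intro continuous_on_ip P.continuous_on_S bounded_linear.continuous_on[OF pg.K_linear]
          continuous_on_S bounded_linear.continuous_on[OF Bn_linear] continuous_on_compose2[OF g]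
          continuous_intros) auto
    then have "(\<lambda>p. V (g k (fst p)) (fst p) (snd p)) \<in> borel_measurable (borel \<Otimes>\<^sub>M borel)"
      unfolding borel_prod by (rule borel_measurable_continuous_onI)
    then show "(\<lambda>p. indicat_real E p *\<^sub>R V (g k (fst p)) (fst p) (snd p)) \<in> borel_measurable (borel \<Otimes>\<^sub>M borel)"
      by measurable
  next
    fix p
    show "(\<lambda>k. indicat_real E p *\<^sub>R V (g k (fst p)) (fst p) (snd p)) \<longlonglongrightarrow> G p"
    proof (cases "p \<in> E")
      case True
      then have "(\<lambda>k. g k (fst p)) \<longlonglongrightarrow> u (fst p)" by (intro lim) (simp add: E_def)
      then show ?thesis
        unfolding G_def V_def
        by (intro tendsto_intros tendsto_ip bounded_linear.tendsto[OF P.S_linear]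
            bounded_linear.tendsto[OF pg.K_linear] bounded_linear.tendsto[OF S_linear]
            bounded_linear.tendsto[OF Bn_linear]) auto
    qed (simp add: G_def)
  qed
  then have Gml [measurable]: "G \<in> borel_measurable (lborel \<Otimes>\<^sub>M lborel)"
    by (simp cong: measurable_cong_sets add: sets_eq)
  define q where "q s = indicat_real ({0<..<T} - N) s * norm (u s)" for s
  have qm [measurable]: "q \<in> borel_measurable lborel"
  proof (rule borel_measurable_LIMSEQ_metric)
    fix k
    have "(\<lambda>s. norm (g k s)) \<in> borel_measurable borel"
      by (intro borel_measurable_continuous_onI continuous_intros g)
    then show "(\<lambda>s. indicat_real ({0<..<T} - N) s * norm (g k s)) \<in> borel_measurable lborel" by measurable
  next
    fix s
    show "(\<lambda>k. indicat_real ({0<..<T} - N) s * norm (g k s)) \<longlonglongrightarrow> q s"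
      using lim[of s] by (cases "s \<in> N") (auto simp: q_def intro!: tendsto_intros)
  qed
  have qi: "integrable lborel q"
  proof -
    have "integrable lebesgue q"
    proof (rule Bochner_Integration.integrable_bound[OF X0.integrable_indicator_norm(1)[OF u(1), of T]])
      show "q \<in> borel_measurable lebesgue" using qm by (rule measurable_completion)
      show "AE s in lebesgue. norm (q s) \<le> norm (indicat_real {0<..<T} s * norm (u s))"
        by (auto simp: q_def indicator_def)
    qed
    then show ?thesis using integrable_completion[OF qm] by simp
  qed
  obtain c where c: "\<And>p. norm (G p) \<le> c * (q (fst p) * indicat_real {0..T} (snd p))"
  proof -
    obtain M1 where M1: "M1 \<ge> 1" "\<And>s x. 0 \<le> s \<Longrightarrow> s \<le> T \<Longrightarrow> norm (S s x) \<le> M1 * norm x"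
      using local_bound[of T] by metis
    obtain M2 where M2: "M2 \<ge> 1" "\<And>s x. 0 \<le> s \<Longrightarrow> s \<le> T \<Longrightarrow> norm (P s x) \<le> M2 * norm x"
      using P.local_bound[of T] by metis
    obtain k where k: "0 \<le> k" "\<And>x. norm (K x) \<le> k * norm x" using Kstar_bound by metis
    obtain b where b: "0 \<le> b" "\<And>v. norm (Bn n v) \<le> norm v * b"
      using bounded_linear.nonneg_bounded[OF Bn_linear] by blast
    have "norm (G p) \<le> (M2 * k * M1 * b * norm \<phi>) * (q (fst p) * indicat_real {0..T} (snd p))" for p
    proof (cases "p \<in> E")
      case True
      obtain s \<sigma> where p: "p = (s, \<sigma>)" by fastforce
      have s: "0 < s" "s < T" "0 \<le> \<sigma>" "\<sigma> \<le> T - s" "s \<notin> N" using True by (auto simp: E_def p)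
      let ?x = "Bn n (u s)"
      have "norm (ip (P \<sigma> (K (S (T - s - \<sigma>) ?x))) \<phi>) \<le> norm (P \<sigma> (K (S (T - s - \<sigma>) ?x))) * norm \<phi>"
        by (rule norm_ip_le)
      also have "\<dots> \<le> (M2 * (k * (M1 * (norm (u s) * b)))) * norm \<phi>"
      proof (rule mult_right_mono)
        have "norm (P \<sigma> (K (S (T - s - \<sigma>) ?x))) \<le> M2 * norm (K (S (T - s - \<sigma>) ?x))"
          using s by (intro M2) auto
        also have "\<dots> \<le> M2 * (k * norm (S (T - s - \<sigma>) ?x))" using M2(1) by (intro mult_left_mono k) auto
        also have "\<dots> \<le> M2 * (k * (M1 * norm ?x))" using M2(1) k(1) s by (intro mult_left_mono M1) auto
        also have "\<dots> \<le> M2 * (k * (M1 * (norm (u s) * b)))"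
          using M2(1) k(1) M1(1) by (intro mult_left_mono b) auto
        finally show "norm (P \<sigma> (K (S (T - s - \<sigma>) ?x))) \<le> M2 * (k * (M1 * (norm (u s) * b)))" .
      qed simp
      finally show ?thesis using s True by (simp add: G_def V_def q_def p mult_ac)
    next
      case False
      then show ?thesis using M1(1) M2(1) k(1) b(1) by (simp add: G_def q_def)
    qed
    then show ?thesis using that by blast
  qed
  have indT: "integrable lborel (indicat_real {0..T})" by (rule integrable_real_indicator) (use T in auto)
  have Gi: "integrable (lborel \<Otimes>\<^sub>M lborel) G"
  proof (rule Bochner_Integration.integrable_bound)
    have "integrable (lborel \<Otimes>\<^sub>M lborel) (\<lambda>p. q (fst p) * indicat_real {0..T} (snd p))"
    proof (rule lborel_pair.Fubini_integrable)
      show "(\<lambda>p. q (fst p) * indicat_real {0..T} (snd p)) \<in> borel_measurable (lborel \<Otimes>\<^sub>M lborel)" by measurable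
      have "integrable lborel (\<lambda>x. \<bar>q x\<bar> * T)" using qi by simp
      then show "integrable lborel (\<lambda>x. LINT y|lborel. norm (q (fst (x, y)) * indicat_real {0..T} (snd (x, y))))"
        using T by (simp add: abs_mult)
      show "AE x in lborel. integrable lborel (\<lambda>y. q (fst (x, y)) * indicat_real {0..T} (snd (x, y)))"
        using indT by simp
    qed
    then show "integrable (lborel \<Otimes>\<^sub>M lborel) (\<lambda>p. c * (q (fst p) * indicat_real {0..T} (snd p)))"
      by (rule integrable_mult_right)
    have "norm (G p) \<le> norm (c * (q (fst p) * indicat_real {0..T} (snd p)))" for p
      unfolding real_norm_def by (rule order_trans[OF c abs_ge_self])
    then show "AE p in lborel \<Otimes>\<^sub>M lborel. norm (G p) \<le> norm (c * (q (fst p) * indicat_real {0..T} (snd p)))"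
      by (intro AE_I2)
  qed measurable
  define a where "a s = (LINT \<sigma>|lborel. G (s, \<sigma>))" for s
  define y where "y \<sigma> = (LINT s|lborel. G (s, \<sigma>))" for \<sigma>
  have am: "a \<in> borel_measurable lborel"
    unfolding a_def by (rule lborel.borel_measurable_lebesgue_integral) (simp add: case_prod_unfold)
  \<comment> \<open>Integrating over \<open>\<sigma>\<close> first gives Duhamel's formula at time
    \<open>T - s\<close> for the vector \<open>Bn n (u s)\<close>.\<close>
  have a_eq: "a s = XK.integrand_n n T u \<phi> s - X0.integrand_n n T u \<phi> s" if s: "s \<notin> N" for s
  proof (cases "s \<in> {0<..<T}")
    case True
    let ?x = "Bn n (u s)"
    have cont: "continuous_on {0..T - s} (\<lambda>\<sigma>. ip (P \<sigma> (K (S (T - s - \<sigma>) ?x))) \<phi>)"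
      by (intro continuous_on_ip pg.Duhamel_continuous continuous_intros)
    have "G (s, \<sigma>) = indicat_real {0..T - s} \<sigma> *\<^sub>R ip (P \<sigma> (K (S (T - s - \<sigma>) ?x))) \<phi>" for \<sigma>
      using True s by (auto simp: G_def V_def E_def indicator_def)
    then have "a s = (LINT \<sigma>:{0..T - s}|lborel. ip (P \<sigma> (K (S (T - s - \<sigma>) ?x))) \<phi>)"
      by (simp add: a_def set_lebesgue_integral_def)
    also have "\<dots> = integral {0..T - s} (\<lambda>\<sigma>. ip (P \<sigma> (K (S (T - s - \<sigma>) ?x))) \<phi>)"
      by (rule set_borel_integral_eq_integral(2)[OF borel_integrable_atLeastAtMost'[OF cont]])
    also have "\<dots> = ip (P (T - s) ?x) \<phi> - ip (S (T - s) ?x) \<phi>"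
      using True by (intro integral_unique Duhamel_ip) simp
    finally show ?thesis using True by (simp add: XK.integrand_n_def X0.integrand_n_def)
  next
    case False
    then have "G (s, \<sigma>) = 0" for \<sigma> by (auto simp: G_def E_def indicator_def)
    then show ?thesis using False by (simp add: a_def XK.integrand_n_def X0.integrand_n_def)
  qed
  have "integral\<^sup>L lebesgue (XK.integrand_n n T u \<phi>) - integral\<^sup>L lebesgue (X0.integrand_n n T u \<phi>) =
      (LINT s|lebesgue. XK.integrand_n n T u \<phi> s - X0.integrand_n n T u \<phi> s)"
    using u(1) \<phi> by (simp add: XK.integrand_n_integrable X0.integrand_n_integrable)
  also have "\<dots> = integral\<^sup>L lebesgue a"
  proof (rule integral_cong_AE)
    show "AE s in lebesgue. XK.integrand_n n T u \<phi> s - X0.integrand_n n T u \<phi> s = a s"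
      using AEN by eventually_elim (simp add: a_eq)
    show "(\<lambda>s. XK.integrand_n n T u \<phi> s - X0.integrand_n n T u \<phi> s) \<in> borel_measurable lebesgue"
      using XK.integrand_n_measurable[OF u(1)] X0.integrand_n_measurable[OF u(1)] by measurable
    show "a \<in> borel_measurable lebesgue" using am by (rule measurable_completion)
  qed
  also have "\<dots> = integral\<^sup>L lborel a" by (rule integral_completion[OF am])
  also have "\<dots> = integral\<^sup>L lborel y"
    unfolding a_def y_def
    using lborel_pair.Fubini_integral[of "\<lambda>s \<sigma>. G (s, \<sigma>)"] Gi by (simp add: case_prod_unfold)
  finally have diff: "integral\<^sup>L lebesgue (XK.integrand_n n T u \<phi>) - integral\<^sup>L lebesgue (X0.integrand_n n T u \<phi>) =
      integral\<^sup>L lborel y" .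
  have yi: "integrable lborel y"
    unfolding y_def using lborel_pair.integrable_snd[of "\<lambda>s \<sigma>. G (s, \<sigma>)"] Gi by (simp add: case_prod_unfold)
  \<comment> \<open>Integrating over s first gives, for fixed \<open>\<sigma>\<close>, the
    unperturbed input map with horizon \<open>T - \<sigma>\<close> at a test vector regularised into
    \<open>Dstar\<close>.\<close>
  have y_le: "y \<sigma> \<bullet> 1 \<le> indicat_real {0..T} \<sigma> * m" for \<sigma>
  proof (cases "\<sigma> \<in> {0..T}")
    case True
    let ?\<chi> = "Kstar (P.Sstar \<sigma> \<phi>)" and ?\<tau> = "T - \<sigma>"
    let ?\<psi> = "reg (1 / Suc n) ?\<chi>"
    have Gs: "(\<lambda>s. G (s, \<sigma>)) \<in> borel_measurable lborel" using Gml by measurable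
    have G_eq: "G (s, \<sigma>) = X0.integrand ?\<tau> u ?\<psi> s" if "s \<notin> N" "s \<noteq> ?\<tau>" for s
    proof (cases "s \<in> {0<..<?\<tau>}")
      case s: True
      have "G (s, \<sigma>) = ip (P \<sigma> (K (S (T - s - \<sigma>) (Bn n (u s))))) \<phi>"
        using s True that by (simp add: G_def V_def E_def)
      also have "\<dots> = ip (Bn n (u s)) (Sstar (T - s - \<sigma>) ?\<chi>)"
        using s True by (simp add: P.ip_Sstar ip_adj_UNIV[OF K_op] ip_Sstar)
      \<comment> \<open>The regularisation inside \<open>Bn n\<close> commutes with the adjoint
        semigroup and so can be absorbed into the test vector.\<close>
      also have "\<dots> = B (u s) (Sstar (T - s - \<sigma>) ?\<psi>)"
        using s unfolding ip_Bn by (subst reg_Sstar[OF \<epsilon>]) auto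
      finally show ?thesis using s by (simp add: X0.integrand_def algebra_simps)
    next
      case False
      then have "(s, \<sigma>) \<notin> E" using True that by (auto simp: E_def)
      then show ?thesis using False by (simp add: G_def X0.integrand_def)
    qed
    have "y \<sigma> = (LINT s|lebesgue. G (s, \<sigma>))"
      unfolding y_def by (rule integral_completion[OF Gs, symmetric])
    also have "\<dots> = X0.inp ?\<tau> u ?\<psi>"
      unfolding X0.inp_def
    proof (rule integral_cong_AE)
      have "{?\<tau>} \<in> null_sets lebesgue" using negligible_sing[of ?\<tau>] by (simp only: negligible_iff_null_sets)
      from AE_not_in[OF this] AEN show "AE s in lebesgue. G (s, \<sigma>) = X0.integrand ?\<tau> u ?\<psi> s"
        by eventually_elim (use G_eq in auto)
      show "(\<lambda>s. G (s, \<sigma>)) \<in> borel_measurable lebesgue" using Gs by (rule measurable_completion)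
      show "X0.integrand ?\<tau> u ?\<psi> \<in> borel_measurable lebesgue"
        by (intro borel_measurable_integrable X0.integrand_integrable u reg_Dstar \<epsilon>)
    qed
    also have "X0.inp ?\<tau> u ?\<psi> \<bullet> 1 \<le> m"
      using True m by (intro inner_input_bound[OF u X0.bounded_inp_mono[OF C] \<epsilon> _ mean M]) auto
    finally show ?thesis using True by simp
  next
    case False
    then have "G (s, \<sigma>) = 0" for s by (auto simp: G_def E_def indicator_def)
    then show ?thesis using False by (simp add: y_def)
  qed
  have "integral\<^sup>L lborel y \<bullet> 1 = (LINT \<sigma>|lborel. y \<sigma> \<bullet> 1)"
    using yi by simp
  also have "\<dots> \<le> (LINT \<sigma>|lborel. indicat_real {0..T} \<sigma> * m)"
    by (rule integral_mono) (use y_le yi indT in auto)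
  also have "\<dots> = T * m" using T by simp
  finally show ?thesis unfolding diff .
qed

text \<open>A bound of \<open>S\<close> on [0, 1] bounds the means over [0, 1/(n+1)] for all n, so
  one \<open>M\<close> serves along the limit.\<close>

lemma comparison:
  obtains M where "1 \<le> M" "\<And>T C u \<phi> m. u \<in> L2_on UNIV \<Longrightarrow> sq_norm u \<le> 1 \<Longrightarrow> 0 \<le> T \<Longrightarrow>
    X0.bounded_inp T C \<Longrightarrow> \<phi> \<in> Dstar \<Longrightarrow>
    (\<And>\<sigma> x. 0 \<le> \<sigma> \<Longrightarrow> \<sigma> \<le> T \<Longrightarrow> norm x \<le> M * C \<Longrightarrow> rip (P \<sigma> (K x)) \<phi> \<le> m) \<Longrightarrow>
    (XK.inp T u \<phi> - X0.inp T u \<phi>) \<bullet> 1 \<le> T * m"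
proof -
  obtain M where M: "M \<ge> 1" "\<And>s x. 0 \<le> s \<Longrightarrow> s \<le> 1 \<Longrightarrow> norm (S s x) \<le> M * norm x"
    using local_bound[of 1] by metis
  have "(XK.inp T u \<phi> - X0.inp T u \<phi>) \<bullet> 1 \<le> T * m"
    if u: "u \<in> L2_on UNIV" "sq_norm u \<le> 1" and T: "0 \<le> T" and C: "X0.bounded_inp T C" and \<phi>: "\<phi> \<in> Dstar"
      and m: "\<And>\<sigma> x. 0 \<le> \<sigma> \<Longrightarrow> \<sigma> \<le> T \<Longrightarrow> norm x \<le> M * C \<Longrightarrow> rip (P \<sigma> (K x)) \<phi> \<le> m" for T C u \<phi> m
  proof (rule LIMSEQ_le_const2)
    show "(\<lambda>n. (integral\<^sup>L lebesgue (XK.integrand_n n T u \<phi>) - integral\<^sup>L lebesgue (X0.integrand_n n T u \<phi>)) \<bullet> 1)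
        \<longlonglongrightarrow> (XK.inp T u \<phi> - X0.inp T u \<phi>) \<bullet> 1"
      by (intro tendsto_intros XK.inp_limit X0.inp_limit u \<phi>)
    have "norm (mean (1 / Suc n) x) \<le> M * norm x" for n x
      by (rule norm_mean_le[OF _ _ M(2)]) auto
    then show "\<exists>N. \<forall>n\<ge>N. (integral\<^sup>L lebesgue (XK.integrand_n n T u \<phi>) -
        integral\<^sup>L lebesgue (X0.integrand_n n T u \<phi>)) \<bullet> 1 \<le> T * m"
      using M(1) by (intro exI[of _ 0] allI impI comparison_regularized[OF u T C _ _ \<phi> m]) auto
  qed
  then show ?thesis using that[OF M(1)] by blast
qed

end

section \<open>Surjectivity and observability\<close>

context hilbert_space
begin

text \<open>The set \<open>I\<close> is the polar of the image of the unit ball of controls.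
  Surjectivity bounds it pointwise, uniform boundedness then bounds it in norm, and scaling passes
  from the bound 1 to an arbitrary \<open>m\<close>. Quantifying over upper bounds \<open>m\<close>
  stands for the supremum.\<close>

lemma observable_if_surjective:
  fixes h :: "(real \<Rightarrow> 'u::real_normed_vector) \<Rightarrow> 'h"
  assumes scaleR: "\<And>u c. u \<in> L2_on UNIV \<Longrightarrow> h (\<lambda>s. c *\<^sub>R u s) = c *\<^sub>R h u"
    and surj: "\<And>y. \<exists>u\<in>L2_on UNIV. h u = y"
  shows "\<exists>C\<ge>0. \<forall>\<phi> m. (\<forall>u\<in>L2_on UNIV. sq_norm u \<le> 1 \<longrightarrow> rip (h u) \<phi> \<le> m) \<longrightarrow> norm \<phi> \<le> C * m"
proof -
  define I where "I = {\<phi>. \<forall>u\<in>L2_on UNIV. sq_norm u \<le> 1 \<longrightarrow> rip (h u) \<phi> \<le> 1}"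
  have "\<exists>K. \<forall>\<phi>\<in>I. norm (rip y \<phi>) \<le> K" for y
  proof -
    obtain u where u: "u \<in> L2_on UNIV" "h u = y" using surj by blast
    define c where "c = 1 + sq_norm u"
    have s0: "0 \<le> sq_norm u" unfolding sq_norm_def by (rule Bochner_Integration.integral_nonneg) simp
    then have c: "c > 0" "sq_norm u \<le> c\<^sup>2" by (auto simp: c_def power2_eq_square algebra_simps)
    have "norm (rip y \<phi>) \<le> c" if "\<phi> \<in> I" for \<phi>
    proof -
      have "r * rip y \<phi> \<le> 1" if "r\<^sup>2 = 1 / c\<^sup>2" for r
      proof -
        have "rip (h (\<lambda>s. r *\<^sub>R u s)) \<phi> \<le> 1"
          using \<open>\<phi> \<in> I\<close> L2_scale[OF u(1), of r] that c by (simp add: I_def)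
        then show ?thesis by (simp add: scaleR[OF u(1)] u(2) ip_scaleR_left)
      qed
      from this[of "1 / c"] this[of "- 1 / c"] show ?thesis
        using c by (simp add: power_divide abs_le_iff field_simps)
    qed
    then show ?thesis by blast
  qed
  then obtain C where C: "0 \<le> C" "\<And>\<phi> y. \<phi> \<in> I \<Longrightarrow> norm (rip y \<phi>) \<le> C * norm y"
    using uniform_boundedness_banach[of I "\<lambda>\<phi> y. rip y \<phi>"] bounded_linear_rip_left by blast
  have CI: "norm \<phi> \<le> C" if "\<phi> \<in> I" for \<phi>
    using C(2)[OF that, of \<phi>] C(1) by (cases "\<phi> = 0") (simp_all add: rip_self power2_eq_square)
  have "norm \<phi> \<le> C * m" if m: "\<forall>u\<in>L2_on UNIV. sq_norm u \<le> 1 \<longrightarrow> rip (h u) \<phi> \<le> m" for \<phi> m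
  proof -
    have "(\<lambda>s. 0) \<in> (L2_on UNIV :: (real \<Rightarrow> 'u) set)" "sq_norm (\<lambda>s. 0 :: 'u) = 0"
      by (auto simp: L2_UNIV sq_norm_def)
    moreover from this have "h (\<lambda>s. 0) = 0" using scaleR[of "\<lambda>s. 0" 0] by simp
    ultimately have m0: "0 \<le> m" using m by force
    \<comment> \<open>For \<open>m = 0\<close> every positive \<open>r\<close> is allowed, which
      forces \<open>\<phi> = 0\<close>.\<close>
    have r: "r * norm \<phi> \<le> C" if "0 < r" "r * m \<le> 1" for r
    proof -
      have "r *\<^sub>R \<phi> \<in> I"
        unfolding I_def
      proof (intro CollectI ballI impI)
        fix u :: "real \<Rightarrow> 'u" assume "u \<in> L2_on UNIV" "sq_norm u \<le> 1"
        then have "r * rip (h u) \<phi> \<le> r * m" using m that(1) by (intro mult_left_mono) auto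
        then show "rip (h u) (r *\<^sub>R \<phi>) \<le> 1" using that(2) by (simp add: ip_scaleR_right)
      qed
      from CI[OF this] show ?thesis using that by simp
    qed
    show ?thesis
    proof (cases "m = 0")
      case False
      then show ?thesis using r[of "1 / m"] m0 by (simp add: field_simps)
    next
      case True
      have "norm \<phi> = 0"
      proof (rule ccontr)
        assume "norm \<phi> \<noteq> 0"
        then have "(C + 1) / norm \<phi> * norm \<phi> \<le> C" using True C(1) by (intro r) auto
        then show False using \<open>norm \<phi> \<noteq> 0\<close> by simp
      qed
      then show ?thesis using True by simp
    qed
  qed
  then show ?thesis using C(1) by blast
qed

text \<open>By convex projection, observability puts the unit ball into the closure of the image of a ball;
  successive approximation then removes the closure.\<close>

lemma surjective_if_observable:
  fixes h :: "(real \<Rightarrow> 'u::real_normed_vector) \<Rightarrow> 'h"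
  assumes lin: "\<And>u v a b. u \<in> L2_on UNIV \<Longrightarrow> v \<in> L2_on UNIV \<Longrightarrow>
      h (\<lambda>s. a *\<^sub>R u s + b *\<^sub>R v s) = a *\<^sub>R h u + b *\<^sub>R h v"
    and series: "\<And>w e. (\<And>n. w n \<in> L2_on UNIV) \<Longrightarrow> (\<And>n. sq_norm (w n) \<le> 1) \<Longrightarrow> (\<And>n. \<bar>e n\<bar> \<le> (1/2) ^ n) \<Longrightarrow>
      \<exists>u\<in>L2_on UNIV. \<forall>\<phi>\<in>M. (\<lambda>n. e n *\<^sub>R ip (h (w n)) \<phi>) sums ip (h u) \<phi>"
    and M: "\<And>x y. (\<And>\<phi>. \<phi> \<in> M \<Longrightarrow> ip x \<phi> = ip y \<phi>) \<Longrightarrow> x = y"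
    and obs: "\<And>\<phi> m. (\<forall>u\<in>L2_on UNIV. sq_norm u \<le> 1 \<longrightarrow> rip (h u) \<phi> \<le> m) \<Longrightarrow> norm \<phi> \<le> C * m"
  shows "\<exists>u\<in>L2_on UNIV. h u = y"
proof -
  have scaleR: "h (\<lambda>s. c *\<^sub>R u s) = c *\<^sub>R h u" if "u \<in> L2_on UNIV" for u c
    using lin[OF that that, of c 0] by simp
  have z: "(\<lambda>s. 0) \<in> (L2_on UNIV :: (real \<Rightarrow> 'u) set)" "sq_norm (\<lambda>s. 0 :: 'u) = 0"
    by (auto simp: L2_UNIV sq_norm_def)
  have h0: "h (\<lambda>s. 0) = 0" using scaleR[OF z(1), of 0] by simp
  \<comment> \<open>At least 1, so that division by it is possible whatever the sign of
    \<open>C\<close>.\<close>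
  define \<rho> where "\<rho> = max C 1"
  have \<rho>: "1 \<le> \<rho>" "C \<le> \<rho>" by (auto simp: \<rho>_def)
  define X where "X = {u \<in> L2_on UNIV. sq_norm (u :: real \<Rightarrow> 'u) \<le> 1}"
  define Ball where "Ball = (\<lambda>u. \<rho> *\<^sub>R h u) ` X"
  have Xconv: "(\<lambda>s. (1 - t) *\<^sub>R u s + t *\<^sub>R v s) \<in> X" if "u \<in> X" "v \<in> X" "0 \<le> t" "t \<le> 1" for u v t
  proof -
    have "(1 - t) * sq_norm u + t * sq_norm v \<le> (1 - t) * 1 + t * 1"
      using that by (intro add_mono mult_left_mono) (auto simp: X_def)
    then show ?thesis using L2_convex[of u v t] that by (auto simp: X_def)
  qed
  have conv: "convex Ball"
    unfolding convex_alt
  proof (intro ballI allI impI)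
    fix x y t assume "x \<in> Ball" "y \<in> Ball" and t: "0 \<le> t \<and> t \<le> (1::real)"
    then obtain u v where uv: "u \<in> X" "x = \<rho> *\<^sub>R h u" "v \<in> X" "y = \<rho> *\<^sub>R h v" by (auto simp: Ball_def)
    have "(1 - t) *\<^sub>R x + t *\<^sub>R y = \<rho> *\<^sub>R h (\<lambda>s. (1 - t) *\<^sub>R u s + t *\<^sub>R v s)"
      using lin[of u v "1 - t" t] uv by (simp add: X_def scaleR_add_right mult.commute)
    then show "(1 - t) *\<^sub>R x + t *\<^sub>R y \<in> Ball"
      unfolding Ball_def using Xconv[OF uv(1,3)] t by blast
  qed
  have zero: "0 \<in> Ball" unfolding Ball_def using z h0 by (intro image_eqI[of _ _ "\<lambda>s. 0"]) (auto simp: X_def)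
  have in_closure: "y \<in> closure Ball" if y: "norm y \<le> 1" for y
  proof -
    obtain p where p: "p \<in> closure Ball" "\<And>c. c \<in> Ball \<Longrightarrow> rip c (y - p) \<le> rip p (y - p)"
      using convex_projection[OF conv, of y] zero by blast
    define m where "m = rip p (y - p)"
    have m0: "0 \<le> m" using p(2)[OF zero] by (simp add: m_def)
    have "rip (h u) (y - p) \<le> m / \<rho>" if "u \<in> L2_on UNIV" "sq_norm u \<le> 1" for u
      using p(2)[of "\<rho> *\<^sub>R h u"] that \<rho>(1) by (simp add: Ball_def X_def ip_scaleR_left m_def field_simps)
    then have "norm (y - p) \<le> C * (m / \<rho>)" using obs by blast
    also have "\<dots> \<le> \<rho> * (m / \<rho>)" using \<rho> m0 by (intro mult_right_mono) auto
    finally have le: "norm (y - p) \<le> m" using \<rho>(1) by simp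
    \<comment> \<open>By \<open>le\<close> this square is at most \<open>norm (y - p) - m\<close>,
      hence at most 0: no point of the unit ball can be separated from \<open>Ball\<close>.\<close>
    have "(norm (y - p))\<^sup>2 = rip y (y - p) - m" unfolding rip_self[symmetric] m_def by (simp add: ip_diff_left inner_diff_left)
    also have "rip y (y - p) \<le> 1 * norm (y - p)"
      by (rule order_trans[OF rip_le]) (use y in \<open>intro mult_right_mono, auto\<close>)
    finally have "(norm (y - p))\<^sup>2 \<le> 0" using le by linarith
    then have "y = p" by simp
    then show ?thesis using p(1) by simp
  qed
  have "\<exists>u\<in>X. norm (r - \<rho> *\<^sub>R h u) \<le> 1/2" if r: "norm r \<le> 1" for r
  proof -
    obtain b where "b \<in> Ball" "dist b r < 1/2"
      using in_closure[OF r] closure_approachable[of r Ball] by (meson half_gt_zero zero_less_one)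
    then show ?thesis by (auto simp: Ball_def dist_norm norm_minus_commute intro!: less_imp_le)
  qed
  then obtain pick where pick: "\<And>r. norm r \<le> 1 \<Longrightarrow> pick r \<in> X" "\<And>r. norm r \<le> 1 \<Longrightarrow> norm (r - \<rho> *\<^sub>R h (pick r)) \<le> 1/2"
    by metis
  have unit: "\<exists>u\<in>L2_on UNIV. h u = y" if y: "norm y \<le> 1" for y
  proof -
    \<comment> \<open>Each remainder has norm at most 1/2 and is doubled back into the unit ball;
      the true error after n steps is 2^-n times \<open>r n\<close>.\<close>
    define r where "r = rec_nat y (\<lambda>n r. 2 *\<^sub>R (r - \<rho> *\<^sub>R h (pick r)))"
    have r_Suc: "r (Suc n) = 2 *\<^sub>R (r n - \<rho> *\<^sub>R h (pick (r n)))" and r_0: "r 0 = y" for n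
      by (simp_all add: r_def)
    have r: "norm (r n) \<le> 1" for n
    proof (induction n)
      case (Suc n) then show ?case using pick(2)[of "r n"] by (simp add: r_Suc)
    qed (simp add: r_0 y)
    define w where "w n = pick (r n)" for n
    have w: "w n \<in> L2_on UNIV" "sq_norm (w n) \<le> 1" for n using pick(1)[OF r] by (auto simp: w_def X_def)
    have partial: "y = (\<Sum>k<n. (1/2) ^ k *\<^sub>R (\<rho> *\<^sub>R h (w k))) + (1/2) ^ n *\<^sub>R r n" for n
    proof (induction n)
      case (Suc n)
      have "(1/2) ^ n *\<^sub>R r n = (1/2) ^ n *\<^sub>R (\<rho> *\<^sub>R h (w n)) + (1/2) ^ Suc n *\<^sub>R r (Suc n)"
        by (simp add: r_Suc w_def scaleR_diff_right)
      then show ?case using Suc by (simp add: add.assoc)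
    qed (simp add: r_0)
    have "(\<lambda>n. (1/2) ^ n *\<^sub>R r n) \<longlonglongrightarrow> 0"
    proof (rule Lim_null_comparison)
      show "\<forall>\<^sub>F n in sequentially. norm ((1/2) ^ n *\<^sub>R r n) \<le> (1/2) ^ n"
        using r by (intro always_eventually allI) (simp add: field_simps)
      show "(\<lambda>n. (1/2::real) ^ n) \<longlonglongrightarrow> 0" by (rule LIMSEQ_power_zero) simp
    qed
    then have "(\<lambda>n. y - (1/2) ^ n *\<^sub>R r n) \<longlonglongrightarrow> y - 0" by (intro tendsto_intros)
    moreover have "y - (1/2) ^ n *\<^sub>R r n = (\<Sum>k<n. (1/2) ^ k *\<^sub>R (\<rho> *\<^sub>R h (w k)))" for n
      using partial[of n] by (simp add: diff_eq_eq)
    ultimately have sums: "(\<lambda>k. (1/2) ^ k *\<^sub>R (\<rho> *\<^sub>R h (w k))) sums y" by (simp add: sums_def)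
    obtain x where x: "x \<in> L2_on UNIV" "\<And>\<phi>. \<phi> \<in> M \<Longrightarrow> (\<lambda>n. (1/2) ^ n *\<^sub>R ip (h (w n)) \<phi>) sums ip (h x) \<phi>"
      using series[of w "\<lambda>n. (1/2) ^ n", OF w] by auto
    \<comment> \<open>No continuity of \<open>h\<close> is assumed; the two series are compared by
      testing against \<open>M\<close>, which separates points.\<close>
    have "\<rho> *\<^sub>R h x = y"
    proof (rule M)
      fix \<phi> assume \<phi>: "\<phi> \<in> M"
      have "(\<lambda>k. (1/2) ^ k *\<^sub>R (\<rho> *\<^sub>R ip (h (w k)) \<phi>)) sums ip y \<phi>"
        using bounded_linear.sums[OF bounded_linear_ip_left sums, of \<phi>] by (simp add: ip_scaleR_left)
      moreover have "(\<lambda>k. (1/2) ^ k *\<^sub>R (\<rho> *\<^sub>R ip (h (w k)) \<phi>)) sums (\<rho> *\<^sub>R ip (h x) \<phi>)"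
        using sums_scaleR_right[OF x(2)[OF \<phi>], of \<rho>] by (simp add: mult.commute)
      ultimately show "ip (\<rho> *\<^sub>R h x) \<phi> = ip y \<phi>" using sums_unique2 by (metis ip_scaleR_left)
    qed
    then show ?thesis using scaleR[OF x(1), of \<rho>] L2_scale(1)[OF x(1), of \<rho>] by metis
  qed
  have pos: "norm y + 1 > 0" by (simp add: add_nonneg_pos)
  then have "norm ((1 / (norm y + 1)) *\<^sub>R y) \<le> 1" by simp
  then obtain u where u: "u \<in> L2_on UNIV" "h u = (1 / (norm y + 1)) *\<^sub>R y"
    using unit by blast
  from pos have "h (\<lambda>s. (norm y + 1) *\<^sub>R u s) = y" using scaleR[OF u(1), of "norm y + 1"] u(2) by simp
  then show ?thesis using L2_scale(1)[OF u(1)] by blast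
qed

end

section \<open>States reached from zero\<close>

context input_semigroup
begin

text \<open>Has the shape of the definite description in \<open>solution\<close>, so that solutions
  can be rewritten with it.\<close>

definition final_state :: "real \<Rightarrow> (real \<Rightarrow> 'u) \<Rightarrow> 'h" where
  "final_state T u = (THE h. pivot_embed ip D A h = (\<lambda>\<phi>. if \<phi> \<in> Dstar then inp T u \<phi> else 0))"

lemma pivot_embed_eq_iff:
  "pivot_embed ip D A h = (\<lambda>\<phi>. if \<phi> \<in> Dstar then F \<phi> else 0) \<longleftrightarrow> (\<forall>\<phi>\<in>Dstar. ip h \<phi> = F \<phi>)"
  by (auto simp: pivot_embed_def fun_eq_iff)

lemma ip_final_state:
  assumes C: "bounded_inp T C" and u: "u \<in> L2_on UNIV" and \<phi>: "\<phi> \<in> Dstar"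
  shows "ip (final_state T u) \<phi> = inp T u \<phi>"
proof -
  obtain h where h: "\<And>\<phi>. \<phi> \<in> Dstar \<Longrightarrow> inp T u \<phi> = ip h \<phi>" using inp_representable[OF C u] by blast
  have "final_state T u = h"
    unfolding final_state_def pivot_embed_eq_iff
    by (rule the_equality) (auto simp: h intro: Dstar_ip_eqI)
  then show ?thesis using h[OF \<phi>] by simp
qed

lemma final_state_combination:
  assumes C: "bounded_inp T C" and u: "u \<in> L2_on UNIV" and v: "v \<in> L2_on UNIV"
  shows "final_state T (\<lambda>s. a *\<^sub>R u s + b *\<^sub>R v s) = a *\<^sub>R final_state T u + b *\<^sub>R final_state T v"
proof (rule Dstar_ip_eqI)
  fix \<phi> assume \<phi>: "\<phi> \<in> Dstar"
  have "(\<lambda>s. a *\<^sub>R u s + b *\<^sub>R v s) \<in> L2_on UNIV"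
  proof -
    \<comment> \<open>The sum is the midpoint of the doubled functions, so convexity and scaling
      apply.\<close>
    have "(\<lambda>s. (1 - 1/2) *\<^sub>R ((2 * a) *\<^sub>R u s) + (1/2) *\<^sub>R ((2 * b) *\<^sub>R v s)) \<in> L2_on UNIV"
      by (intro L2_convex(1) L2_scale u v) auto
    then show ?thesis by simp
  qed
  then show "ip (final_state T (\<lambda>s. a *\<^sub>R u s + b *\<^sub>R v s)) \<phi> =
      ip (a *\<^sub>R final_state T u + b *\<^sub>R final_state T v) \<phi>"
    using u v \<phi> by (simp add: ip_final_state[OF C] inp_combination ip_add_left ip_scaleR_left)
qed

lemma final_state_series:
  assumes C: "bounded_inp T C"
    and "\<And>n. w n \<in> L2_on UNIV" "\<And>n. sq_norm (w n) \<le> 1" "\<And>n. \<bar>e n\<bar> \<le> (1/2) ^ n"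
  shows "\<exists>u\<in>L2_on UNIV. \<forall>\<phi>\<in>Dstar. (\<lambda>n. e n *\<^sub>R ip (final_state T (w n)) \<phi>) sums ip (final_state T u) \<phi>"
  using inp_series[of w e T] assms by (auto simp: ip_final_state[OF C])

end

section \<open>Transfer of admissibility and observability\<close>

context perturbed_control
begin

lemma K_orbit_bound:
  obtains c where "0 \<le> c" "\<And>\<sigma> x. 0 \<le> \<sigma> \<Longrightarrow> \<sigma> \<le> T \<Longrightarrow> norm (P \<sigma> (K x)) \<le> c * norm x"
proof -
  obtain N where N: "N \<ge> 1" "\<And>s x. 0 \<le> s \<Longrightarrow> s \<le> T \<Longrightarrow> norm (P s x) \<le> N * norm x"
    using P.local_bound[of T] by metis
  obtain k where k: "0 \<le> k" "\<And>x. norm (K x) \<le> k * norm x" using Kstar_bound by metis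
  have "norm (P \<sigma> (K x)) \<le> (N * k) * norm x" if "0 \<le> \<sigma>" "\<sigma> \<le> T" for \<sigma> x
    using order_trans[OF N(2)[OF that, of "K x"] mult_left_mono[OF k(2)[of x], of N]] N(1) by simp
  then show ?thesis using that[of "N * k"] N(1) k(1) by simp
qed

text \<open>The comparison bounds the difference of the two inputs by the norm of
  \<open>\<phi>\<close> in H, and this carries admissibility over to the perturbed system.\<close>

lemma perturbed_bounded_inp:
  assumes T: "0 \<le> T" and C: "X0.bounded_inp T C"
  shows "\<exists>C'. XK.bounded_inp T C'"
proof -
  obtain M where M: "1 \<le> M" and cmp: "\<And>T C u \<phi> m. u \<in> L2_on UNIV \<Longrightarrow> sq_norm u \<le> 1 \<Longrightarrow> 0 \<le> T \<Longrightarrow>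
      X0.bounded_inp T C \<Longrightarrow> \<phi> \<in> Dstar \<Longrightarrow>
      (\<And>\<sigma> (x :: 'h). 0 \<le> \<sigma> \<Longrightarrow> \<sigma> \<le> T \<Longrightarrow> norm x \<le> M * C \<Longrightarrow> rip (P \<sigma> (K x)) \<phi> \<le> m) \<Longrightarrow>
      (XK.inp T u \<phi> - X0.inp T u \<phi>) \<bullet> 1 \<le> T * m" using comparison by blast
  obtain c where c: "0 \<le> c" "\<And>\<sigma> x. 0 \<le> \<sigma> \<Longrightarrow> \<sigma> \<le> T \<Longrightarrow> norm (P \<sigma> (K x)) \<le> c * norm x"
    using K_orbit_bound[of T] by metis
  have C0: "0 \<le> C" using C by (simp add: X0.bounded_inp_def)
  have "norm (XK.inp T u \<phi>) \<le> (C + T * (c * (M * C))) * norm \<phi>"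
    if u: "u \<in> L2_on UNIV" "sq_norm u \<le> 1" and \<phi>: "\<phi> \<in> Dstar" for u \<phi>
  proof -
    have "norm (XK.inp T u \<phi> - X0.inp T u \<phi>) \<le> T * (c * (M * C) * norm \<phi>)"
    proof (rule norm_le_if_inner_1_le)
      fix a :: 'k assume a: "norm a = 1"
      \<comment> \<open>The comparison sees only real parts; rotating \<open>\<phi>\<close> by unit
        scalars recovers the norm. Inputs are conjugate-linear in \<open>\<phi>\<close>, hence
        \<open>kcnj a\<close>.\<close>
      have "(XK.inp T u (scal (kcnj a) \<phi>) - X0.inp T u (scal (kcnj a) \<phi>)) \<bullet> 1 \<le> T * (c * (M * C) * norm \<phi>)"
      proof (rule cmp[OF u T C Dstar_scal[OF \<phi>]])
        fix \<sigma> and x :: 'h assume "0 \<le> \<sigma>" "\<sigma> \<le> T" "norm x \<le> M * C"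
        then have "norm (P \<sigma> (K x)) \<le> c * (M * C)"
          using c(2)[of \<sigma> x] mult_left_mono[of "norm x" "M * C" c] c(1) by linarith
        then have "norm (P \<sigma> (K x)) * norm (scal (kcnj a) \<phi>) \<le> c * (M * C) * norm \<phi>"
          using a by (simp add: mult_right_mono)
        then show "rip (P \<sigma> (K x)) (scal (kcnj a) \<phi>) \<le> c * (M * C) * norm \<phi>"
          using rip_le[of "P \<sigma> (K x)" "scal (kcnj a) \<phi>"] by linarith
      qed
      then show "(a * (XK.inp T u \<phi> - X0.inp T u \<phi>)) \<bullet> 1 \<le> T * (c * (M * C) * norm \<phi>)"
        by (simp add: XK.inp_scal[OF u(1) \<phi>] X0.inp_scal[OF u(1) \<phi>] right_diff_distrib)
    qed (use T c(1) M C0 in simp)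
    moreover have "norm (X0.inp T u \<phi>) \<le> C * norm \<phi>" using C u \<phi> by (simp add: X0.bounded_inp_def)
    ultimately show ?thesis
      using norm_triangle_sub[of "XK.inp T u \<phi>" "X0.inp T u \<phi>"] by (simp add: distrib_right)
  qed
  moreover have "0 \<le> C + T * (c * (M * C))" using T c(1) M C0 by simp
  ultimately show ?thesis unfolding XK.bounded_inp_def by blast
qed

text \<open>Observability concerns all vectors of H, not only \<open>Dstar\<close>. Replacing
  \<open>\<phi>\<close> by an approximation in \<open>Dstar\<close> worsens \<open>m\<close> by a
  multiple of the approximation error, which vanishes in the limit.\<close>

lemma comparison_states:
  obtains M where "1 \<le> M" "\<And>T C C' u \<phi> m. u \<in> L2_on UNIV \<Longrightarrow> sq_norm u \<le> 1 \<Longrightarrow> 0 \<le> T \<Longrightarrow>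
    X0.bounded_inp T C \<Longrightarrow> XK.bounded_inp T C' \<Longrightarrow>
    (\<And>\<sigma> (x :: 'h). 0 \<le> \<sigma> \<Longrightarrow> \<sigma> \<le> T \<Longrightarrow> norm x \<le> M * C \<Longrightarrow> rip (P \<sigma> (K x)) \<phi> \<le> m) \<Longrightarrow>
    rip (XK.final_state T u - X0.final_state T u) \<phi> \<le> T * m"
proof -
  obtain M where M: "1 \<le> M" and cmp: "\<And>T C u \<phi> m. u \<in> L2_on UNIV \<Longrightarrow> sq_norm u \<le> 1 \<Longrightarrow> 0 \<le> T \<Longrightarrow>
      X0.bounded_inp T C \<Longrightarrow> \<phi> \<in> Dstar \<Longrightarrow>
      (\<And>\<sigma> (x :: 'h). 0 \<le> \<sigma> \<Longrightarrow> \<sigma> \<le> T \<Longrightarrow> norm x \<le> M * C \<Longrightarrow> rip (P \<sigma> (K x)) \<phi> \<le> m) \<Longrightarrow>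
      (XK.inp T u \<phi> - X0.inp T u \<phi>) \<bullet> 1 \<le> T * m" using comparison by blast
  have "rip (XK.final_state T u - X0.final_state T u) \<phi> \<le> T * m"
    if u: "u \<in> L2_on UNIV" "sq_norm u \<le> 1" and T: "0 \<le> T" and C: "X0.bounded_inp T C" and C': "XK.bounded_inp T C'"
      and m: "\<And>\<sigma> x. 0 \<le> \<sigma> \<Longrightarrow> \<sigma> \<le> T \<Longrightarrow> norm x \<le> M * C \<Longrightarrow> rip (P \<sigma> (K x)) \<phi> \<le> m" for T C C' u \<phi> m
  proof -
    obtain c where c: "0 \<le> c" "\<And>\<sigma> x. 0 \<le> \<sigma> \<Longrightarrow> \<sigma> \<le> T \<Longrightarrow> norm (P \<sigma> (K x)) \<le> c * norm x"
      using K_orbit_bound[of T] by metis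
    define z where "z = XK.final_state T u - X0.final_state T u"
    obtain \<psi> where \<psi>: "\<And>n. \<psi> n \<in> Dstar" "\<psi> \<longlonglongrightarrow> \<phi>"
      using Dstar_dense closure_sequential[of \<phi> Dstar] by auto
    have "rip z (\<psi> n) \<le> T * (m + c * (M * C) * norm (\<psi> n - \<phi>))" for n
    proof -
      have "rip z (\<psi> n) = (XK.inp T u (\<psi> n) - X0.inp T u (\<psi> n)) \<bullet> 1"
        unfolding z_def using XK.ip_final_state[OF C' u(1) \<psi>(1)] X0.ip_final_state[OF C u(1) \<psi>(1)]
        by (simp add: ip_diff_left)
      also have "\<dots> \<le> T * (m + c * (M * C) * norm (\<psi> n - \<phi>))"
      proof (rule cmp[OF u T C \<psi>(1)])
        fix \<sigma> and x :: 'h assume x: "0 \<le> \<sigma>" "\<sigma> \<le> T" "norm x \<le> M * C"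
        have "rip (P \<sigma> (K x)) (\<psi> n - \<phi>) \<le> norm (P \<sigma> (K x)) * norm (\<psi> n - \<phi>)" by (rule rip_le)
        also have "\<dots> \<le> (c * (M * C)) * norm (\<psi> n - \<phi>)"
          using order_trans[OF c(2)[OF x(1,2)] mult_left_mono[OF x(3) c(1)]] by (intro mult_right_mono) auto
        finally show "rip (P \<sigma> (K x)) (\<psi> n) \<le> m + c * (M * C) * norm (\<psi> n - \<phi>)"
          using m[OF x] by (simp add: ip_diff_right inner_diff_left)
      qed
      finally show ?thesis .
    qed
    moreover have "(\<lambda>n. rip z (\<psi> n)) \<longlonglongrightarrow> rip z \<phi>" by (intro tendsto_intros tendsto_ip \<psi>)
    moreover have "(\<lambda>n. T * (m + c * (M * C) * norm (\<psi> n - \<phi>))) \<longlonglongrightarrow> T * (m + c * (M * C) * norm (\<phi> - \<phi>))"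
      by (intro tendsto_intros \<psi>)
    ultimately have "rip z \<phi> \<le> T * (m + c * (M * C) * norm (\<phi> - \<phi>))"
      by (intro LIMSEQ_le[of "\<lambda>n. rip z (\<psi> n)"]) auto
    then show ?thesis by (simp add: z_def)
  qed
  then show ?thesis using that[OF M] by blast
qed

text \<open>The compact set \<open>{P(\<sigma>) K x}\<close> is covered by finitely many small balls around reachable states, so
  the compact part of the observability inequality costs only a small multiple of \<open>\<parallel>\<phi>\<parallel>\<close>.\<close>

lemma perturbed_surjective:
  assumes T: "0 \<le> T" and C: "X0.bounded_inp T C" and C': "XK.bounded_inp T C'" and K: "compact_operator K"
    and surj: "\<And>y. \<exists>u\<in>L2_on UNIV. X0.final_state T u = y"
    and dense: "\<And>y e. 0 < e \<Longrightarrow> \<exists>u\<in>L2_on UNIV. norm (XK.final_state T u - y) \<le> e"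
  shows "\<exists>u\<in>L2_on UNIV. XK.final_state T u = y"
proof -
  let ?h0 = "X0.final_state T" and ?hK = "XK.final_state T"
  have sc0: "?h0 (\<lambda>s. c *\<^sub>R u s) = c *\<^sub>R ?h0 u" if "u \<in> L2_on UNIV" for u c
    using X0.final_state_combination[OF C that that, of c 0] by simp
  have scK: "?hK (\<lambda>s. c *\<^sub>R u s) = c *\<^sub>R ?hK u" if "u \<in> L2_on UNIV" for u c
    using XK.final_state_combination[OF C' that that, of c 0] by simp
  obtain C0 where C0: "0 \<le> C0" "\<And>\<phi> m. (\<forall>u\<in>L2_on UNIV. sq_norm u \<le> 1 \<longrightarrow> rip (?h0 u) \<phi> \<le> m) \<Longrightarrow> norm \<phi> \<le> C0 * m"
    using observable_if_surjective[of ?h0, OF sc0 surj] by blast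
  obtain M where M: "1 \<le> M" and cmp: "\<And>T C C' u \<phi> m. u \<in> L2_on UNIV \<Longrightarrow> sq_norm u \<le> 1 \<Longrightarrow> 0 \<le> T \<Longrightarrow>
      X0.bounded_inp T C \<Longrightarrow> XK.bounded_inp T C' \<Longrightarrow>
      (\<And>\<sigma> (x :: 'h). 0 \<le> \<sigma> \<Longrightarrow> \<sigma> \<le> T \<Longrightarrow> norm x \<le> M * C \<Longrightarrow> rip (P \<sigma> (K x)) \<phi> \<le> m) \<Longrightarrow>
      rip (XK.final_state T u - X0.final_state T u) \<phi> \<le> T * m" using comparison_states by blast
  \<comment> \<open>The image of a product of compact sets under the jointly continuous action of
    \<open>P\<close>; the radius \<open>M * C\<close> is the one demanded by the comparison.\<close>
  define Q where "Q = (\<lambda>z. P (fst z) (snd z)) ` ({0..T} \<times> closure (K ` cball 0 (M * C)))"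
  have "compact (closure (K ` cball 0 (M * C)))" using K by (auto simp: compact_operator_def)
  then have Q: "compact Q"
    unfolding Q_def
    by (intro compact_continuous_image P.continuous_on_S continuous_intros compact_Times) auto
  have in_Q: "P \<sigma> (K x) \<in> Q" if "0 \<le> \<sigma>" "\<sigma> \<le> T" "norm x \<le> M * C" for \<sigma> x
    unfolding Q_def using that closure_subset[of "K ` cball 0 (M * C)"]
    by (intro image_eqI[of _ _ "(\<sigma>, K x)"]) auto
  \<comment> \<open>Chosen to make \<open>C0 * T * \<epsilon>\<close> at most 1/2; the added 1
    covers \<open>C0 * T = 0\<close>.\<close>
  define \<epsilon> where "\<epsilon> = 1 / (2 * (C0 * T + 1))"
  have \<epsilon>: "0 < \<epsilon>" "C0 * T * \<epsilon> \<le> 1 / 2"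
  proof -
    have pos: "C0 * T + 1 > 0" using C0(1) T by (intro add_nonneg_pos mult_nonneg_nonneg) auto
    then show "0 < \<epsilon>" by (simp add: \<epsilon>_def)
    show "C0 * T * \<epsilon> \<le> 1 / 2" using pos by (simp add: \<epsilon>_def divide_simps)
  qed
  obtain F where F: "finite F" "F \<subseteq> Q" "Q \<subseteq> (\<Union>x\<in>F. ball x (\<epsilon> / 2))"
  proof (rule compactE_image[OF Q, of Q "\<lambda>x. ball x (\<epsilon> / 2)"])
    show "Q \<subseteq> (\<Union>x\<in>Q. ball x (\<epsilon> / 2))" using \<epsilon>(1) by force
  qed auto
  \<comment> \<open>One half of \<open>\<epsilon>\<close> is spent on the covering, the other on
    nearly reaching the centre \<open>z\<close>.\<close>
  obtain w where w: "\<And>z. w z \<in> L2_on UNIV" "\<And>z. norm (?hK (w z) - z) \<le> \<epsilon> / 2"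
    using dense[of "\<epsilon> / 2"] \<epsilon>(1) by (metis half_gt_zero)
  have sq0: "0 \<le> sq_norm u" for u :: "real \<Rightarrow> 'u"
    unfolding sq_norm_def by (rule Bochner_Integration.integral_nonneg) simp
  \<comment> \<open>Being at least 1, \<open>\<mu>\<close> is at most its square, so division by
    \<open>\<mu>\<close> moves every \<open>w z\<close> with \<open>z\<close> in \<open>F\<close>
    into the unit ball.\<close>
  define \<mu> where "\<mu> = 1 + (\<Sum>z\<in>F. sq_norm (w z))"
  have \<mu>: "1 \<le> \<mu>" by (simp add: \<mu>_def sum_nonneg sq0)
  have w\<mu>: "sq_norm (w z) \<le> \<mu>\<^sup>2" if "z \<in> F" for z
  proof -
    have "sq_norm (w z) \<le> (\<Sum>z\<in>F. sq_norm (w z))" using F(1) that sq0 by (intro member_le_sum) auto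
    also have "\<dots> \<le> \<mu>" by (simp add: \<mu>_def)
    also have "\<mu> \<le> \<mu>\<^sup>2" using \<mu> by (simp add: power2_eq_square)
    finally show ?thesis .
  qed
  have obs: "norm \<phi> \<le> (2 * C0 * (1 + T * \<mu>)) * m"
    if m: "\<forall>u\<in>L2_on UNIV. sq_norm u \<le> 1 \<longrightarrow> rip (?hK u) \<phi> \<le> m" for \<phi> m
  proof -
    have q: "rip q \<phi> \<le> \<mu> * m + \<epsilon> * norm \<phi>" if "q \<in> Q" for q
    proof -
      obtain z where z: "z \<in> F" "dist z q < \<epsilon> / 2" using F(3) \<open>q \<in> Q\<close> by auto
      have "norm (q - ?hK (w z)) \<le> \<epsilon>"
        using norm_triangle_ineq4[of "q - z" "?hK (w z) - z"] z(2) w(2)[of z]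
        by (simp add: dist_norm norm_minus_commute)
      then have "rip (q - ?hK (w z)) \<phi> \<le> \<epsilon> * norm \<phi>"
        using rip_le[of "q - ?hK (w z)" \<phi>] mult_right_mono[of _ \<epsilon> "norm \<phi>"] by fastforce
      moreover have "rip (?hK (\<lambda>s. (1 / \<mu>) *\<^sub>R w z s)) \<phi> \<le> m"
        using m L2_scale[OF w(1), of "1 / \<mu>" z] w\<mu>[OF z(1)] \<mu> by (simp add: power_divide)
      then have "rip (?hK (w z)) \<phi> \<le> \<mu> * m"
        using \<mu> by (simp add: scK[OF w(1)] ip_scaleR_left field_simps)
      ultimately show ?thesis by (simp add: ip_diff_left inner_diff_left)
    qed
    have "rip (?h0 u) \<phi> \<le> m + T * (\<mu> * m + \<epsilon> * norm \<phi>)" if u: "u \<in> L2_on UNIV" "sq_norm u \<le> 1" for u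
    proof -
      \<comment> \<open>The comparison bounds perturbed minus unperturbed states; the opposite sign
        comes from the control with reversed sign.\<close>
      let ?v = "\<lambda>s. (-1) *\<^sub>R u s"
      have v: "?v \<in> L2_on UNIV" "sq_norm ?v \<le> 1" using L2_scale[OF u(1), of "-1"] u(2) by auto
      have "rip (?hK ?v - ?h0 ?v) \<phi> \<le> T * (\<mu> * m + \<epsilon> * norm \<phi>)"
        by (rule cmp[OF v T C C']) (rule q[OF in_Q])
      then have "rip (?h0 u - ?hK u) \<phi> \<le> T * (\<mu> * m + \<epsilon> * norm \<phi>)"
        unfolding sc0[OF u(1)] scK[OF u(1)] by simp
      moreover have "rip (?hK u) \<phi> \<le> m" using m u by blast
      ultimately show ?thesis by (simp add: ip_diff_left inner_diff_left)
    qed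
    then have "norm \<phi> \<le> C0 * (m + T * (\<mu> * m + \<epsilon> * norm \<phi>))" by (intro C0(2)) blast
    also have "\<dots> = C0 * (1 + T * \<mu>) * m + (C0 * T * \<epsilon>) * norm \<phi>" by (simp add: algebra_simps)
    \<comment> \<open>Half of \<open>norm \<phi>\<close> is absorbed on the left, which doubles the
      constant.\<close>
    also have "\<dots> \<le> C0 * (1 + T * \<mu>) * m + (1 / 2) * norm \<phi>"
      using \<epsilon>(2) by (intro add_left_mono mult_right_mono) auto
    finally show ?thesis by simp
  qed
  show ?thesis
    by (rule surjective_if_observable[of ?hK Dstar, OF XK.final_state_combination[OF C']
          XK.final_state_series[OF C'] Dstar_ip_eqI obs])
qed

end

theorem theorem1p1:
  fixes scal :: "'k::real_or_complex \<Rightarrow> 'h::banach \<Rightarrow> 'h" and ip :: "'h \<Rightarrow> 'h \<Rightarrow> 'k"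
    and scalU :: "'k \<Rightarrow> 'u::banach \<Rightarrow> 'u" and ipU :: "'u \<Rightarrow> 'u \<Rightarrow> 'k"
    and D :: "'h set" and A0 K AK :: "'h \<Rightarrow> 'h" and B :: "'u \<Rightarrow> 'h \<Rightarrow> 'k" and T0 :: real
  assumes H: "hilbert_space scal ip" and U: "hilbert_space scalU ipU"
    and A0: "is_generator scal D A0"
    and B: "admissible scal ip scalU D A0 B"
    and K: "bounded_operator scal K"
    and AK: "AK = (\<lambda>x. A0 x + K x)"
    and T0: "T0 > 0"
    and exact: "exactly_controllable scal ip D A0 B T0"
    and compact: "compact_operator K"
    and approx: "approximately_controllable scal ip D AK B T0"
  shows "is_generator scal D AK \<and> admissible scal ip scalU D AK B \<and>
    exactly_controllable scal ip D AK B T0"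
proof -
  interpret hilbert_space scal ip by (rule H)
  interpret U: hilbert_space scalU ipU by (rule U)
  define S where "S = semigroup_of scal D A0"
  have gen: "generates scal D A0 S"
    using A0 unfolding S_def semigroup_of_def is_generator_def by (rule someI_ex)
  interpret generator scal ip S D A0
    by unfold_locales (use gen in \<open>auto simp: generates_def\<close>)
  have AKgen: "is_generator scal D AK" unfolding AK by (rule bounded_perturbation[OF K])
  define P where "P = semigroup_of scal D AK"
  have genP: "generates scal D (\<lambda>x. A0 x + K x) P"
    using AKgen unfolding P_def semigroup_of_def is_generator_def AK by (rule someI_ex)
  have control: "control_operator scal ip scalU D A0 B" using B by (simp add: admissible_def)
  interpret perturbed_control scal ip S D A0 scalU ipU B P K
    by unfold_locales (use control genP K in \<open>auto simp: generates_def\<close>)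
  have Dstar_AK: "adj_domain ip D AK = Dstar" unfolding AK by (rule perturbed_adjoint(1))
  have pivot_AK: "pivot_embed ip D AK = pivot_embed ip D A0"
    by (simp add: pivot_embed_def[abs_def] Dstar_AK)
  \<comment> \<open>Off \<open>Dstar\<close> the extended operator is zero by definition, while the
    value of \<open>X0.inp\<close> there is arbitrary; hence the case distinction.\<close>
  have inp0: "input_map scal ip D A0 B T u = (\<lambda>\<phi>. if \<phi> \<in> Dstar then X0.inp T u \<phi> else 0)" for T u
    by (auto simp: input_map_def extended_op_def X0.inp_def X0.integrand_def[abs_def]
        set_lebesgue_integral_def fun_eq_iff simp flip: S_def)
  have inpK: "input_map scal ip D AK B T u = (\<lambda>\<phi>. if \<phi> \<in> Dstar then XK.inp T u \<phi> else 0)" for T u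
    by (auto simp: input_map_def extended_op_def XK.inp_def XK.integrand_def[abs_def]
        set_lebesgue_integral_def fun_eq_iff Dstar_AK simp flip: P_def)
  \<comment> \<open>Controls on (0, T0) are continued by zero to the whole line; inputs up to
    \<open>T0\<close> do not see the continuation.\<close>
  let ?ext = "\<lambda>u s. if s \<in> {0<..<T0} then u s else (0 :: 'u)"
  have ext_L2: "?ext u \<in> L2_on UNIV" if "u \<in> L2_on {0<..<T0}" for u
    using that L2_on_extend[of u "{0<..<T0}"] by simp
  obtain T1 where T1: "T1 > 0" "input_map scal ip D A0 B T1 ` L2_on {0<..} \<subseteq> range (pivot_embed ip D A0)"
    using B by (auto simp: admissible_def)
  \<comment> \<open>Admissibility is given at some time \<open>T1\<close>; the uniform bound
    obtained there is then transported to \<open>T0\<close>.\<close>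
  have "\<exists>h. \<forall>\<phi>\<in>Dstar. X0.inp T1 u \<phi> = ip h \<phi>" if "u \<in> L2_on UNIV" for u
  proof -
    have "u \<in> L2_on {0<..}" using that by (rule L2_on_subset) simp
    then obtain h where "pivot_embed ip D A0 h = input_map scal ip D A0 B T1 u"
      using T1(2) by (metis image_subset_iff rangeE)
    then show ?thesis unfolding inp0 X0.pivot_embed_eq_iff by metis
  qed
  then obtain C1 where "X0.bounded_inp T1 C1" using X0.bounded_inp_if_representable by blast
  then obtain C where C: "X0.bounded_inp T0 C" using X0.bounded_inp_all[OF T1(1)] by blast
  obtain C' where C': "XK.bounded_inp T0 C'" using perturbed_bounded_inp[OF _ C] T0 by auto
  have "input_map scal ip D AK B T0 u \<in> range (pivot_embed ip D AK)" if u: "u \<in> L2_on {0<..}" for u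
  proof -
    let ?v = "\<lambda>s. if s \<in> {0<..} then u s else 0"
    have v: "?v \<in> L2_on UNIV" using u L2_on_extend by blast
    obtain h where h: "\<forall>\<phi>\<in>Dstar. XK.inp T0 ?v \<phi> = ip h \<phi>" using XK.inp_representable[OF C' v] by blast
    have "XK.inp T0 u = XK.inp T0 ?v" by (intro ext XK.inp_cong) simp
    then have "pivot_embed ip D AK h = input_map scal ip D AK B T0 u"
      unfolding inpK pivot_AK X0.pivot_embed_eq_iff using h by simp
    then show ?thesis by (metis rangeI)
  qed
  moreover have "control_operator scal ip scalU D AK B" unfolding AK by (rule perturbed_control_operator)
  ultimately have adm: "admissible scal ip scalU D AK B" using T0 by (auto simp: admissible_def)
  have sol0: "solution scal ip D A0 B y0 u T0 = S T0 y0 + X0.final_state T0 (?ext u)" for y0 u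
  proof -
    have eq: "X0.inp T0 (?ext u) = X0.inp T0 u" by (intro ext X0.inp_cong) simp
    show ?thesis unfolding solution_def S_def[symmetric] inp0 X0.final_state_def eq ..
  qed
  have solK: "solution scal ip D AK B y0 u T0 = P T0 y0 + XK.final_state T0 (?ext u)" for y0 u
  proof -
    have eq: "XK.inp T0 (?ext u) = XK.inp T0 u" by (intro ext XK.inp_cong) simp
    show ?thesis unfolding solution_def P_def[symmetric] inpK pivot_AK XK.final_state_def eq ..
  qed
  have surj0: "\<exists>u\<in>L2_on UNIV. X0.final_state T0 u = y" for y
  proof -
    obtain u where u: "u \<in> L2_on {0<..<T0}" "solution scal ip D A0 B 0 u T0 = y"
      using exact by (auto simp: exactly_controllable_def)
    then show ?thesis
      using ext_L2[OF u(1)] linear_0[OF bounded_linear.linear[OF S_linear[of T0]]] T0 unfolding sol0 by auto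
  qed
  have denseK: "\<exists>u\<in>L2_on UNIV. norm (XK.final_state T0 u - y) \<le> e" if "0 < e" for y e
  proof -
    obtain u where u: "u \<in> L2_on {0<..<T0}" "norm (solution scal ip D AK B 0 u T0 - y) \<le> e"
      using approx \<open>0 < e\<close> unfolding approximately_controllable_def by metis
    then show ?thesis
      using ext_L2[OF u(1)] linear_0[OF bounded_linear.linear[OF P.S_linear[of T0]]] T0 unfolding solK by auto
  qed
  have "exactly_controllable scal ip D AK B T0"
    unfolding exactly_controllable_def
  proof (intro allI)
    fix y0 y1
    \<comment> \<open>The free evolution of \<open>y0\<close> is subtracted from the target, leaving
      a state to be reached from zero.\<close>
    obtain u where u: "u \<in> L2_on UNIV" "XK.final_state T0 u = y1 - P T0 y0"
      using perturbed_surjective[OF less_imp_le[OF T0] C C' compact surj0 denseK] by blast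
    have "XK.inp T0 (?ext u) = XK.inp T0 u" by (intro ext XK.inp_cong) simp
    then have "XK.final_state T0 (?ext u) = XK.final_state T0 u" by (simp only: XK.final_state_def)
    then have "solution scal ip D AK B y0 u T0 = y1" unfolding solK using u(2) by simp
    moreover have "u \<in> L2_on {0<..<T0}" using u(1) by (rule L2_on_subset) simp
    ultimately show "\<exists>u\<in>L2_on {0<..<T0}. solution scal ip D AK B y0 u T0 = y1" by blast
  qed
  then show ?thesis using AKgen adm by blast
qed

end
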